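(* Let $\nu>0$. The embedding $LG^\gamma(\mathbb T)\to\exp L^\nu(\mathbb T)$ is compact if either $\gamma>1/2$ and $\nu<2$, or $\nu\ge2$ and $\gamma>1-\nu^{-1}$. Moreover the entropy numbers satisfy the following, for integers $n\ge2$. (i) If $\gamma>1/2$ and $\nu<2$, then $e_n(LG^\gamma,\exp L^\nu)\approx(\log n)^{1/2-\gamma}$. (ii) If $\nu\ge2$ and $\gamma>1-\nu^{-1}$, then $e_n(LG^\gamma,\exp L^\nu)\approx(\log n)^{1-\gamma-1/\nu}$. Here $A_n\approx B_n$ means that there are positive constants $c,C$ independent of $n$ (they may depend on $\gamma,\nu$) with $cB_n\le A_n\le CB_n$ for all $n\ge2$.
   Context: $\mathbb T=\mathbb R/\mathbb Z$, identified with $[0,1)$ with Lebesgue measure; functions on $\mathbb T$ are $1$-periodic functions on $\mathbb R$. For $\nu>0$, $\exp L^\nu(\mathbb T)$ is the space of measurable functions with finite norm $\|f\|_{\exp L^\nu(\mathbb T)}=\sup_{1\le p<\infty}p^{-1/\nu}\|f\|_{L^p(\mathbb T)}$. Fix an even $C^\infty$ function $\Phi=\phi_0$ on $\mathbb R$ with $\Phi(s)=1$ for $|s|\le 1$ and $\Phi$ supported in $(-2,2)$. For $k\ge1$ set $\phi_k(s)=\Phi(2^{-k}s)-\Phi(2^{-k+1}s)$, and for $k\ge 0$ set $L_kf(x)=\sum_{n\in\mathbb Z}\phi_k(n)\widehat f(n)e^{2\pi i n x}$, where $\widehat f(n)$ are the Fourier coefficients of $f$. For $\gamma>1/2$, $LG^\gamma(\mathbb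 T)$ is the class of $f\in L^1(\mathbb T)$ with $\|f\|_{LG^\gamma(\mathbb T)}=\sup_{k\ge0}(1+k)^\gamma\|L_kf\|_\infty<\infty$. For a Banach space $X$ and a subspace $Y\subset X$ with its own norm $\|\cdot\|_Y$, the $n$th entropy number $e_n(Y;X)$ (also written $e_n(Y,X)$) is the infimum of all $\varepsilon>0$ for which there are $2^{n-1}$ balls of radius $\varepsilon$ in $X$ covering the unit ball $\{y\in Y:\|y\|_Y\le1\}$. *)

theory Defs
  imports "HOL-Probability.Essential_Supremum"
begin

section \<open>Functions on the torus\<close>

text \<open>A function on \<open>\<real>/\<int>\<close> is a 1-periodic complex-valued function on \<open>\<real>\<close>; integrals are taken
  over the fundamental domain \<open>[0,1)\<close>. Function spaces are sets of functions rather than of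
  a.e.-classes, so their norms are in fact seminorms: functions that agree a.e. have distance 0.
  Norms take values in \<^typ>\<open>ennreal\<close>, with \<open>\<infinity>\<close> for functions outside the space.\<close>

abbreviation torus :: "real measure" where
  "torus \<equiv> lebesgue_on {0..<1}"

definition periodic1 :: "(real \<Rightarrow> complex) \<Rightarrow> bool" where
  "periodic1 f \<longleftrightarrow> (\<forall>x. f (x + 1) = f x)"

definition Lp_norm :: "real \<Rightarrow> (real \<Rightarrow> complex) \<Rightarrow> ennreal" where
  "Lp_norm p f =
     (let I = (\<integral>\<^sup>+ x. ennreal (norm (f x) powr p) \<partial>torus)
      in if I = \<infinity> then \<infinity> else ennreal (enn2real I powr (1 / p)))"

definition Linf_norm :: "(real \<Rightarrow> complex) \<Rightarrow> ennreal" where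
  "Linf_norm f = esssup torus (\<lambda>x. ennreal (norm (f x)))"

definition fourier_coeff :: "(real \<Rightarrow> complex) \<Rightarrow> int \<Rightarrow> complex" where
  "fourier_coeff f n = (\<integral> x. f x * exp (- 2 * of_real pi * \<i> * of_int n * of_real x) \<partial>torus)"

section \<open>The space \<open>exp L\<^sup>\<nu>\<close>\<close>

definition expL_norm :: "real \<Rightarrow> (real \<Rightarrow> complex) \<Rightarrow> ennreal" where
  "expL_norm \<nu> f = (SUP p\<in>{1..}. ennreal (p powr (- 1 / \<nu>)) * Lp_norm p f)"

definition expL :: "real \<Rightarrow> (real \<Rightarrow> complex) set" where
  "expL \<nu> = {f. periodic1 f \<and> f \<in> borel_measurable torus \<and> expL_norm \<nu> f < \<infinity>}"

section \<open>The class \<open>LG\<^sup>\<gamma>\<close>\<close>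

definition smooth :: "(real \<Rightarrow> real) \<Rightarrow> bool" where
  "smooth g \<longleftrightarrow> (\<forall>n x. (deriv ^^ n) g differentiable (at x))"

definition admissible_cutoff :: "(real \<Rightarrow> real) \<Rightarrow> bool" where
  "admissible_cutoff \<Phi> \<longleftrightarrow>
     smooth \<Phi> \<and> (\<forall>s. \<Phi> (- s) = \<Phi> s) \<and> (\<forall>s. \<bar>s\<bar> \<le> 1 \<longrightarrow> \<Phi> s = 1) \<and>
     closure {s. \<Phi> s \<noteq> 0} \<subseteq> {-2<..<2}"

definition dyadic_cutoff :: "(real \<Rightarrow> real) \<Rightarrow> nat \<Rightarrow> real \<Rightarrow> real" where
  "dyadic_cutoff \<Phi> k s =
     (if k = 0 then \<Phi> s
      else \<Phi> (2 powr (- real k) * s) - \<Phi> (2 powr (- real k + 1) * s))"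

text \<open>For an admissible cutoff only finitely many terms of the following sum are nonzero.\<close>

definition LP_piece :: "(real \<Rightarrow> real) \<Rightarrow> nat \<Rightarrow> (real \<Rightarrow> complex) \<Rightarrow> real \<Rightarrow> complex" where
  "LP_piece \<Phi> k f x =
     (\<Sum>\<^sub>\<infinity>n\<in>(UNIV :: int set). of_real (dyadic_cutoff \<Phi> k (of_int n)) * fourier_coeff f n *
        exp (2 * of_real pi * \<i> * of_int n * of_real x))"

definition LG_norm :: "(real \<Rightarrow> real) \<Rightarrow> real \<Rightarrow> (real \<Rightarrow> complex) \<Rightarrow> ennreal" where
  "LG_norm \<Phi> \<gamma> f = (SUP k. ennreal ((1 + real k) powr \<gamma>) * Linf_norm (LP_piece \<Phi> k f))"

definition LG :: "(real \<Rightarrow> real) \<Rightarrow> real \<Rightarrow> (real \<Rightarrow> complex) set" where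
  "LG \<Phi> \<gamma> = {f. periodic1 f \<and> integrable torus f \<and> LG_norm \<Phi> \<gamma> f < \<infinity>}"

section \<open>Compact embeddings and entropy numbers\<close>

text \<open>A space is given by its carrier \<open>X\<close> and its norm \<open>NX\<close>.\<close>

definition norm_ball :: "'a::minus set \<Rightarrow> ('a \<Rightarrow> ennreal) \<Rightarrow> 'a \<Rightarrow> real \<Rightarrow> 'a set" where
  "norm_ball X NX c r = {x \<in> X. NX (x - c) \<le> ennreal r}"

definition unit_ball :: "'a set \<Rightarrow> ('a \<Rightarrow> ennreal) \<Rightarrow> 'a set" where
  "unit_ball Y NY = {y \<in> Y. NY y \<le> 1}"

text \<open>Compactness of the inclusion \<open>Y \<rightarrow> X\<close>: the unit ball of \<open>Y\<close> is relatively compact in \<open>X\<close>,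
  stated with sequences so that it is meaningful for seminorms. The limit lies in \<open>X\<close>.\<close>

definition compact_embedding ::
  "'a::minus set \<Rightarrow> ('a \<Rightarrow> ennreal) \<Rightarrow> 'a set \<Rightarrow> ('a \<Rightarrow> ennreal) \<Rightarrow> bool" where
  "compact_embedding Y NY X NX \<longleftrightarrow>
     Y \<subseteq> X \<and>
     (\<forall>u :: nat \<Rightarrow> 'a. (\<forall>j. u j \<in> unit_ball Y NY) \<longrightarrow>
        (\<exists>l\<in>X. \<exists>r :: nat \<Rightarrow> nat. strict_mono r \<and> (\<lambda>j. NX (u (r j) - l)) \<longlonglongrightarrow> 0))"

text \<open>The infimum is taken in \<^typ>\<open>ennreal\<close>, so it is \<open>\<infinity>\<close> if no finite radius is possible.\<close>

definition entropy_number ::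
  "nat \<Rightarrow> 'a::minus set \<Rightarrow> ('a \<Rightarrow> ennreal) \<Rightarrow> 'a set \<Rightarrow> ('a \<Rightarrow> ennreal) \<Rightarrow> ennreal" where
  "entropy_number n Y NY X NX =
     Inf {ennreal \<epsilon> | \<epsilon>. \<epsilon> > 0 \<and>
        (\<exists>c :: nat \<Rightarrow> 'a. (\<forall>i < 2 ^ (n - 1). c i \<in> X) \<and>
           unit_ball Y NY \<subseteq> (\<Union>i < 2 ^ (n - 1). norm_ball X NX (c i) \<epsilon>))}"

definition comparable_from_2 :: "(nat \<Rightarrow> ennreal) \<Rightarrow> (nat \<Rightarrow> real) \<Rightarrow> bool" where
  "comparable_from_2 A B \<longleftrightarrow>
     (\<exists>c>0. \<exists>C>0. \<forall>n\<ge>2. ennreal (c * B n) \<le> A n \<and> A n \<le> ennreal (C * B n))"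

end

theory Submission
  imports Defs "HOL-Probability.Probability_Measure" "HOL-Library.Diagonal_Subsequence"
begin

text \<open>The unit ball of the class consists of sums of pieces \<open>L\<^sub>k f\<close> that live on frequencies
\<open>|n| \<approx> 2^k\<close> and satisfy \<open>|L\<^sub>k f| \<le> (1 + k) powr -\<gamma>\<close>. The size of
such sums is controlled by two estimates. The trivial one adds the sup norms. The other one says that
pieces of widely different frequency behave like independent variables: if \<open>|g\<^sub>k| \<le> a\<^sub>k\<close>,
then \<open>\<Sum>k. g\<^sub>k\<close> is subgaussian with variance of order \<open>\<Sum>k. a\<^sub>k^2\<close>, so its norm
in \<open>L^p\<close> is at most a constant times \<open>sqrt p * sqrt (\<Sum>k. a\<^sub>k^2)\<close>
(\<open>subgaussian_Lp\<close>). For the proof, look at the martingale of averages over dyadic intervals. The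
piece \<open>g\<^sub>k\<close> is nearly constant on intervals much shorter than \<open>2^-k\<close> and oscillates on much
longer ones, so by Bernstein's inequalities it contributes at most a multiple of
\<open>2^-|j-k| a\<^sub>k\<close> to the \<open>j\<close>-th martingale difference; Azuma's inequality does the rest.

Applied to the pieces with \<open>k > K\<close>, this gives a tail of size \<open>K powr (1/2 - \<gamma>)\<close> in
\<open>exp L^\<nu>\<close> for \<open>\<nu> < 2\<close>. For \<open>\<nu> \<ge> 2\<close> the exponent \<open>p\<close> matters: the pieces with
\<open>k \<le> p\<close> are added trivially, those with \<open>k > p\<close> are subgaussian, and the outcome is
\<open>K powr (1 - \<gamma> - 1/\<nu>)\<close> (\<open>shell_tail_expL\<close>). Both rates are written
\<open>K powr -\<beta>\<close> with \<open>\<beta> > 0\<close> the \<open>decay_exponent\<close>.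

The rest is the same for both ranges of \<open>\<nu>\<close>. The first \<open>K\<close> pieces form a trigonometric
polynomial with about \<open>2^K\<close> coefficients, whose possible values are covered by
\<open>exp (C * 4^K)\<close> points of a grid. Only \<open>log n\<close> enters the rate, so this crude count is good
enough: \<open>K \<approx> log n\<close> gives the upper bound for the entropy numbers (\<open>entropy_upper\<close>).
Compactness follows by extracting a subsequence along which all Fourier coefficients converge
(\<open>LG_compact_embedding\<close>).

For the lower bound, multiply a lacunary sum \<open>\<Sum>k\<in>{K<..2K}. exp (2 * pi * i * 2^k * x)\<close> by a sum of
Fejer bumps at a subset \<open>S\<close> of the grid of \<open>2^K\<close> points. After division by a multiple of
\<open>K powr \<gamma>\<close> these functions are in the unit ball. For \<open>\<nu> \<ge> 2\<close> two of them differ by about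
\<open>K powr (1 - \<gamma>)\<close> near a grid point that belongs to one set only, which is visible in
\<open>L^p\<close> with \<open>p = K\<close>; for \<open>\<nu> < 2\<close> they differ by about
\<open>K powr (1/2 - \<gamma>)\<close> in \<open>L^2\<close> provided that the two sets differ on a fixed fraction of the grid.
A Gilbert-Varshamov code provides \<open>2^(2^(K-1))\<close> sets with this property, hence
\<open>entropy_lower\<close>.\<close>

section \<open>Trigonometric sums on the torus\<close>

lemma prob_space_torus: "prob_space torus"
  by (rule prob_spaceI) (simp add: emeasure_restrict_space space_restrict_space)

interpretation torus: prob_space torus
  by (rule prob_space_torus)

lemma space_torus: "space torus = {0..<1}"
  by (simp add: space_restrict_space)

lemma borel_measurable_torus_continuous:
  fixes g :: "real \<Rightarrow> 'b::{second_countable_topology,metric_space}"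
  assumes "continuous_on UNIV g"
  shows "g \<in> borel_measurable torus"
proof -
  have "g \<in> borel_measurable borel" using assms by (rule borel_measurable_continuous_onI)
  then have "g \<in> borel_measurable lebesgue" by (intro measurable_completion) auto
  then show ?thesis by (rule measurable_restrict_space1)
qed

lemma integrable_torus_bounded:
  fixes g :: "real \<Rightarrow> 'b::{second_countable_topology,banach}"
  assumes "g \<in> borel_measurable torus" "\<And>x. x \<in> {0..<1} \<Longrightarrow> norm (g x) \<le> B"
  shows "integrable torus g"
  using assms by (intro torus.integrable_const_bound[of _ B]) (auto intro!: AE_I2 simp: space_torus)

lemma integrable_torus_continuous:
  fixes g :: "real \<Rightarrow> 'b::{second_countable_topology,banach}"
  assumes "continuous_on UNIV g"
  shows "integrable torus g"
proof -
  have "compact (g ` {0..1})"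
    by (intro compact_continuous_image continuous_on_subset[OF assms]) auto
  then obtain B where "\<forall>y\<in>g ` {0..1}. norm y \<le> B"
    using compact_imp_bounded bounded_iff by metis
  then show ?thesis
    by (intro integrable_torus_bounded[of g B] borel_measurable_torus_continuous assms) auto
qed

text \<open>Derivatives and antiderivatives are handled with the gauge integral, norms with the Lebesgue
  integral; for continuous functions the two agree.\<close>

lemma integral_torus_continuous:
  fixes g :: "real \<Rightarrow> 'b::euclidean_space"
  assumes "continuous_on UNIV g"
  shows "integral\<^sup>L torus g = integral {0..1} g"
proof -
  have "integral\<^sup>L torus g = integral {0..<1} g"
    using lebesgue_integral_eq_integral[of "{0..<1}" g] integrable_torus_continuous[OF assms] by simp
  also have "\<dots> = integral {0..1} g"
  proof (rule integral_subset_negligible)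
    have "{0..1} - {0..<1::real} = {1}" by auto
    then show "negligible ({0..1} - {0..<1::real})" by simp
  qed auto
  finally show ?thesis .
qed

definition echar :: "int \<Rightarrow> real \<Rightarrow> complex" where
  "echar n x = cis (2 * pi * of_int n * x)"

lemma norm_echar [simp]: "norm (echar n x) = 1"
  by (simp add: echar_def)

lemma echar_zero [simp]: "echar 0 x = 1" "echar n 0 = 1"
  by (simp_all add: echar_def)

lemma echar_add: "echar (m + n) x = echar m x * echar n x"
  by (simp add: echar_def cis_mult algebra_simps)

lemma echar_add_arg: "echar n (x + y) = echar n x * echar n y"
  by (simp add: echar_def cis_mult algebra_simps)

lemma cnj_echar: "cnj (echar n x) = echar (- n) x"
  by (simp add: echar_def cis_cnj)

lemma echar_minus_arg: "echar n (- x) = echar (- n) x"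
  by (simp add: echar_def)

lemma echar_nat [simp]: "echar n (of_nat k) = 1"
  using cis_multiple_2pi[of "of_int n * of_nat k"]
  by (simp add: echar_def mult.assoc Ints_mult)

lemma echar_periodic [simp]: "echar n (x + 1) = echar n x"
  using echar_nat[of n 1] by (simp add: echar_add_arg)

lemma echar_mult_cnj [simp]: "echar n x * cnj (echar n x) = 1"
  by (simp add: cnj_echar flip: echar_add)

lemma continuous_on_echar [continuous_intros]:
  "continuous_on S f \<Longrightarrow> continuous_on S (\<lambda>x. echar n (f x))"
  unfolding echar_def by (intro continuous_intros)

lemma has_vector_derivative_echar:
  "(echar n has_vector_derivative (2 * of_real pi * \<i> * of_int n * echar n x)) (at x within S)"
  unfolding echar_def cis_conv_exp
  by (auto intro!: derivative_eq_intros has_vector_derivative_real_field simp: algebra_simps)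

lemma integral_echar: "integral {0..1} (echar n) = (if n = 0 then 1 else 0)"
proof (cases "n = 0")
  case True
  have "echar 0 = (\<lambda>x. 1)" by (simp add: fun_eq_iff)
  then show ?thesis using True by simp
next
  case False
  let ?d = "2 * of_real pi * \<i> * of_int n :: complex"
  have d: "?d \<noteq> 0" using False by simp
  have "((\<lambda>x. echar n x / ?d) has_vector_derivative echar n x) (at x within {0..1})" for x
    using has_vector_derivative_divide[OF has_vector_derivative_echar[of n x "{0..1}"], of ?d] d by simp
  then have "(echar n has_integral (echar n 1 / ?d - echar n 0 / ?d)) {0..1}"
    by (intro fundamental_theorem_of_calculus) auto
  moreover have "echar n 1 = 1" using echar_nat[of n 1] by simp
  ultimately show ?thesis using False by (auto dest: integral_unique)
qed

lemma integral_torus_echar: "integral\<^sup>L torus (echar n) = (if n = 0 then 1 else 0)"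
  using integral_torus_continuous[of "echar n"] integral_echar
  by (simp add: continuous_on_echar)

text \<open>The index set is arbitrary, so that spectral localisation can be read off from it.\<close>

definition tsum :: "int set \<Rightarrow> (int \<Rightarrow> complex) \<Rightarrow> real \<Rightarrow> complex" where
  "tsum A c x = (\<Sum>n\<in>A. c n * echar n x)"

lemma tsum_periodic [simp]: "tsum A c (x + 1) = tsum A c x"
  by (simp add: tsum_def)

lemma periodic1_tsum: "periodic1 (tsum A c)"
  by (simp add: periodic1_def)

lemma continuous_on_tsum [continuous_intros]:
  "continuous_on S f \<Longrightarrow> continuous_on S (\<lambda>x. tsum A c (f x))"
  unfolding tsum_def by (intro continuous_intros)

lemma continuous_tsum: "continuous_on S (tsum A c)"
  using continuous_on_tsum[of S "\<lambda>x. x"] by (simp add: continuous_on_id)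

lemma tsum_mono_neutral:
  assumes "finite B" "A \<subseteq> B" "\<And>n. n \<in> B - A \<Longrightarrow> c n = 0"
  shows "tsum A c x = tsum B c x"
  unfolding tsum_def using assms by (intro sum.mono_neutral_left) auto

lemma norm_tsum_le: "norm (tsum A c x) \<le> (\<Sum>n\<in>A. norm (c n))"
  unfolding tsum_def by (intro order_trans[OF norm_sum]) (simp add: norm_mult)

lemma tsum_diff: "tsum A (\<lambda>n. c n - d n) x = tsum A c x - tsum A d x"
  by (simp add: tsum_def sum_subtractf algebra_simps)

lemma fourier_coeff_echar: "fourier_coeff f n = (\<integral>x. f x * echar (- n) x \<partial>torus)"
  by (simp add: fourier_coeff_def echar_def cis_conv_exp algebra_simps)

lemma integrable_times_echar:
  assumes "integrable torus f"
  shows "integrable torus (\<lambda>x. f x * echar n x)"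
proof (rule Bochner_Integration.integrable_bound[OF assms])
  show "(\<lambda>x. f x * echar n x) \<in> borel_measurable torus"
    by (intro borel_measurable_times borel_measurable_integrable assms
        borel_measurable_torus_continuous continuous_intros)
qed (simp add: norm_mult)

text \<open>Orthogonality of the characters.\<close>

lemma fourier_coeff_tsum:
  assumes "finite A"
  shows "fourier_coeff (tsum A c) n = (if n \<in> A then c n else 0)"
proof -
  have "fourier_coeff (tsum A c) n = (\<integral>x. (\<Sum>k\<in>A. c k * echar (k - n) x) \<partial>torus)"
    by (simp add: fourier_coeff_echar tsum_def sum_distrib_right mult.assoc flip: echar_add)
  also have "\<dots> = (\<Sum>k\<in>A. c k * integral\<^sup>L torus (echar (k - n)))"
    by (subst Bochner_Integration.integral_sum)
       (auto intro!: integrable_torus_continuous continuous_intros)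
  also have "\<dots> = (\<Sum>k\<in>A. if k = n then c k else 0)"
    by (intro sum.cong) (auto simp: integral_torus_echar)
  also have "\<dots> = (if n \<in> A then c n else 0)" using assms by (simp add: sum.delta)
  finally show ?thesis .
qed

lemma norm_fourier_coeff_le:
  assumes "integrable torus f"
  shows "norm (fourier_coeff f n) \<le> (\<integral>x. norm (f x) \<partial>torus)"
  unfolding fourier_coeff_echar
  by (rule order_trans[OF integral_norm_bound]) (simp add: norm_mult)

lemma norm_tsum_coeff_le:
  assumes "finite A" "n \<in> A" "\<And>x. norm (tsum A c x) \<le> b"
  shows "norm (c n) \<le> b"
proof -
  have "norm (c n) \<le> (\<integral>x. norm (tsum A c x) \<partial>torus)"
    using norm_fourier_coeff_le[of "tsum A c" n] fourier_coeff_tsum[OF assms(1), of c n] assms(2)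
    by (simp add: integrable_torus_continuous continuous_tsum)
  also have "\<dots> \<le> (\<integral>x. b \<partial>torus)"
    by (intro integral_mono integrable_torus_continuous continuous_intros assms continuous_on_id)
  also have "\<dots> = b" using torus.prob_space by (simp add: space_torus)
  finally show ?thesis .
qed

lemma parseval_tsum:
  assumes "finite A"
  shows "(\<integral>x. (norm (tsum A c x))\<^sup>2 \<partial>torus) = (\<Sum>n\<in>A. (norm (c n))\<^sup>2)"
proof -
  have "complex_of_real (\<integral>x. (norm (tsum A c x))\<^sup>2 \<partial>torus)
      = (\<integral>x. complex_of_real ((norm (tsum A c x))\<^sup>2) \<partial>torus)"
    by (rule integral_complex_of_real[symmetric])
  also have "\<dots> = (\<integral>x. (\<Sum>n\<in>A. cnj (c n) * (tsum A c x * echar (- n) x)) \<partial>torus)"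
  proof (intro Bochner_Integration.integral_cong refl)
    fix x
    have "complex_of_real ((norm (tsum A c x))\<^sup>2) = tsum A c x * cnj (tsum A c x)"
      by (rule complex_norm_square)
    also have "cnj (tsum A c x) = (\<Sum>n\<in>A. cnj (c n) * echar (- n) x)"
      by (simp add: tsum_def cnj_echar)
    finally show "complex_of_real ((norm (tsum A c x))\<^sup>2)
        = (\<Sum>n\<in>A. cnj (c n) * (tsum A c x * echar (- n) x))"
      by (simp add: sum_distrib_left algebra_simps)
  qed
  also have "\<dots> = (\<Sum>n\<in>A. cnj (c n) * fourier_coeff (tsum A c) n)"
    unfolding fourier_coeff_echar
    by (subst Bochner_Integration.integral_sum)
       (auto intro!: integrable_torus_continuous continuous_intros continuous_on_id)
  also have "\<dots> = (\<Sum>n\<in>A. of_real ((norm (c n))\<^sup>2))"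
    by (intro sum.cong refl) (simp add: fourier_coeff_tsum[OF assms] complex_norm_square mult.commute del: of_real_power)
  also have "\<dots> = complex_of_real (\<Sum>n\<in>A. (norm (c n))\<^sup>2)" by simp
  finally show ?thesis by (simp only: of_real_eq_iff)
qed

section \<open>Elementary inequalities\<close>

text \<open>The power series compare term by term because \<open>2^n * n! \<le> (2n)!\<close>.\<close>

lemma cosh_le_exp_half_square: "cosh x \<le> exp (x\<^sup>2 / 2)" for x :: real
proof -
  have pow: "2 ^ n * fact n \<le> (fact (2 * n) :: real)" for n
  proof (induction n)
    case (Suc n)
    have "2 ^ Suc n * fact (Suc n) = (2 * real (Suc n)) * (2 ^ n * fact n :: real)"
      by (simp add: algebra_simps)
    also have "\<dots> \<le> (2 * real (Suc n)) * fact (2 * n)"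
      by (intro mult_left_mono Suc) auto
    also have "\<dots> \<le> (2 * real (Suc n)) * ((2 * real n + 1) * fact (2 * n))"
      by (intro mult_left_mono mult_right_le_one_le) (auto simp: algebra_simps)
    also have "\<dots> = fact (2 * Suc n)" by (simp add: algebra_simps)
    finally show ?case .
  qed simp
  have "(\<lambda>n. if even n then x ^ n /\<^sub>R fact n else 0) sums cosh x"
    by (rule cosh_converges)
  then have "(\<lambda>n. if even (2 * n) then x ^ (2 * n) /\<^sub>R fact (2 * n) else 0) sums cosh x"
    by (subst sums_mono_reindex[of "\<lambda>n. 2 * n" "\<lambda>n. if even n then x ^ n /\<^sub>R fact n else 0"])
       (auto intro!: strict_monoI elim!: evenE)
  then have s: "(\<lambda>n. x ^ (2 * n) / fact (2 * n)) sums cosh x"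
    by (simp add: field_simps)
  have t: "(\<lambda>n. (x\<^sup>2 / 2) ^ n / fact n) sums exp (x\<^sup>2 / 2)"
    using exp_converges[of "x\<^sup>2 / 2"] by (simp add: field_simps)
  show ?thesis
  proof (rule sums_le[OF _ s t])
    fix n
    have "x ^ (2 * n) / fact (2 * n) \<le> x ^ (2 * n) / (2 ^ n * fact n)"
      by (intro divide_left_mono pow) (auto simp: power_mult)
    also have "\<dots> = (x\<^sup>2 / 2) ^ n / fact n"
      by (simp add: power_mult power_divide)
    finally show "x ^ (2 * n) / fact (2 * n) \<le> (x\<^sup>2 / 2) ^ n / fact n" .
  qed
qed

lemma sin_ge_third: assumes "0 \<le> x" "x \<le> 2" shows "x / 3 \<le> sin (x :: real)"
proof -
  have "\<bar>sin x - (\<Sum>m<3. sin_coeff m * x ^ m)\<bar> \<le> inverse (fact 3) * \<bar>x\<bar> ^ 3"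
    by (rule Maclaurin_sin_bound)
  moreover have "(\<Sum>m<3. sin_coeff m * x ^ m) = x"
    by (simp add: numeral_3_eq_3 sin_coeff_def)
  moreover have "inverse (fact 3) * \<bar>x\<bar> ^ 3 \<le> 2 * x / 3"
  proof -
    have "x * x \<le> 2 * 2" using assms by (intro mult_mono) auto
    then have "x * (x * x) \<le> x * 4" using assms by (intro mult_left_mono) auto
    then show ?thesis using assms by (simp add: eval_nat_numeral)
  qed
  ultimately show ?thesis by linarith
qed

lemma norm_echar_1_minus_1: "norm (echar 1 x - 1) = 2 * \<bar>sin (pi * x)\<bar>"
proof -
  have "(norm (echar 1 x - 1))\<^sup>2 = (cos (2 * (pi * x)) - 1)\<^sup>2 + (sin (2 * (pi * x)))\<^sup>2"
    by (simp add: cmod_power2 echar_def mult.assoc)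
  also have "\<dots> = 2 - 2 * cos (2 * (pi * x))"
    using sin_cos_squared_add[of "2 * (pi * x)"] by (simp add: power2_eq_square algebra_simps)
  also have "\<dots> = (2 * \<bar>sin (pi * x)\<bar>)\<^sup>2"
    by (subst cos_double_sin) (simp add: power2_eq_square)
  finally show ?thesis by (rule power2_eq_imp_eq) auto
qed

text \<open>The chord between two points of the circle is at least a multiple of the arc between them.\<close>

lemma norm_echar_1_minus_1_ge:
  assumes "0 \<le> x" "x \<le> 1"
  shows "min x (1 - x) \<le> norm (echar 1 x - 1)"
proof -
  have half: "y \<le> 2 * \<bar>sin (pi * y)\<bar>" if "0 \<le> y" "y \<le> 1/2" for y
  proof -
    have "pi * y \<le> 4 * (1/2)" using that pi_less_4 by (intro mult_mono) auto
    then have "pi * y / 3 \<le> sin (pi * y)" using that by (intro sin_ge_third) auto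
    moreover have "3 * y \<le> pi * y" using that pi_gt3 by (intro mult_right_mono) auto
    ultimately show ?thesis using that by linarith
  qed
  show ?thesis
  proof (cases "x \<le> 1/2")
    case True
    then show ?thesis using half[of x] assms by (simp add: norm_echar_1_minus_1)
  next
    case False
    have "sin (pi * (1 - x)) = sin (pi * x)" by (simp add: algebra_simps)
    then show ?thesis using half[of "1 - x"] False assms
      by (simp add: norm_echar_1_minus_1)
  qed
qed

section \<open>Multipliers with Lipschitz symbol and Bernstein inequalities\<close>

lemma integral_cauchy_weight_le:
  fixes D :: real assumes "D > 0"
  shows "(\<integral>x. D / (1 + D\<^sup>2 * x\<^sup>2) \<partial>torus) \<le> 2"
    and "(\<integral>x. D / (1 + D\<^sup>2 * (1 - x)\<^sup>2) \<partial>torus) \<le> 2"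
proof -
  have pos: "1 + D\<^sup>2 * y\<^sup>2 > 0" for y by (smt (verit) zero_le_power2 mult_nonneg_nonneg)
  have at: "arctan D \<le> 2" using arctan_bounded[of D] pi_less_4 by linarith
  have "((\<lambda>x. arctan (D * x)) has_vector_derivative D / (1 + D\<^sup>2 * x\<^sup>2)) (at x within {0..1})" for x
    unfolding has_real_derivative_iff_has_vector_derivative[symmetric]
    by (auto intro!: derivative_eq_intros simp: power_mult_distrib field_simps)
  then have "((\<lambda>x. D / (1 + D\<^sup>2 * x\<^sup>2)) has_integral arctan (D * 1) - arctan (D * 0)) {0..1}"
    by (intro fundamental_theorem_of_calculus) auto
  then show "(\<integral>x. D / (1 + D\<^sup>2 * x\<^sup>2) \<partial>torus) \<le> 2"
    using pos at
    by (subst integral_torus_continuous)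
       (auto intro!: continuous_intros simp: less_imp_neq[symmetric] dest: integral_unique)
  have "((\<lambda>x. - arctan (D * (1 - x))) has_vector_derivative D / (1 + D\<^sup>2 * (1 - x)\<^sup>2)) (at x within {0..1})" for x
    unfolding has_real_derivative_iff_has_vector_derivative[symmetric]
    by (auto intro!: derivative_eq_intros simp: power_mult_distrib divide_inverse)
  then have "((\<lambda>x. D / (1 + D\<^sup>2 * (1 - x)\<^sup>2)) has_integral - arctan (D * (1 - 1)) - - arctan (D * (1 - 0))) {0..1}"
    by (intro fundamental_theorem_of_calculus) auto
  then show "(\<integral>x. D / (1 + D\<^sup>2 * (1 - x)\<^sup>2) \<partial>torus) \<le> 2"
    using pos at
    by (subst integral_torus_continuous)
       (auto intro!: continuous_intros simp: less_imp_neq[symmetric] dest: integral_unique)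
qed

text \<open>Summation by parts: multiplication by \<open>e(x) - 1\<close> takes differences of the coefficients.\<close>

lemma tsum_diff_coeff:
  fixes D :: nat
  assumes "\<And>n. \<bar>n\<bar> > int D \<Longrightarrow> m n = 0"
  shows "tsum {- int D..int D + 1} (\<lambda>n. m (n - 1) - m n) x
           = (echar 1 x - 1) * tsum {- int D..int D} m x"
proof -
  have "tsum {- int D..int D + 1} m x = tsum {- int D..int D} m x"
    using assms by (intro tsum_mono_neutral[symmetric]) auto
  moreover have "tsum {- int D..int D + 1} (\<lambda>n. m (n - 1)) x = echar 1 x * tsum {- int D..int D} m x"
  proof -
    have "tsum {- int D..int D + 1} (\<lambda>n. m (n - 1)) x = tsum {- int D + 1..int D + 1} (\<lambda>n. m (n - 1)) x"
      using assms by (intro tsum_mono_neutral[symmetric]) auto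
    also have "\<dots> = (\<Sum>n\<in>{- int D..int D}. m n * echar (n + 1) x)"
      unfolding tsum_def
      by (rule sum.reindex_bij_witness[of _ "\<lambda>n. n + 1" "\<lambda>n. n - 1"]) auto
    also have "\<dots> = echar 1 x * tsum {- int D..int D} m x"
      by (simp add: tsum_def echar_add sum_distrib_left algebra_simps)
    finally show ?thesis .
  qed
  ultimately show ?thesis by (simp add: tsum_diff algebra_simps)
qed

text \<open>The kernel of a multiplier of width \<open>D\<close> has size \<open>D\<close> and is concentrated on
  \<open>|x| \<lesssim> 1/D\<close>. The concentration is measured by the weight \<open>1 + D^2 |e(x) - 1|^2\<close>: by Parseval,
  the weighted \<open>L^2\<close> norm of the kernel involves only the coefficients and their differences, and the
  reciprocal of the weight has integral of order \<open>1/D\<close>.\<close>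

lemma kernel_L1_bound:
  fixes D :: nat and B :: real
  assumes D: "D \<ge> 1" and supp: "\<And>n. \<bar>n\<bar> > int D \<Longrightarrow> m n = 0"
    and size: "\<And>n. norm (m n) \<le> B" and lip: "\<And>n. norm (m (n + 1) - m n) \<le> B / D"
  shows "(\<integral>y. norm (tsum {- int D..int D} m y) \<partial>torus) \<le> 6 * B"
proof (cases "B = 0")
  case True
  then have "m n = 0" for n using size[of n] by simp
  then have "norm (tsum {- int D..int D} m y) = 0" for y by (simp add: tsum_def)
  then show ?thesis using True by simp
next
  case False
  moreover have "0 \<le> B" using size[of 0] norm_ge_zero order_trans by blast
  ultimately have B: "B > 0" by simp
  define K where "K = tsum {- int D..int D} m"
  define w where "w x = 1 + (real D)\<^sup>2 * (norm (echar 1 x - 1))\<^sup>2" for x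
  define v where "v x = D / (1 + (real D)\<^sup>2 * x\<^sup>2) + D / (1 + (real D)\<^sup>2 * (1 - x)\<^sup>2)" for x
  have Dp: "real D > 0" using D by simp
  have wpos: "w x > 0" for x unfolding w_def by (smt (verit) zero_le_power2 mult_nonneg_nonneg)
  have pos: "1 + (real D)\<^sup>2 * y\<^sup>2 > 0" for y by (smt (verit) zero_le_power2 mult_nonneg_nonneg)
  have c: "continuous_on UNIV K" unfolding K_def by (rule continuous_tsum)
  \<comment> \<open>the Cauchy-Schwarz inequality for \<open>K = (K * sqrt w) / sqrt w\<close>, linearised by \<open>2 \<le> r t + 1 / (r t)\<close>\<close>
  have pt: "norm (K x) \<le> ((norm (K x))\<^sup>2 * w x / (D * B) + B * v x) / 2" if "x \<in> {0..<1}" for x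
  proof -
    have "D / w x \<le> v x"
    proof -
      define t where "t = min x (1 - x)"
      have t: "0 \<le> t" "t \<le> norm (echar 1 x - 1)"
        using norm_echar_1_minus_1_ge[of x] that by (auto simp: t_def)
      then have "1 + (real D)\<^sup>2 * t\<^sup>2 \<le> w x"
        unfolding w_def by (intro add_left_mono mult_left_mono power_mono) auto
      then have "D / w x \<le> D / (1 + (real D)\<^sup>2 * t\<^sup>2)"
        using pos[of t] wpos[of x] by (intro divide_left_mono) auto
      also have "\<dots> \<le> v x"
        using pos[of x] pos[of "1 - x"] unfolding v_def t_def min_def by (auto intro: divide_nonneg_pos)
      finally show ?thesis .
    qed
    then have "B * (D / w x) \<le> B * v x" using B by (intro mult_left_mono) auto
    moreover have "2 * norm (K x) \<le> (norm (K x))\<^sup>2 * w x / (D * B) + B * (D / w x)"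
    proof -
      define r where "r = w x / (D * B)"
      have r: "r > 0" using wpos[of x] B Dp by (simp add: r_def)
      have "0 \<le> (norm (K x) * r - 1)\<^sup>2 / r" using r by simp
      also have "\<dots> = (norm (K x))\<^sup>2 * r + 1 / r - 2 * norm (K x)"
        using r by (simp add: power2_eq_square field_simps)
      finally show ?thesis using r by (simp add: r_def mult_ac)
    qed
    ultimately show ?thesis by simp
  qed
  have "(\<integral>y. norm (K y) \<partial>torus) \<le> (\<integral>x. ((norm (K x))\<^sup>2 * w x / (D * B) + B * v x) / 2 \<partial>torus)"
    using pt pos B D unfolding w_def v_def
    by (intro integral_mono integrable_torus_continuous)
       (auto intro!: continuous_intros continuous_on_subset[OF c] continuous_on_id simp: space_torus less_imp_neq[symmetric])
  also have "\<dots> = ((\<integral>x. (norm (K x))\<^sup>2 * w x \<partial>torus) / (D * B) + B * (\<integral>x. v x \<partial>torus)) / 2"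
  proof -
    have "integrable torus (\<lambda>x. (norm (K x))\<^sup>2 * w x)" unfolding w_def
      by (intro integrable_torus_continuous continuous_intros continuous_on_subset[OF c] continuous_on_id) auto
    moreover have "integrable torus v" using pos unfolding v_def
      by (intro integrable_torus_continuous continuous_intros continuous_on_id)
         (auto simp: less_imp_neq[symmetric])
    ultimately show ?thesis by simp
  qed
  also have "\<dots> \<le> (7 * D * B\<^sup>2 / (D * B) + B * 4) / 2"
  proof -
    have "(\<integral>x. v x \<partial>torus) \<le> 4"
      using integral_cauchy_weight_le[of D] Dp pos unfolding v_def
      by (subst Bochner_Integration.integral_add)
         (auto intro!: integrable_torus_continuous continuous_intros continuous_on_id simp: less_imp_neq[symmetric])
    moreover have "(\<integral>x. (norm (K x))\<^sup>2 * w x \<partial>torus) \<le> 7 * D * B\<^sup>2"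
    proof -
      have "(norm (K x))\<^sup>2 * w x = (norm (K x))\<^sup>2 + (real D)\<^sup>2 *
          (norm (tsum {- int D..int D + 1} (\<lambda>n. m (n - 1) - m n) x))\<^sup>2" for x
      proof -
        have e: "tsum {- int D..int D + 1} (\<lambda>n. m (n - 1) - m n) x = (echar 1 x - 1) * K x"
          unfolding K_def by (rule tsum_diff_coeff[OF supp])
        show ?thesis unfolding e norm_mult power_mult_distrib w_def by (simp add: algebra_simps)
      qed
      then have "(\<integral>x. (norm (K x))\<^sup>2 * w x \<partial>torus) = (\<integral>x. (norm (K x))\<^sup>2 \<partial>torus) +
         (real D)\<^sup>2 * (\<integral>x. (norm (tsum {- int D..int D + 1} (\<lambda>n. m (n - 1) - m n) x))\<^sup>2 \<partial>torus)"
        by (simp add: integrable_torus_continuous continuous_intros continuous_tsum c)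
      also have "(\<integral>x. (norm (K x))\<^sup>2 \<partial>torus) = (\<Sum>n\<in>{- int D..int D}. (norm (m n))\<^sup>2)"
        unfolding K_def by (rule parseval_tsum) simp
      also have "\<dots> \<le> (\<Sum>n\<in>{- int D..int D}. B\<^sup>2)"
        using size by (intro sum_mono power_mono) auto
      also have "\<dots> = (2 * D + 1) * B\<^sup>2" by simp
      also have "\<dots> \<le> 3 * D * B\<^sup>2" using D by (intro mult_right_mono) auto
      also have "(\<integral>x. (norm (tsum {- int D..int D + 1} (\<lambda>n. m (n - 1) - m n) x))\<^sup>2 \<partial>torus)
         = (\<Sum>n\<in>{- int D..int D + 1}. (norm (m (n - 1) - m n))\<^sup>2)"
        by (rule parseval_tsum) simp
      also have "\<dots> \<le> (\<Sum>n\<in>{- int D..int D + 1}. (B / D)\<^sup>2)"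
        using lip[of "_ - 1"] by (intro sum_mono power_mono) (auto simp: norm_minus_commute)
      also have "\<dots> = (2 * D + 2) * (B / D)\<^sup>2" by simp
      also have "\<dots> \<le> 4 * D * (B / D)\<^sup>2" using D by (intro mult_right_mono) auto
      finally show ?thesis using Dp by (simp add: field_simps power2_eq_square)
    qed
    ultimately show ?thesis using B Dp
      by (intro divide_right_mono add_mono mult_left_mono) auto
  qed
  also have "\<dots> \<le> 6 * B" using B Dp by (simp add: power2_eq_square)
  finally show ?thesis unfolding K_def .
qed

text \<open>A multiplier acts by convolution with its kernel.\<close>

lemma multiplier_bound:
  fixes D :: nat and B :: real
  assumes D: "D \<ge> 1" and supp: "\<And>n. \<bar>n\<bar> > int D \<Longrightarrow> m n = 0"
    and size: "\<And>n. norm (m n) \<le> B" and lip: "\<And>n. norm (m (n + 1) - m n) \<le> B / D"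
    and A: "finite A" and b: "\<And>x. norm (tsum A c x) \<le> b"
  shows "norm (tsum A (\<lambda>n. m n * c n) x) \<le> 6 * B * b"
proof -
  define K where "K = tsum {- int D..int D} m"
  have c: "continuous_on UNIV K" unfolding K_def by (rule continuous_tsum)
  have b0: "b \<ge> 0" using b[of 0] norm_ge_zero order_trans by blast
  have "tsum A (\<lambda>n. m n * c n) x = (\<Sum>n\<in>A. c n * echar n x * fourier_coeff K n)"
    unfolding tsum_def K_def fourier_coeff_tsum[OF finite_atLeastAtMost_int]
    using supp by (intro sum.cong) auto
  also have "\<dots> = (\<integral>y. tsum A c (x - y) * K y \<partial>torus)"
  proof -
    have "tsum A c (x - y) * K y = (\<Sum>n\<in>A. c n * echar n x * (K y * echar (- n) y))" for y
      using echar_add_arg[of _ x "- y"] by (simp add: tsum_def sum_distrib_left sum_distrib_right echar_minus_arg algebra_simps)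
    moreover have "integrable torus (\<lambda>y. K y * echar (- n) y)" for n
      by (intro integrable_torus_continuous continuous_intros c)
    ultimately show ?thesis
      by (simp add: fourier_coeff_echar)
  qed
  also have "norm \<dots> \<le> (\<integral>y. norm (tsum A c (x - y) * K y) \<partial>torus)"
    by (rule integral_norm_bound)
  also have "\<dots> \<le> (\<integral>y. b * norm (K y) \<partial>torus)"
    by (intro integral_mono integrable_torus_continuous)
       (auto intro!: continuous_intros continuous_on_subset[OF c] continuous_on_id mult_right_mono b simp: norm_mult)
  also have "\<dots> \<le> b * (6 * B)"
    using kernel_L1_bound[of D m B, OF D supp size lip] b0 unfolding K_def
    by (simp add: mult_left_mono)
  finally show ?thesis by (simp add: mult_ac)
qed

text \<open>Differentiation and integration have odd symbols, given here by their values on the positive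
  integers.\<close>

definition odd_multiplier :: "(nat \<Rightarrow> real) \<Rightarrow> int \<Rightarrow> complex" where
  "odd_multiplier \<mu> n = of_real (sgn (of_int n) * \<mu> (nat \<bar>n\<bar>))"

lemma odd_multiplier_step:
  assumes "\<mu> 0 = 0" "\<And>t. \<bar>\<mu> (Suc t) - \<mu> t\<bar> \<le> d"
  shows "norm (odd_multiplier \<mu> (n + 1) - odd_multiplier \<mu> n) \<le> d"
proof (cases "n \<ge> 0")
  case True
  define t where "t = nat n"
  have n: "n = int t" using True by (simp add: t_def)
  have *: "nat (int t + 1) = Suc t" by linarith
  have "odd_multiplier \<mu> (n + 1) - odd_multiplier \<mu> n = of_real (\<mu> (Suc t) - \<mu> t)"
    using assms(1) by (cases "t = 0") (auto simp: odd_multiplier_def n * sgn_if)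
  then show ?thesis using assms(2)[of t] by (simp only: norm_of_real)
next
  case False
  define t where "t = nat (- n - 1)"
  have n: "n = - int t - 1" using False by (simp add: t_def)
  have *: "nat (1 + int t) = Suc t" by linarith
  have "odd_multiplier \<mu> (n + 1) - odd_multiplier \<mu> n = of_real (\<mu> (Suc t) - \<mu> t)"
    using assms(1) by (cases "t = 0") (auto simp: odd_multiplier_def n * sgn_if)
  then show ?thesis using assms(2)[of t] by (simp only: norm_of_real)
qed

lemma odd_multiplier_bound:
  fixes D :: nat and B :: real
  assumes D: "D \<ge> 1" and supp: "\<And>t. t > D \<Longrightarrow> \<mu> t = 0" and zero: "\<mu> 0 = 0"
    and size: "\<And>t. \<bar>\<mu> t\<bar> \<le> B" and lip: "\<And>t. \<bar>\<mu> (Suc t) - \<mu> t\<bar> \<le> B / D"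
    and A: "finite A" and b: "\<And>x. norm (tsum A c x) \<le> b"
  shows "norm (tsum A (\<lambda>n. odd_multiplier \<mu> n * c n) x) \<le> 6 * B * b"
proof (rule multiplier_bound[where m = "odd_multiplier \<mu>" and c = c and b = b and B = B and D = D, OF D _ _ _ A b])
  show "norm (odd_multiplier \<mu> n) \<le> B" for n
    using size[of "nat \<bar>n\<bar>"] size[of 0] zero by (auto simp: odd_multiplier_def abs_mult sgn_if)
  show "odd_multiplier \<mu> n = 0" if "\<bar>n\<bar> > int D" for n
    using supp[of "nat \<bar>n\<bar>"] that by (auto simp: odd_multiplier_def)
  show "norm (odd_multiplier \<mu> (n + 1) - odd_multiplier \<mu> n) \<le> B / D" for n
    by (rule odd_multiplier_step[of \<mu> "B / D"]) (simp_all add: zero lip)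
qed

text \<open>The symbol \<open>n\<close> matters only for \<open>|n| \<le> D\<close>; beyond that it is continued to a zigzag of
  compact support and slope 1.\<close>

lemma bernstein_derivative:
  fixes D :: nat and b :: real
  assumes D: "D \<ge> 1" and A: "A \<subseteq> {- int D..int D}" and b: "\<And>x. norm (tsum A c x) \<le> b"
  shows "norm (tsum A (\<lambda>n. of_int n * c n) x) \<le> 12 * D * b"
proof -
  define \<mu> where "\<mu> t = (if t \<le> D then real t else if t \<le> 2 * D then real (2 * D) - real t else 0)" for t
  have "norm (tsum A (\<lambda>n. odd_multiplier \<mu> n * c n) x) \<le> 6 * (2 * real D) * b"
  proof (rule odd_multiplier_bound[where \<mu> = \<mu> and D = "2 * D" and c = c and b = b and B = "2 * real D" and A = A, OF _ _ _ _ _ _ b])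
    show "2 * D \<ge> 1" using D by simp
    show "finite A" using A by (rule finite_subset) simp
    show "\<bar>\<mu> t\<bar> \<le> 2 * real D" for t by (auto simp: \<mu>_def)
    show "\<bar>\<mu> (Suc t) - \<mu> t\<bar> \<le> 2 * real D / real (2 * D)" for t
    proof -
      have "\<bar>\<mu> (Suc t) - \<mu> t\<bar> \<le> 1" by (auto simp: \<mu>_def abs_le_iff)
      then show ?thesis using D by simp
    qed
  qed (auto simp: \<mu>_def)
  moreover have "tsum A (\<lambda>n. odd_multiplier \<mu> n * c n) x = tsum A (\<lambda>n. of_int n * c n) x"
    unfolding tsum_def
  proof (intro sum.cong refl)
    fix n assume "n \<in> A"
    then have "n \<in> {- int D..int D}" using A by blast
    then have "\<bar>n\<bar> \<le> int D" by auto
    then have "odd_multiplier \<mu> n = of_int n"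
      by (auto simp: odd_multiplier_def \<mu>_def sgn_if)
    then show "odd_multiplier \<mu> n * c n * echar n x = of_int n * c n * echar n x" by simp
  qed
  ultimately show ?thesis by simp
qed

text \<open>For a spectrum away from 0 the antiderivative gains a factor \<open>1/Q\<close>. The symbol \<open>1/n\<close> is
  continued to a function with Lipschitz constant \<open>1/Q^2\<close>: linearly through 0 below \<open>Q\<close>, and by its tangent at \<open>4Q\<close>,
  which reaches 0 at \<open>8Q\<close>.\<close>

lemma bernstein_antiderivative:
  fixes Q :: nat and b :: real
  assumes Q: "Q \<ge> 1" and A: "A \<subseteq> {n. int Q \<le> \<bar>n\<bar> \<and> \<bar>n\<bar> \<le> 4 * int Q}"
    and b: "\<And>x. norm (tsum A c x) \<le> b"
  shows "norm (tsum A (\<lambda>n. c n / of_int n) x) \<le> 48 / Q * b"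
proof -
  define \<mu> where "\<mu> t = (if t < Q then t / (real Q)\<^sup>2 else if t \<le> 4 * Q then 1 / real t
     else if t \<le> 8 * Q then 1 / (2 * real Q) - t / (16 * (real Q)\<^sup>2) else 0)" for t :: nat
  have fin: "finite A"
  proof (rule finite_subset)
    show "A \<subseteq> {- 4 * int Q..4 * int Q}"
    proof
      fix n assume "n \<in> A"
      then have "\<bar>n\<bar> \<le> 4 * int Q" using A by auto
      then show "n \<in> {- 4 * int Q..4 * int Q}" by auto
    qed
  qed simp
  have Qp: "real Q \<ge> 1" using Q by simp
  have size: "\<bar>\<mu> t\<bar> \<le> 8 / Q" for t
  proof -
    consider "t < Q" | "Q \<le> t" "t \<le> 4 * Q" | "4 * Q < t" "t \<le> 8 * Q" | "t > 8 * Q" by linarith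
    then show ?thesis
    proof cases
      case 1
      then have "real t / (real Q)\<^sup>2 \<le> real Q / (real Q)\<^sup>2" by (intro divide_right_mono) auto
      also have "\<dots> \<le> 8 / Q" using Qp by (simp add: power2_eq_square field_simps)
      finally show ?thesis using 1 by (simp add: \<mu>_def)
    next
      case 2
      then have "1 / real t \<le> 1 / real Q" using Qp by (intro divide_left_mono) auto
      also have "\<dots> \<le> 8 / Q" using Qp by (simp add: field_simps)
      finally show ?thesis using 2 Qp by (simp add: \<mu>_def)
    next
      case 3
      have "real t / (16 * (real Q)\<^sup>2) \<le> (8 * real Q) / (16 * (real Q)\<^sup>2)"
        using 3 by (intro divide_right_mono) auto
      also have "\<dots> = 1 / (2 * real Q)" using Qp by (simp add: power2_eq_square field_simps)
      finally have "real t / (16 * (real Q)\<^sup>2) \<le> 1 / (2 * real Q)" .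
      moreover have "1 / (2 * real Q) \<le> 8 / Q" using Qp by (simp add: field_simps)
      moreover have "0 \<le> real t / (16 * (real Q)\<^sup>2)" by simp
      moreover have "\<mu> t = 1 / (2 * real Q) - real t / (16 * (real Q)\<^sup>2)"
        using 3 Qp by (simp add: \<mu>_def)
      ultimately show ?thesis by linarith
    qed (use Qp in \<open>auto simp: \<mu>_def\<close>)
  qed
  have lip: "\<bar>\<mu> (Suc t) - \<mu> t\<bar> \<le> 1 / (real Q)\<^sup>2" for t
  proof -
    consider "Suc t < Q" | "Suc t = Q" | "Q \<le> t" "t < 4 * Q" | "t = 4 * Q" | "4 * Q < t" "t < 8 * Q" | "t = 8 * Q" | "t > 8 * Q" by linarith
    then show ?thesis
    proof cases
      case 1
      then show ?thesis by (simp add: \<mu>_def diff_divide_distrib[symmetric])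
    next
      case 2
      then have "\<mu> (Suc t) = real Q / (real Q)\<^sup>2" "\<mu> t = (real Q - 1) / (real Q)\<^sup>2"
        by (auto simp: \<mu>_def power2_eq_square)
      then have "\<mu> (Suc t) - \<mu> t = 1 / (real Q)\<^sup>2" by (simp add: diff_divide_distrib)
      then show ?thesis by simp
    next
      case 3
      then have t: "real t > 0" "real Q \<le> real t" using Qp by linarith+
      have "\<mu> (Suc t) - \<mu> t = - (1 / (real t * (real t + 1)))"
        using 3 t by (simp add: \<mu>_def field_simps)
      moreover have "1 / (real t * (real t + 1)) \<le> 1 / (real Q)\<^sup>2"
        unfolding power2_eq_square using t Qp by (intro divide_left_mono mult_mono) auto
      ultimately show ?thesis using t by simp
    next
      case 4
      have "\<mu> (Suc t) - \<mu> t = - (1 / (16 * (real Q)\<^sup>2))"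
        using 4 Qp by (simp add: \<mu>_def field_simps power2_eq_square)
      moreover have "1 / (16 * (real Q)\<^sup>2) \<le> 1 / (real Q)\<^sup>2" using Qp by (intro divide_left_mono) auto
      ultimately show ?thesis by simp
    next
      case 5
      have "\<mu> (Suc t) - \<mu> t = - (1 / (16 * (real Q)\<^sup>2))"
        using 5 Qp by (simp add: \<mu>_def field_simps power2_eq_square)
      moreover have "1 / (16 * (real Q)\<^sup>2) \<le> 1 / (real Q)\<^sup>2" using Qp by (intro divide_left_mono) auto
      ultimately show ?thesis by simp
    next
      case 6
      then show ?thesis using Qp by (simp add: \<mu>_def field_simps power2_eq_square)
    qed (simp add: \<mu>_def)
  qed
  have "norm (tsum A (\<lambda>n. odd_multiplier \<mu> n * c n) x) \<le> 6 * (8 / Q) * b"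
  proof (rule odd_multiplier_bound[where \<mu> = \<mu> and D = "8 * Q" and c = c and b = b and B = "8 / real Q" and A = A, OF _ _ _ size _ fin b])
    show "\<bar>\<mu> (Suc t) - \<mu> t\<bar> \<le> 8 / real Q / real (8 * Q)" for t
      using lip[of t] Qp by (simp add: power2_eq_square)
  qed (use Q in \<open>auto simp: \<mu>_def\<close>)
  moreover have "tsum A (\<lambda>n. odd_multiplier \<mu> n * c n) x = tsum A (\<lambda>n. c n / of_int n) x"
    unfolding tsum_def
  proof (intro sum.cong refl)
    fix n assume "n \<in> A"
    then have "int Q \<le> \<bar>n\<bar>" "\<bar>n\<bar> \<le> 4 * int Q" using A by auto
    then have "odd_multiplier \<mu> n = 1 / of_int n"
      using Q by (auto simp: odd_multiplier_def \<mu>_def sgn_if)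
    then show "odd_multiplier \<mu> n * c n * echar n x = c n / of_int n * echar n x" by simp
  qed
  ultimately show ?thesis by simp
qed

section \<open>Azuma inequality on the dyadic tree\<close>

lemma sum_dyadic_split:
  fixes f :: "nat \<Rightarrow> 'a::comm_monoid_add"
  shows "(\<Sum>i<2 ^ Suc J. f i) = (\<Sum>i<2 ^ J. f (2 * i) + f (2 * i + 1))"
proof -
  have "(\<Sum>i<2 * n. f i) = (\<Sum>i<n. f (2 * i) + f (2 * i + 1))" for n :: nat
    by (induction n) (simp_all add: add.assoc)
  then show ?thesis by simp
qed

text \<open>The average of \<open>exp\<close> over the two children of a node is \<open>cosh d\<close> times the value of \<open>exp\<close> at
  the node, where \<open>d\<close> is the martingale difference; \<open>cosh d \<le> exp (d^2 / 2)\<close> then gains one factor per level.\<close>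

lemma dyadic_azuma:
  fixes A :: "nat \<Rightarrow> nat \<Rightarrow> real"
  assumes mean: "\<And>j i. A j i = (A (Suc j) (2 * i) + A (Suc j) (2 * i + 1)) / 2"
    and step: "\<And>j i. \<bar>A (Suc j) (2 * i) - A j i\<bar> \<le> b j"
  shows "(\<Sum>i<2 ^ J. exp (A J i)) / 2 ^ J \<le> exp (A 0 0 + (\<Sum>j<J. (b j)\<^sup>2) / 2)"
proof (induction J)
  case (Suc J)
  have pair: "exp (A (Suc J) (2 * i)) + exp (A (Suc J) (2 * i + 1)) \<le> 2 * exp (A J i) * exp ((b J)\<^sup>2 / 2)" for i
  proof -
    define d where "d = A (Suc J) (2 * i) - A J i"
    have l: "A (Suc J) (2 * i) = A J i + d" by (simp add: d_def)
    have r: "A (Suc J) (2 * i + 1) = A J i - d" using mean[of J i] by (simp add: d_def)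
    have "\<bar>d\<bar>\<^sup>2 \<le> (b J)\<^sup>2" using step[of J i] unfolding d_def by (intro power_mono) auto
    then have "exp (d\<^sup>2 / 2) \<le> exp ((b J)\<^sup>2 / 2)" by simp
    then have "cosh d \<le> exp ((b J)\<^sup>2 / 2)" using cosh_le_exp_half_square[of d] by linarith
    then have "2 * exp (A J i) * cosh d \<le> 2 * exp (A J i) * exp ((b J)\<^sup>2 / 2)"
      by (intro mult_left_mono) auto
    moreover have "exp (A (Suc J) (2 * i)) + exp (A (Suc J) (2 * i + 1)) = 2 * exp (A J i) * cosh d"
      unfolding l r by (simp add: cosh_def exp_add exp_diff exp_minus field_simps)
    ultimately show ?thesis by simp
  qed
  have "(\<Sum>i<2 ^ Suc J. exp (A (Suc J) i)) / 2 ^ Suc J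
      \<le> (\<Sum>i<2 ^ J. 2 * exp (A J i) * exp ((b J)\<^sup>2 / 2)) / 2 ^ Suc J"
    unfolding sum_dyadic_split by (intro divide_right_mono sum_mono pair) auto
  also have "\<dots> = (\<Sum>i<2 ^ J. exp (A J i)) / 2 ^ J * exp ((b J)\<^sup>2 / 2)"
    by (simp add: sum_distrib_left sum_distrib_right sum_divide_distrib mult_ac)
  also have "\<dots> \<le> exp (A 0 0 + (\<Sum>j<J. (b j)\<^sup>2) / 2) * exp ((b J)\<^sup>2 / 2)"
    by (intro mult_right_mono Suc.IH) auto
  also have "\<dots> = exp (A 0 0 + (\<Sum>j<Suc J. (b j)\<^sup>2) / 2)"
    by (simp add: exp_add[symmetric] add_divide_distrib)
  finally show ?case .
qed simp

definition dyadic_avg :: "(real \<Rightarrow> 'a::real_normed_vector) \<Rightarrow> nat \<Rightarrow> nat \<Rightarrow> 'a" where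
  "dyadic_avg g j i = 2 ^ j *\<^sub>R integral {real i / 2 ^ j..(real i + 1) / 2 ^ j} g"

lemma dyadic_endpoints:
  "real (2 * i) / 2 ^ Suc j = real i / 2 ^ j"
  "(real (2 * i + 1) + 1) / 2 ^ Suc j = (real i + 1) / 2 ^ j"
  "(real (2 * i) + 1) / 2 ^ Suc j = real (2 * i + 1) / 2 ^ Suc j"
  by (simp_all add: field_simps)

lemma dyadic_avg_mean:
  fixes g :: "real \<Rightarrow> 'a::euclidean_space"
  assumes "continuous_on UNIV g"
  shows "dyadic_avg g j i = (1 / 2) *\<^sub>R (dyadic_avg g (Suc j) (2 * i) + dyadic_avg g (Suc j) (2 * i + 1))"
proof -
  let ?a = "real i / 2 ^ j" and ?m = "real (2 * i + 1) / 2 ^ Suc j" and ?b = "(real i + 1) / 2 ^ j"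
  have "integral {?a..?m} g + integral {?m..?b} g = integral {?a..?b} g"
    by (intro Henstock_Kurzweil_Integration.integral_combine integrable_continuous_interval
         continuous_on_subset[OF assms]) (auto simp: field_simps)
  then show ?thesis
    unfolding dyadic_avg_def dyadic_endpoints by (simp add: scaleR_add_right[symmetric])
qed

lemma dyadic_avg_sum:
  fixes g :: "'k \<Rightarrow> real \<Rightarrow> 'a::euclidean_space"
  assumes "finite F" "\<And>k. k \<in> F \<Longrightarrow> continuous_on UNIV (g k)"
  shows "dyadic_avg (\<lambda>x. \<Sum>k\<in>F. g k x) j i = (\<Sum>k\<in>F. dyadic_avg (g k) j i)"
proof -
  have "g k integrable_on {a..b}" if "k \<in> F" for k a b
    by (intro integrable_continuous_interval continuous_on_subset[OF assms(2)[OF that]]) simp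
  then show ?thesis using assms(1)
    unfolding dyadic_avg_def
    by (subst Henstock_Kurzweil_Integration.integral_sum) (simp_all add: scaleR_sum_right)
qed

lemma dyadic_avg_bounded_linear:
  fixes g :: "real \<Rightarrow> 'a::euclidean_space" and h :: "'a \<Rightarrow> 'b::euclidean_space"
  assumes "bounded_linear h" "continuous_on UNIV g"
  shows "dyadic_avg (\<lambda>x. h (g x)) j i = h (dyadic_avg g j i)"
proof -
  interpret h: bounded_linear h by fact
  have "integral {real i / 2 ^ j..(real i + 1) / 2 ^ j} (h \<circ> g) = h (integral {real i / 2 ^ j..(real i + 1) / 2 ^ j} g)"
    by (intro integral_linear integrable_continuous_interval continuous_on_subset[OF assms(2)] assms) auto
  then show ?thesis by (simp add: dyadic_avg_def h.scaleR o_def)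
qed

text \<open>A Lipschitz function differs from its averages on the scale \<open>2^-J\<close> by at most \<open>L * 2^-J\<close>.\<close>

lemma dyadic_exp_integral:
  fixes u :: "real \<Rightarrow> real"
  assumes cont: "continuous_on UNIV u" and lip: "\<And>x y. \<bar>u x - u y\<bar> \<le> L * \<bar>x - y\<bar>"
  shows "integral {0..1} (\<lambda>x. exp (u x)) \<le> exp (L / 2 ^ J) * ((\<Sum>i<2 ^ J. exp (dyadic_avg u J i)) / 2 ^ J)"
proof -
  have L: "0 \<le> L" using lip[of 0 1] by auto
  have int: "(\<lambda>x. exp (u x)) integrable_on {a..b}" "u integrable_on {a..b}" for a b
    by (auto intro!: integrable_continuous_interval continuous_intros continuous_on_subset[OF cont])
  have piece: "integral {real i / 2 ^ J..(real i + 1) / 2 ^ J} (\<lambda>x. exp (u x))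
      \<le> exp (L / 2 ^ J) * exp (dyadic_avg u J i) / 2 ^ J" for i
  proof -
    let ?I = "{real i / 2 ^ J..(real i + 1) / 2 ^ J}"
    have len: "(real i + 1) / 2 ^ J - real i / 2 ^ J = 1 / 2 ^ J" by (simp add: field_simps)
    have le: "real i / 2 ^ J \<le> (real i + 1) / 2 ^ J" by (simp add: divide_right_mono)
    have "u x \<le> dyadic_avg u J i + L / 2 ^ J" if "x \<in> ?I" for x
    proof -
      have "u x - L / 2 ^ J \<le> u y" if "y \<in> ?I" for y
      proof -
        have "\<bar>x - y\<bar> \<le> 1 / 2 ^ J" using that \<open>x \<in> ?I\<close> len by auto
        then have "L * \<bar>x - y\<bar> \<le> L * (1 / 2 ^ J)" using L by (rule mult_left_mono)
        then show ?thesis using lip[of x y] by simp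
      qed
      then have "integral ?I (\<lambda>y. u x - L / 2 ^ J) \<le> integral ?I u"
        by (intro integral_le int) auto
      then have "2 ^ J * ((1 / 2 ^ J) * (u x - L / 2 ^ J)) \<le> 2 ^ J * integral ?I u"
        using len le by (intro mult_left_mono) auto
      then show ?thesis by (simp add: dyadic_avg_def)
    qed
    then have "integral ?I (\<lambda>x. exp (u x)) \<le> integral ?I (\<lambda>x. exp (dyadic_avg u J i + L / 2 ^ J))"
      by (intro integral_le int) auto
    also have "\<dots> = exp (L / 2 ^ J) * exp (dyadic_avg u J i) / 2 ^ J"
      using len le by (simp add: exp_add)
    finally show ?thesis .
  qed
  have "integral {0..real n / 2 ^ J} (\<lambda>x. exp (u x))
     = (\<Sum>i<n. integral {real i / 2 ^ J..(real i + 1) / 2 ^ J} (\<lambda>x. exp (u x)))" for n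
  proof (induction n)
    case (Suc n)
    have "integral {0..real n / 2 ^ J} (\<lambda>x. exp (u x)) + integral {real n / 2 ^ J..(real n + 1) / 2 ^ J} (\<lambda>x. exp (u x))
       = integral {0..(real n + 1) / 2 ^ J} (\<lambda>x. exp (u x))"
      by (intro Henstock_Kurzweil_Integration.integral_combine int) (auto simp: divide_right_mono)
    then show ?case using Suc by (simp add: add.commute)
  qed simp
  from this[of "2 ^ J"] have "integral {0..1} (\<lambda>x. exp (u x))
     = (\<Sum>i<2 ^ J. integral {real i / 2 ^ J..(real i + 1) / 2 ^ J} (\<lambda>x. exp (u x)))"
    by simp
  also have "\<dots> \<le> (\<Sum>i<2 ^ J. exp (L / 2 ^ J) * exp (dyadic_avg u J i) / 2 ^ J)"
    by (intro sum_mono piece)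
  also have "\<dots> = exp (L / 2 ^ J) * ((\<Sum>i<2 ^ J. exp (dyadic_avg u J i)) / 2 ^ J)"
    by (simp add: sum_distrib_left sum_divide_distrib)
  finally show ?thesis .
qed

lemma exp_integral_le_dyadic:
  fixes u :: "real \<Rightarrow> real"
  assumes cont: "continuous_on UNIV u" and lip: "\<And>x y. \<bar>u x - u y\<bar> \<le> L * \<bar>x - y\<bar>"
    and mean0: "integral {0..1} u = 0"
    and step: "\<And>j i. \<bar>dyadic_avg u (Suc j) (2 * i) - dyadic_avg u j i\<bar> \<le> b j"
    and S: "\<And>J. (\<Sum>j<J. (b j)\<^sup>2) \<le> S"
  shows "integral {0..1} (\<lambda>x. exp (u x)) \<le> exp (S / 2)"
proof (rule LIMSEQ_le_const)
  show "(\<lambda>J. exp (L / 2 ^ J) * exp (S / 2)) \<longlonglongrightarrow> exp (S / 2)"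
  proof -
    have "(\<lambda>J. L / 2 ^ J) \<longlonglongrightarrow> 0" by (rule LIMSEQ_divide_realpow_zero) simp
    then have "(\<lambda>J. exp (L / 2 ^ J) * exp (S / 2)) \<longlonglongrightarrow> exp 0 * exp (S / 2)"
      by (rule tendsto_mult[OF tendsto_exp tendsto_const])
    then show ?thesis by simp
  qed
  have "integral {0..1} (\<lambda>x. exp (u x)) \<le> exp (L / 2 ^ J) * exp (S / 2)" for J
  proof -
    have "integral {0..1} (\<lambda>x. exp (u x)) \<le> exp (L / 2 ^ J) * ((\<Sum>i<2 ^ J. exp (dyadic_avg u J i)) / 2 ^ J)"
      by (rule dyadic_exp_integral[OF cont lip])
    also have "(\<Sum>i<2 ^ J. exp (dyadic_avg u J i)) / 2 ^ J \<le> exp (dyadic_avg u 0 0 + (\<Sum>j<J. (b j)\<^sup>2) / 2)"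
      proof (rule dyadic_azuma[where A = "dyadic_avg u" and b = b])
      show "dyadic_avg u j i = (dyadic_avg u (Suc j) (2 * i) + dyadic_avg u (Suc j) (2 * i + 1)) / 2" for j i
        by (subst dyadic_avg_mean[OF cont]) simp
    qed (rule step)
    also have "dyadic_avg u 0 0 = 0" using mean0 by (simp add: dyadic_avg_def)
    also have "exp (0 + (\<Sum>j<J. (b j)\<^sup>2) / 2) \<le> exp (S / 2)" using S[of J] by simp
    finally show ?thesis by simp
  qed
  then show "\<exists>N. \<forall>n\<ge>N. integral {0..1} (\<lambda>x. exp (u x)) \<le> exp (L / 2 ^ n) * exp (S / 2)" by blast
qed

text \<open>This is \<open>2^-|j-k|\<close>, the interaction of the frequency scale \<open>k\<close> with the length scale \<open>j\<close>.\<close>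

definition scale_decay :: "nat \<Rightarrow> nat \<Rightarrow> real" where
  "scale_decay j k = min (2 ^ k / 2 ^ j) (2 ^ j / 2 ^ k)"

lemma scale_decay_nonneg: "0 \<le> scale_decay j k"
  by (simp add: scale_decay_def)

lemma scale_decay_commute: "scale_decay j k = scale_decay k j"
  by (simp add: scale_decay_def min.commute)

lemma sum_scale_decay_le: "finite F \<Longrightarrow> (\<Sum>j\<in>F. scale_decay j k) \<le> 3"
proof -
  assume "finite F"
  then obtain J where J: "F \<subseteq> {..<J}" using finite_nat_bounded by blast
  \<comment> \<open>the exact values of the two geometric sums, in a form that can be proved by induction on \<open>J\<close>\<close>
  have "(\<Sum>j<J. scale_decay j k) \<le> (if J \<le> k then 2 ^ J / 2 ^ k else 3 - 2 * 2 ^ k / 2 ^ J)"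
  proof (induction J)
    case (Suc J)
    show ?case
    proof (cases "Suc J \<le> k")
      case True
      then have "(\<Sum>j<Suc J. scale_decay j k) \<le> 2 ^ J / 2 ^ k + 2 ^ J / 2 ^ k"
        using Suc by (auto simp: scale_decay_def intro!: add_mono)
      then show ?thesis using True by simp
    next
      case False
      show ?thesis
      proof (cases "J = k")
        case True
        then show ?thesis using Suc by (simp add: scale_decay_def)
      next
        case False
        then have "(\<Sum>j<Suc J. scale_decay j k) \<le> (3 - 2 * 2 ^ k / 2 ^ J) + 2 ^ k / 2 ^ J"
          using Suc \<open>\<not> Suc J \<le> k\<close> by (auto simp: scale_decay_def intro!: add_mono)
        then show ?thesis using \<open>\<not> Suc J \<le> k\<close> by simp
      qed
    qed
  qed (simp add: scale_decay_def)
  also have "\<dots> \<le> 3"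
  proof (cases "J \<le> k")
    case True
    then have "(2::real) ^ J \<le> 2 ^ k" by (intro power_increasing) auto
    then have "2 ^ J / 2 ^ k \<le> (1::real)" by simp
    then have "2 ^ J / 2 ^ k \<le> (3::real)" by linarith
    then show ?thesis using True by (simp only: if_True)
  qed simp
  finally have "(\<Sum>j<J. scale_decay j k) \<le> 3" .
  moreover have "(\<Sum>j\<in>F. scale_decay j k) \<le> (\<Sum>j<J. scale_decay j k)"
    using J by (intro sum_mono2) (auto simp: scale_decay_nonneg)
  ultimately show ?thesis by linarith
qed

text \<open>Schur's test: the matrix \<open>2^-|j-k|\<close> has row and column sums at most 3, hence norm at most 3
  on square summable sequences.\<close>

lemma scale_decay_schur:
  assumes "finite F"
  shows "(\<Sum>j<J. (\<Sum>k\<in>F. scale_decay j k * a k)\<^sup>2) \<le> 9 * (\<Sum>k\<in>F. (a k)\<^sup>2)"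
proof -
  have row: "(\<Sum>k\<in>F. scale_decay j k * a k)\<^sup>2 \<le> 3 * (\<Sum>k\<in>F. scale_decay j k * (a k)\<^sup>2)" for j
  proof -
    have "(\<Sum>k\<in>F. sqrt (scale_decay j k) * (sqrt (scale_decay j k) * a k))\<^sup>2
        \<le> (\<Sum>k\<in>F. (sqrt (scale_decay j k))\<^sup>2) * (\<Sum>k\<in>F. (sqrt (scale_decay j k) * a k)\<^sup>2)"
      by (rule Cauchy_Schwarz_ineq_sum)
    then have "(\<Sum>k\<in>F. scale_decay j k * a k)\<^sup>2 \<le> (\<Sum>k\<in>F. scale_decay j k) * (\<Sum>k\<in>F. scale_decay j k * (a k)\<^sup>2)"
      by (simp add: scale_decay_nonneg power_mult_distrib flip: mult.assoc)
    also have "\<dots> \<le> 3 * (\<Sum>k\<in>F. scale_decay j k * (a k)\<^sup>2)"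
      using sum_scale_decay_le[OF assms, of j]
      by (intro mult_right_mono sum_nonneg) (auto simp: scale_decay_nonneg scale_decay_commute)
    finally show ?thesis .
  qed
  have "(\<Sum>j<J. (\<Sum>k\<in>F. scale_decay j k * a k)\<^sup>2) \<le> (\<Sum>j<J. 3 * (\<Sum>k\<in>F. scale_decay j k * (a k)\<^sup>2))"
    by (intro sum_mono row)
  also have "\<dots> = 3 * (\<Sum>k\<in>F. (\<Sum>j<J. scale_decay j k) * (a k)\<^sup>2)"
    unfolding sum_distrib_left sum_distrib_right by (subst sum.swap) simp
  also have "\<dots> \<le> 3 * (\<Sum>k\<in>F. 3 * (a k)\<^sup>2)"
    by (intro mult_left_mono sum_mono mult_right_mono sum_scale_decay_le) auto
  also have "\<dots> = 9 * (\<Sum>k\<in>F. (a k)\<^sup>2)" by (simp add: sum_distrib_left)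
  finally show ?thesis .
qed

section \<open>Sums of dyadic blocks are subgaussian\<close>

lemma has_vector_derivative_tsum:
  "(tsum A c has_vector_derivative tsum A (\<lambda>n. 2 * of_real pi * \<i> * of_int n * c n) x) (at x within S)"
proof -
  have "((\<lambda>x. \<Sum>n\<in>A. c n * echar n x) has_vector_derivative
      (\<Sum>n\<in>A. c n * (2 * of_real pi * \<i> * of_int n * echar n x))) (at x within S)"
    by (intro has_vector_derivative_sum has_vector_derivative_mult_right has_vector_derivative_echar)
  moreover have "tsum A c = (\<lambda>x. \<Sum>n\<in>A. c n * echar n x)" by (simp add: fun_eq_iff tsum_def)
  ultimately show ?thesis by (simp add: tsum_def mult_ac)
qed

lemma tsum_lipschitz:
  fixes D :: nat and b :: real
  assumes D: "D \<ge> 1" and A: "A \<subseteq> {- int D..int D}" and b: "\<And>x. norm (tsum A c x) \<le> b"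
  shows "norm (tsum A c x - tsum A c y) \<le> 96 * real D * b * \<bar>x - y\<bar>"
proof -
  have b0: "b \<ge> 0" using b[of 0] norm_ge_zero order_trans by blast
  have "norm (tsum A (\<lambda>n. 2 * of_real pi * \<i> * of_int n * c n) z) \<le> 96 * real D * b" for z
  proof -
    have "tsum A (\<lambda>n. 2 * of_real pi * \<i> * of_int n * c n) z
        = (2 * of_real pi * \<i>) * tsum A (\<lambda>n. of_int n * c n) z"
      by (simp add: tsum_def sum_distrib_left mult_ac)
    then have "norm (tsum A (\<lambda>n. 2 * of_real pi * \<i> * of_int n * c n) z)
        = 2 * pi * norm (tsum A (\<lambda>n. of_int n * c n) z)"
      by (simp add: norm_mult)
    also have "\<dots> \<le> 2 * 4 * (12 * real D * b)"
      using bernstein_derivative[OF D A b, of z] pi_less_4 by (intro mult_mono) auto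
    finally show ?thesis by simp
  qed
  moreover have "(tsum A c has_derivative (\<lambda>h. h *\<^sub>R tsum A (\<lambda>n. 2 * of_real pi * \<i> * of_int n * c n) z)) (at z within UNIV)" for z
    using has_vector_derivative_tsum[of A c z UNIV] by (simp add: has_vector_derivative_def)
  ultimately show ?thesis
    using differentiable_bound[of UNIV "tsum A c" "\<lambda>z h. h *\<^sub>R tsum A (\<lambda>n. 2 * of_real pi * \<i> * of_int n * c n) z" "96 * real D * b" x y]
    by (simp add: onorm_scaleR_left[OF bounded_linear_ident] onorm_id)
qed

lemma integral_tsum:
  assumes "0 \<notin> A" "a \<le> b"
  shows "integral {a..b} (tsum A c)
     = tsum A (\<lambda>n. c n / (2 * of_real pi * \<i> * of_int n)) b - tsum A (\<lambda>n. c n / (2 * of_real pi * \<i> * of_int n)) a"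
proof -
  let ?F = "tsum A (\<lambda>n. c n / (2 * of_real pi * \<i> * of_int n))"
  have eq: "tsum A (\<lambda>n. 2 * of_real pi * \<i> * of_int n * (c n / (2 * of_real pi * \<i> * of_int n))) x = tsum A c x" for x
    unfolding tsum_def using assms(1) by (intro sum.cong) auto
  have "(?F has_vector_derivative tsum A c x) (at x within {a..b})" for x
    using has_vector_derivative_tsum[of A "\<lambda>n. c n / (2 * of_real pi * \<i> * of_int n)" x "{a..b}"]
    unfolding eq .
  then have "(tsum A c has_integral (?F b - ?F a)) {a..b}"
    by (intro fundamental_theorem_of_calculus assms(2))
  then show ?thesis by (rule integral_unique)
qed

lemma dyadic_avg_near:
  fixes g :: "real \<Rightarrow> complex"
  assumes cont: "continuous_on UNIV g"
    and near: "\<And>x. real i / 2 ^ j \<le> x \<Longrightarrow> x \<le> (real i + 1) / 2 ^ j \<Longrightarrow> norm (g x - v) \<le> e"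
  shows "norm (dyadic_avg g j i - v) \<le> e"
proof -
  let ?a = "real i / 2 ^ j" and ?b = "(real i + 1) / 2 ^ j"
  have le: "?a \<le> ?b" by (simp add: divide_right_mono)
  have len: "?b - ?a = 1 / 2 ^ j" by (simp add: field_simps)
  have "integral {?a..?b} (\<lambda>x. g x - v) = integral {?a..?b} g - integral {?a..?b} (\<lambda>x. v)"
    by (intro Henstock_Kurzweil_Integration.integral_diff integrable_continuous_interval
        continuous_on_subset[OF cont] continuous_on_const) auto
  also have "integral {?a..?b} (\<lambda>x. v) = (1 / 2 ^ j) *\<^sub>R v" using le len by simp
  finally have "dyadic_avg g j i - v = 2 ^ j *\<^sub>R integral {?a..?b} (\<lambda>x. g x - v)"
    by (simp add: dyadic_avg_def scaleR_diff_right)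
  moreover have "norm (integral {?a..?b} (\<lambda>x. g x - v)) \<le> e * (?b - ?a)"
    using near by (intro integral_bound le continuous_intros continuous_on_subset[OF cont]) auto
  then have "2 ^ j * norm (integral {?a..?b} (\<lambda>x. g x - v)) \<le> 2 ^ j * (e * (1 / 2 ^ j))"
    unfolding len by (rule mult_left_mono) simp
  ultimately show ?thesis by simp
qed

text \<open>On an interval that is short compared with the wave length, averaging over one half changes
  little: both halves are compared with the value at the midpoint.\<close>

lemma dyadic_step_low_frequency:
  fixes D :: nat and b :: real
  assumes D: "D \<ge> 1" and A: "A \<subseteq> {- int D..int D}" and b: "\<And>x. norm (tsum A c x) \<le> b"
  shows "norm (dyadic_avg (tsum A c) (Suc j) (2 * i) - dyadic_avg (tsum A c) j i) \<le> 48 * real D * b / 2 ^ j"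
proof -
  define m where "m = real (2 * i + 1) / 2 ^ Suc j"
  define e where "e = 96 * real D * b / 2 ^ Suc j"
  have b0: "b \<ge> 0" using b[of 0] norm_ge_zero order_trans by blast
  have close: "norm (tsum A c x - tsum A c m) \<le> e" if "\<bar>x - m\<bar> \<le> 1 / 2 ^ Suc j" for x
  proof -
    have "96 * real D * b * \<bar>x - m\<bar> \<le> 96 * real D * b * (1 / 2 ^ Suc j)"
      using that b0 by (intro mult_left_mono) auto
    then show ?thesis using tsum_lipschitz[OF D A b, of x m] by (simp add: e_def)
  qed
  have l: "norm (dyadic_avg (tsum A c) (Suc j) (2 * i) - tsum A c m) \<le> e"
    by (intro dyadic_avg_near continuous_tsum close) (auto simp: m_def add_divide_distrib abs_le_iff)
  have r: "norm (dyadic_avg (tsum A c) (Suc j) (2 * i + 1) - tsum A c m) \<le> e"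
    by (intro dyadic_avg_near continuous_tsum close) (auto simp: m_def add_divide_distrib abs_le_iff)
  have "norm (dyadic_avg (tsum A c) (Suc j) (2 * i) - dyadic_avg (tsum A c) (Suc j) (2 * i + 1)) \<le> 2 * e"
    using norm_triangle_sub[of "dyadic_avg (tsum A c) (Suc j) (2 * i) - tsum A c m" "dyadic_avg (tsum A c) (Suc j) (2 * i + 1) - tsum A c m"]
      norm_triangle_ineq4[of "dyadic_avg (tsum A c) (Suc j) (2 * i) - tsum A c m" "dyadic_avg (tsum A c) (Suc j) (2 * i + 1) - tsum A c m"] l r
    by simp
  moreover have "dyadic_avg (tsum A c) (Suc j) (2 * i) - dyadic_avg (tsum A c) j i
     = (1/2) *\<^sub>R (dyadic_avg (tsum A c) (Suc j) (2 * i) - dyadic_avg (tsum A c) (Suc j) (2 * i + 1))"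
    unfolding dyadic_avg_mean[OF continuous_tsum, of A c j i]
    by (simp add: complex_eq_iff add_divide_distrib)
  ultimately have "norm (dyadic_avg (tsum A c) (Suc j) (2 * i) - dyadic_avg (tsum A c) j i) \<le> e" by simp
  then show ?thesis by (simp add: e_def mult_ac)
qed

text \<open>On an interval that is long compared with the wave length the average is a difference quotient
  of the antiderivative, which is small.\<close>

lemma dyadic_avg_high_frequency:
  fixes Q :: nat
  assumes Q: "Q \<ge> 1" and A: "A \<subseteq> {n. int Q \<le> \<bar>n\<bar> \<and> \<bar>n\<bar> \<le> 4 * int Q}"
    and b: "\<And>x. norm (tsum A c x) \<le> b"
  shows "norm (dyadic_avg (tsum A c) j i) \<le> 16 * 2 ^ j * b / Q"
proof -
  have A0: "0 \<notin> A" using A Q by auto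
  have F: "norm (tsum A (\<lambda>n. c n / (2 * of_real pi * \<i> * of_int n)) x) \<le> 8 * b / Q" for x
  proof -
    have "tsum A (\<lambda>n. c n / (2 * of_real pi * \<i> * of_int n)) x
        = tsum A (\<lambda>n. c n / of_int n) x / (2 * of_real pi * \<i>)"
      by (simp add: tsum_def sum_divide_distrib mult_ac)
    then have "norm (tsum A (\<lambda>n. c n / (2 * of_real pi * \<i> * of_int n)) x)
        = norm (tsum A (\<lambda>n. c n / of_int n) x) / (2 * pi)"
      by (simp add: norm_divide norm_mult)
    also have "\<dots> \<le> (48 / Q * b) / (2 * 3)"
      using bernstein_antiderivative[OF Q A b, of x] pi_gt3
      by (intro frac_le) (auto intro: order_trans[OF norm_ge_zero])
    finally show ?thesis by simp
  qed
  have "norm (integral {real i / 2 ^ j..(real i + 1) / 2 ^ j} (tsum A c)) \<le> 8 * b / Q + 8 * b / Q"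
  proof -
    have eq: "integral {real i / 2 ^ j..(real i + 1) / 2 ^ j} (tsum A c)
       = tsum A (\<lambda>n. c n / (2 * of_real pi * \<i> * of_int n)) ((real i + 1) / 2 ^ j)
         - tsum A (\<lambda>n. c n / (2 * of_real pi * \<i> * of_int n)) (real i / 2 ^ j)"
      by (rule integral_tsum[OF A0]) (simp add: divide_right_mono)
    show ?thesis unfolding eq by (rule order_trans[OF norm_triangle_ineq4 add_mono[OF F F]])
  qed
  then have "2 ^ j * norm (integral {real i / 2 ^ j..(real i + 1) / 2 ^ j} (tsum A c)) \<le> 2 ^ j * (16 * b / Q)"
    by (intro mult_left_mono) auto
  then show ?thesis by (simp add: dyadic_avg_def mult_ac)
qed

text \<open>The frequencies that can occur in the \<open>k\<close>-th Littlewood-Paley piece.\<close>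

definition dyadic_shell :: "nat \<Rightarrow> int set" where
  "dyadic_shell k = (if k = 0 then {-2..2} else {n. 2 ^ (k - 1) \<le> \<bar>n\<bar> \<and> \<bar>n\<bar> \<le> 2 ^ (k + 1)})"

lemma dyadic_shell_subset: "dyadic_shell k \<subseteq> {- int (2 ^ (k + 1))..int (2 ^ (k + 1))}"
  by (auto simp: dyadic_shell_def)

lemma finite_dyadic_shell [simp]: "finite (dyadic_shell k)"
  by (rule finite_subset[OF dyadic_shell_subset]) simp

lemma zero_notin_dyadic_shell: "k \<ge> 1 \<Longrightarrow> 0 \<notin> dyadic_shell k"
  by (simp add: dyadic_shell_def)

lemma dyadic_step_shell:
  assumes k: "k \<ge> 1" and b: "\<And>x. norm (tsum (dyadic_shell k) c x) \<le> b"
  shows "norm (dyadic_avg (tsum (dyadic_shell k) c) (Suc j) (2 * i) - dyadic_avg (tsum (dyadic_shell k) c) j i)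
     \<le> 96 * scale_decay j k * b"
proof -
  let ?g = "tsum (dyadic_shell k) c"
  have b0: "b \<ge> 0" using b[of 0] norm_ge_zero order_trans by blast
  obtain l where l: "k = Suc l" using k by (cases k) auto
  have "norm (dyadic_avg ?g (Suc j) (2 * i) - dyadic_avg ?g j i) \<le> 48 * real (2 ^ (k + 1)) * b / 2 ^ j"
    by (rule dyadic_step_low_frequency[OF _ dyadic_shell_subset b]) simp
  then have low: "norm (dyadic_avg ?g (Suc j) (2 * i) - dyadic_avg ?g j i) \<le> 96 * b * (2 ^ k / 2 ^ j)"
    by (simp add: mult_ac)
  have A: "dyadic_shell k \<subseteq> {n. int (2 ^ l) \<le> \<bar>n\<bar> \<and> \<bar>n\<bar> \<le> 4 * int (2 ^ l)}"
    by (auto simp: dyadic_shell_def l)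
  have "norm (dyadic_avg ?g (Suc j) (2 * i) - dyadic_avg ?g j i)
      \<le> 16 * 2 ^ Suc j * b / real (2 ^ l) + 16 * 2 ^ j * b / real (2 ^ l)"
    by (intro order_trans[OF norm_triangle_ineq4] add_mono dyadic_avg_high_frequency[OF _ A b]) auto
  also have "\<dots> = 96 * b * (2 ^ j / 2 ^ k)" by (simp add: l)
  finally have high: "norm (dyadic_avg ?g (Suc j) (2 * i) - dyadic_avg ?g j i) \<le> 96 * b * (2 ^ j / 2 ^ k)" .
  have "96 * scale_decay j k * b = min (96 * b * (2 ^ k / 2 ^ j)) (96 * b * (2 ^ j / 2 ^ k))"
    using b0 unfolding scale_decay_def by (simp add: min_mult_distrib_left min_mult_distrib_right mult_ac)
  then show ?thesis using low high by simp
qed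

text \<open>By the two preceding estimates the martingale differences are bounded by the scale decay matrix
  applied to \<open>a\<close>; Schur's test bounds the sum of their squares. The factor \<open>w\<close> of modulus 1 selects a
  direction in the complex plane.\<close>

lemma subgaussian_mgf:
  fixes a :: "nat \<Rightarrow> real" and lam :: real
  assumes F: "finite F" "0 \<notin> F" and w: "norm w = 1" and lam: "lam > 0"
    and a: "\<And>k x. k \<in> F \<Longrightarrow> norm (tsum (dyadic_shell k) (c k) x) \<le> a k"
    and S: "(\<Sum>k\<in>F. (a k)\<^sup>2) \<le> S"
  shows "integral {0..1} (\<lambda>x. exp (lam * Re (w * (\<Sum>k\<in>F. tsum (dyadic_shell k) (c k) x)))) \<le> exp (lam\<^sup>2 * (288\<^sup>2 * S) / 2)"
proof -
  define g where "g k = tsum (dyadic_shell k) (c k)" for k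
  define h where "h z = lam * Re (w * z)" for z
  have cg: "continuous_on UNIV (g k)" for k unfolding g_def by (rule continuous_tsum)
  have cG: "continuous_on UNIV (\<lambda>x. \<Sum>k\<in>F. g k x)"
    by (intro continuous_on_sum cg)
  have h: "bounded_linear h" unfolding h_def
    by (intro bounded_linear_const_mult bounded_linear_compose[OF bounded_linear_Re] bounded_linear_mult_right)
  interpret h: bounded_linear h by fact
  have hle: "\<bar>h z\<bar> \<le> lam * norm z" for z
    using abs_Re_le_cmod[of "w * z"] w lam by (simp add: h_def abs_mult norm_mult)
  define u where "u x = h (\<Sum>k\<in>F. g k x)" for x
  have avg: "dyadic_avg u j i = h (\<Sum>k\<in>F. dyadic_avg (g k) j i)" for j i
    unfolding u_def dyadic_avg_bounded_linear[OF h cG] dyadic_avg_sum[OF F(1) cg] ..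
  have "integral {0..1} (\<lambda>x. exp (u x)) \<le> exp (lam\<^sup>2 * (288\<^sup>2 * S) / 2)"
  proof (rule exp_integral_le_dyadic)
    show "continuous_on UNIV u" unfolding u_def
      by (intro linear_continuous_on_compose[OF cG] h.linear_axioms | rule h.continuous_on[OF cG])+
    show "\<bar>u x - u y\<bar> \<le> (lam * (\<Sum>k\<in>F. 96 * real (2 ^ (k + 1)) * a k)) * \<bar>x - y\<bar>" for x y
    proof -
      have "\<bar>u x - u y\<bar> \<le> lam * norm (\<Sum>k\<in>F. g k x - g k y)"
        using hle[of "\<Sum>k\<in>F. g k x - g k y"] by (simp add: u_def h.diff sum_subtractf)
      also have "\<dots> \<le> lam * (\<Sum>k\<in>F. 96 * real (2 ^ (k + 1)) * a k * \<bar>x - y\<bar>)"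
      proof (intro mult_left_mono order_trans[OF norm_sum] sum_mono)
        fix k assume k: "k \<in> F"
        show "norm (g k x - g k y) \<le> 96 * real (2 ^ (k + 1)) * a k * \<bar>x - y\<bar>"
          unfolding g_def by (rule tsum_lipschitz[OF _ dyadic_shell_subset a[OF k]]) simp
      qed (use lam in simp)
      finally show ?thesis by (simp add: sum_distrib_right mult.assoc)
    qed
    show "integral {0..1} u = 0"
    proof -
      have "dyadic_avg (g k) 0 0 = 0" if "k \<in> F" for k
      proof -
        have "k \<ge> 1" using that F(2) by (cases k) auto
        then have "integral {0..1} (g k) = 0" unfolding g_def
          using tsum_periodic[of _ _ 0]
          by (subst integral_tsum) (auto simp: zero_notin_dyadic_shell simp del: tsum_periodic)
        then show ?thesis by (simp add: dyadic_avg_def)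
      qed
      then have "dyadic_avg u 0 0 = 0" unfolding avg by (simp add: h.zero)
      then show ?thesis by (simp add: dyadic_avg_def)
    qed
    show "\<bar>dyadic_avg u (Suc j) (2 * i) - dyadic_avg u j i\<bar> \<le> lam * 96 * (\<Sum>k\<in>F. scale_decay j k * a k)" for j i
    proof -
      have "\<bar>dyadic_avg u (Suc j) (2 * i) - dyadic_avg u j i\<bar>
         \<le> lam * norm (\<Sum>k\<in>F. dyadic_avg (g k) (Suc j) (2 * i) - dyadic_avg (g k) j i)"
        unfolding avg h.diff[symmetric] sum_subtractf[symmetric] by (rule hle)
      also have "\<dots> \<le> lam * (\<Sum>k\<in>F. 96 * scale_decay j k * a k)"
      proof (intro mult_left_mono order_trans[OF norm_sum] sum_mono)
        fix k assume k: "k \<in> F"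
        then have "k \<ge> 1" using F(2) by (cases k) auto
        then show "norm (dyadic_avg (g k) (Suc j) (2 * i) - dyadic_avg (g k) j i) \<le> 96 * scale_decay j k * a k"
          unfolding g_def by (rule dyadic_step_shell) (rule a[OF k])
      qed (use lam in simp)
      finally show ?thesis by (simp add: sum_distrib_left mult_ac)
    qed
    show "(\<Sum>j<J. (lam * 96 * (\<Sum>k\<in>F. scale_decay j k * a k))\<^sup>2) \<le> lam\<^sup>2 * (288\<^sup>2 * S)" for J
    proof -
      have "(\<Sum>j<J. (lam * 96 * (\<Sum>k\<in>F. scale_decay j k * a k))\<^sup>2)
         = (lam * 96)\<^sup>2 * (\<Sum>j<J. (\<Sum>k\<in>F. scale_decay j k * a k)\<^sup>2)"
        by (simp only: power_mult_distrib sum_distrib_left[symmetric])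
      also have "\<dots> \<le> (lam * 96)\<^sup>2 * (9 * S)"
        using scale_decay_schur[OF F(1), where J = J and a = a] S by (intro mult_left_mono) auto
      finally show ?thesis by (simp add: power_mult_distrib)
    qed
  qed
  then show ?thesis by (simp add: u_def h_def g_def)
qed

section \<open>Lebesgue and exponential norms\<close>

lemma Lp_norm_le_iff:
  assumes p: "p \<ge> 1" and b: "b \<ge> 0"
  shows "Lp_norm p f \<le> ennreal b \<longleftrightarrow> (\<integral>\<^sup>+ x. ennreal (norm (f x) powr p) \<partial>torus) \<le> ennreal (b powr p)"
proof -
  define I where "I = (\<integral>\<^sup>+ x. ennreal (norm (f x) powr p) \<partial>torus)"
  have L: "Lp_norm p f = (if I = \<infinity> then \<infinity> else ennreal (enn2real I powr (1 / p)))"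
    by (simp add: Lp_norm_def I_def Let_def)
  show ?thesis
  proof (cases "I = \<infinity>")
    case True
    then show ?thesis unfolding L I_def[symmetric] by (auto simp: top_unique)
  next
    case False
    define r where "r = enn2real I"
    have r: "I = ennreal r" "r \<ge> 0" using False by (simp_all add: r_def less_top)
    have "r powr (1 / p) \<le> b \<longleftrightarrow> r \<le> b powr p"
    proof
      assume "r powr (1 / p) \<le> b"
      then have "(r powr (1 / p)) powr p \<le> b powr p" using p by (intro powr_mono2) auto
      then show "r \<le> b powr p" using p r by (simp add: powr_powr)
    next
      assume "r \<le> b powr p"
      then have "r powr (1 / p) \<le> (b powr p) powr (1 / p)" using p r by (intro powr_mono2) auto
      then show "r powr (1 / p) \<le> b" using p b by (simp add: powr_powr)
    qed
    moreover have "Lp_norm p f \<le> ennreal b \<longleftrightarrow> r powr (1 / p) \<le> b"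
      using False b unfolding L r_def[symmetric] by simp
    moreover have "I \<le> ennreal (b powr p) \<longleftrightarrow> r \<le> b powr p" by (simp add: r)
    ultimately show ?thesis by (simp add: I_def)
  qed
qed

lemma Lp_norm_mono_AE:
  assumes "p \<ge> 1" "AE x in torus. norm (f x) \<le> norm (g x)"
  shows "Lp_norm p f \<le> Lp_norm p g"
proof (cases "Lp_norm p g")
  case (real b)
  have "(\<integral>\<^sup>+ x. ennreal (norm (f x) powr p) \<partial>torus) \<le> (\<integral>\<^sup>+ x. ennreal (norm (g x) powr p) \<partial>torus)"
    using assms by (intro nn_integral_mono_AE) (auto intro!: ennreal_leI powr_mono2)
  also have "\<dots> \<le> ennreal (b powr p)"
    using Lp_norm_le_iff[of p b g] real assms(1) by simp
  finally show ?thesis using Lp_norm_le_iff[of p b f] real assms(1) by simp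
qed simp

lemma Lp_norm_cong_AE:
  assumes "p \<ge> 1" "AE x in torus. f x = g x"
  shows "Lp_norm p f = Lp_norm p g"
  using assms by (intro antisym Lp_norm_mono_AE) auto

lemma Lp_norm_bounded:
  assumes "p \<ge> 1" "b \<ge> 0" "\<And>x. x \<in> {0..<1} \<Longrightarrow> norm (f x) \<le> b"
  shows "Lp_norm p f \<le> ennreal b"
proof -
  have "(\<integral>\<^sup>+ x. ennreal (norm (f x) powr p) \<partial>torus) \<le> (\<integral>\<^sup>+ x. ennreal (b powr p) \<partial>torus)"
    using assms by (intro nn_integral_mono) (auto intro!: ennreal_leI powr_mono2 simp: space_torus)
  also have "\<dots> = ennreal (b powr p)" using torus.emeasure_space_1 by (simp add: space_torus)
  finally show ?thesis using assms by (simp add: Lp_norm_le_iff)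
qed

text \<open>A triangle inequality up to the factor 4 is all that two-sided bounds up to constants require; it
  follows from \<open>|f| + |g| \<le> 2 max |f| |g|\<close>. Only an upper bound for \<open>h\<close> is assumed, so that the rule applies to sums and to
  differences.\<close>

lemma Lp_norm_quasi_triangle:
  assumes p: "p \<ge> 1" and M: "M \<ge> 0" and meas: "f \<in> borel_measurable torus" "g \<in> borel_measurable torus"
    and f: "Lp_norm p f \<le> ennreal M" and g: "Lp_norm p g \<le> ennreal M"
    and h: "AE x in torus. norm (h x) \<le> norm (f x) + norm (g x)"
  shows "Lp_norm p h \<le> ennreal (4 * M)"
proof -
  have "(\<integral>\<^sup>+ x. ennreal (norm (h x) powr p) \<partial>torus)
      \<le> (\<integral>\<^sup>+ x. ennreal (2 powr p) * (ennreal (norm (f x) powr p) + ennreal (norm (g x) powr p)) \<partial>torus)"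
  proof (rule nn_integral_mono_AE, use h in eventually_elim)
    fix x assume "norm (h x) \<le> norm (f x) + norm (g x)"
    also have "\<dots> \<le> 2 * max (norm (f x)) (norm (g x))" by simp
    finally have "norm (h x) powr p \<le> (2 * max (norm (f x)) (norm (g x))) powr p"
      using p by (intro powr_mono2) auto
    also have "\<dots> \<le> 2 powr p * (norm (f x) powr p + norm (g x) powr p)"
      by (auto simp: powr_mult max_def intro!: mult_left_mono)
    finally show "ennreal (norm (h x) powr p) \<le> ennreal (2 powr p) * (ennreal (norm (f x) powr p) + ennreal (norm (g x) powr p))"
      by (simp flip: ennreal_plus ennreal_mult)
  qed
  also have "\<dots> = ennreal (2 powr p) * ((\<integral>\<^sup>+ x. ennreal (norm (f x) powr p) \<partial>torus) + (\<integral>\<^sup>+ x. ennreal (norm (g x) powr p) \<partial>torus))"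
    using meas by (simp add: nn_integral_cmult nn_integral_add)
  also have "\<dots> \<le> ennreal (2 powr p) * (ennreal (M powr p) + ennreal (M powr p))"
    using f g p M by (intro mult_left_mono add_mono) (auto simp: Lp_norm_le_iff)
  also have "\<dots> = ennreal (2 * (2 * M) powr p)"
    using M by (simp add: powr_mult flip: ennreal_plus ennreal_mult)
  also have "\<dots> \<le> ennreal ((4 * M) powr p)"
  proof (rule ennreal_leI)
    have "2 * (2 * M) powr p \<le> 2 powr p * (2 * M) powr p"
      using powr_mono[OF p, of 2] by (intro mult_right_mono) auto
    also have "\<dots> = (4 * M) powr p" using M by (simp add: powr_mult[symmetric])
    finally show "2 * (2 * M) powr p \<le> (4 * M) powr p" .
  qed
  finally show ?thesis using p M by (simp add: Lp_norm_le_iff)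
qed

text \<open>The moments of order \<open>p\<close> are read off from the moment generating function by
  \<open>t^p \<le> exp (p t)\<close>; the choice \<open>lam\<close> of order \<open>sqrt p / s\<close> balances the two factors.\<close>

lemma subgaussian_Lp:
  fixes a :: "nat \<Rightarrow> real" and s p :: real
  assumes F: "finite F" "0 \<notin> F"
    and a: "\<And>k x. k \<in> F \<Longrightarrow> norm (tsum (dyadic_shell k) (c k) x) \<le> a k"
    and S: "(\<Sum>k\<in>F. (a k)\<^sup>2) \<le> s\<^sup>2" and s: "s > 0" and p: "p \<ge> 1"
  shows "Lp_norm p (\<lambda>x. \<Sum>k\<in>F. tsum (dyadic_shell k) (c k) x) \<le> ennreal (5000 * s * sqrt p)"
proof -
  define G where "G x = (\<Sum>k\<in>F. tsum (dyadic_shell k) (c k) x)" for x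
  define lam where "lam = sqrt p / (288 * s)"
  \<comment> \<open>every complex number has a component of at least half its modulus in one of four directions\<close>
  define W where "W = {1, -1, \<i>, -\<i>}"
  have lam: "lam > 0" using s p by (simp add: lam_def)
  have cG: "continuous_on UNIV G"
    unfolding G_def by (intro continuous_on_sum continuous_tsum)
  have W: "finite W" "card W \<le> 4" "\<And>w. w \<in> W \<Longrightarrow> norm w = 1"
    by (auto simp: W_def intro!: order_trans[OF card_insert_le_m1])
  have pt: "norm z powr p \<le> (2 * p / lam) powr p * (\<Sum>w\<in>W. exp (lam * Re (w * z)))" for z
  proof -
    have "\<exists>w\<in>W. norm z / 2 \<le> Re (w * z)"
      using cmod_le[of z] by (auto simp: W_def)
    then obtain w where w: "w \<in> W" "norm z / 2 \<le> Re (w * z)" by blast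
    define t where "t = lam * norm z / (2 * p)"
    have t: "t \<ge> 0" using lam p by (simp add: t_def)
    have "norm z powr p = (2 * p / lam) powr p * t powr p"
      using lam p by (simp add: t_def powr_mult[symmetric])
    also have "t powr p \<le> exp t powr p"
      using t p exp_ge_add_one_self[of t] by (intro powr_mono2) linarith+
    also have "exp t powr p = exp (lam * (norm z / 2))"
      using p by (simp add: t_def exp_powr_real)
    also have "\<dots> \<le> exp (lam * Re (w * z))"
      using w(2) lam by simp
    also have "\<dots> \<le> (\<Sum>w\<in>W. exp (lam * Re (w * z)))"
      using w(1) W(1) by (intro member_le_sum) auto
    finally show ?thesis by (simp add: mult_left_mono)
  qed
  have ci: "continuous_on UNIV (\<lambda>x. exp (lam * Re (w * G x)))" for w
    by (intro continuous_intros cG)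
  have mgf: "(\<integral>x. exp (lam * Re (w * G x)) \<partial>torus) \<le> exp (p / 2)" if "w \<in> W" for w
  proof -
    have "(\<integral>x. exp (lam * Re (w * G x)) \<partial>torus) \<le> exp (lam\<^sup>2 * (288\<^sup>2 * s\<^sup>2) / 2)"
      unfolding integral_torus_continuous[OF ci] unfolding G_def
      by (rule subgaussian_mgf[OF F W(3)[OF that] lam a S])
    also have "lam\<^sup>2 * (288\<^sup>2 * s\<^sup>2) / 2 = p / 2"
      using s p by (simp add: lam_def power_divide power_mult_distrib)
    finally show ?thesis .
  qed
  have "(\<integral>\<^sup>+ x. ennreal (norm (G x) powr p) \<partial>torus)
     \<le> (\<integral>\<^sup>+ x. ennreal ((2 * p / lam) powr p * (\<Sum>w\<in>W. exp (lam * Re (w * G x)))) \<partial>torus)"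
    by (intro nn_integral_mono ennreal_leI pt)
  also have "\<dots> = ennreal (\<integral>x. (2 * p / lam) powr p * (\<Sum>w\<in>W. exp (lam * Re (w * G x))) \<partial>torus)"
    by (intro nn_integral_eq_integral integrable_torus_continuous continuous_on_mult continuous_on_sum ci
         continuous_on_const AE_I2 mult_nonneg_nonneg sum_nonneg) auto
  also have "(\<integral>x. (2 * p / lam) powr p * (\<Sum>w\<in>W. exp (lam * Re (w * G x))) \<partial>torus)
     = (2 * p / lam) powr p * (\<Sum>w\<in>W. \<integral>x. exp (lam * Re (w * G x)) \<partial>torus)"
    unfolding integral_mult_right_zero
    by (subst Bochner_Integration.integral_sum[OF integrable_torus_continuous[OF ci]]) (rule refl)
  also have "\<dots> \<le> (2 * p / lam) powr p * (4 * exp (p / 2))"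
  proof (intro mult_left_mono)
    have "(\<Sum>w\<in>W. \<integral>x. exp (lam * Re (w * G x)) \<partial>torus) \<le> (\<Sum>w\<in>W. exp (p / 2))"
      by (intro sum_mono mgf)
    also have "\<dots> \<le> 4 * exp (p / 2)" using W(2) by simp
    finally show "(\<Sum>w\<in>W. \<integral>x. exp (lam * Re (w * G x)) \<partial>torus) \<le> 4 * exp (p / 2)" .
  qed simp
  also have "\<dots> \<le> (5000 * s * sqrt p) powr p"
  proof -
    have "exp (1 / 2) \<le> (2 :: real)"
      using exp_bound_half[of "1/2 :: real"] by simp
    then have "exp (1 / 2) powr p \<le> 2 powr p" using p by (intro powr_mono2) auto
    then have e: "exp (p / 2) \<le> 2 powr p" by (simp add: exp_powr_real)
    have f: "4 \<le> 4 powr p" using powr_mono[OF p, of 4] by simp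
    have "4 * exp (p / 2) \<le> 4 powr p * 2 powr p"
      by (intro mult_mono e f) auto
    then have "(2 * p / lam) powr p * (4 * exp (p / 2)) \<le> (2 * p / lam) powr p * (4 powr p * 2 powr p)"
      by (intro mult_left_mono) auto
    also have "\<dots> = (2 * p / lam * 8) powr p"
      using lam p by (simp add: powr_mult[symmetric])
    also have "2 * p / lam * 8 = 4608 * s * sqrt p"
    proof -
      have "2 * p / lam * 8 = 4608 * s * (p / sqrt p)" by (simp add: lam_def)
      also have "p / sqrt p = sqrt p" using p by (simp add: real_div_sqrt)
      finally show ?thesis .
    qed
    also have "(4608 * s * sqrt p) powr p \<le> (5000 * s * sqrt p) powr p"
      using s p by (intro powr_mono2 mult_right_mono) auto
    finally show ?thesis .
  qed
  finally have "(\<integral>\<^sup>+ x. ennreal (norm (G x) powr p) \<partial>torus) \<le> ennreal ((5000 * s * sqrt p) powr p)"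
    by (simp add: ennreal_leI)
  then show ?thesis using s p by (subst Lp_norm_le_iff) (auto simp: G_def)
qed

lemma expL_norm_le_iff:
  assumes "M \<ge> 0"
  shows "expL_norm \<nu> f \<le> ennreal M \<longleftrightarrow> (\<forall>p\<ge>1. Lp_norm p f \<le> ennreal (M * p powr (1 / \<nu>)))"
proof -
  have "ennreal (p powr (- 1 / \<nu>)) * Lp_norm p f \<le> ennreal M \<longleftrightarrow> Lp_norm p f \<le> ennreal (M * p powr (1 / \<nu>))"
    if p: "p \<ge> 1" for p
  proof (cases "Lp_norm p f")
    case (real l)
    have "p powr (- 1 / \<nu>) * l \<le> M \<longleftrightarrow> l \<le> M * p powr (1 / \<nu>)"
      using p by (simp add: powr_minus field_simps minus_divide_left[symmetric])
    then show ?thesis using real assms p by (simp flip: ennreal_mult)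
  next
    case top
    then show ?thesis using p by (simp add: ennreal_mult_top top_unique)
  qed
  then show ?thesis unfolding expL_norm_def SUP_le_iff by auto
qed

lemma expL_norm_cong_AE:
  assumes "AE x in torus. f x = g x"
  shows "expL_norm \<nu> f = expL_norm \<nu> g"
  unfolding expL_norm_def by (intro SUP_cong refl) (simp add: Lp_norm_cong_AE[OF _ assms])

lemma expL_norm_bounded:
  assumes "\<nu> > 0" "b \<ge> 0" "\<And>x. x \<in> {0..<1} \<Longrightarrow> norm (f x) \<le> b"
  shows "expL_norm \<nu> f \<le> ennreal b"
proof (subst expL_norm_le_iff[OF assms(2)], intro allI impI)
  fix p :: real assume p: "p \<ge> 1"
  have "Lp_norm p f \<le> ennreal b" by (rule Lp_norm_bounded[OF p assms(2,3)])
  also have "\<dots> \<le> ennreal (b * p powr (1 / \<nu>))"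
    using assms p ge_one_powr_ge_zero[of p "1 / \<nu>"] by (intro ennreal_leI) (simp add: mult_le_cancel_left1)
  finally show "Lp_norm p f \<le> ennreal (b * p powr (1 / \<nu>))" .
qed

lemma expL_norm_quasi_triangle:
  assumes M: "M \<ge> 0" and meas: "f \<in> borel_measurable torus" "g \<in> borel_measurable torus"
    and f: "expL_norm \<nu> f \<le> ennreal M" and g: "expL_norm \<nu> g \<le> ennreal M"
    and h: "AE x in torus. norm (h x) \<le> norm (f x) + norm (g x)"
  shows "expL_norm \<nu> h \<le> ennreal (4 * M)"
proof (subst expL_norm_le_iff, use M in simp, intro allI impI)
  fix p :: real assume p: "p \<ge> 1"
  have "Lp_norm p h \<le> ennreal (4 * (M * p powr (1 / \<nu>)))"
    using f g p M by (intro Lp_norm_quasi_triangle[OF p _ meas _ _ h]) (auto simp: expL_norm_le_iff)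
  then show "Lp_norm p h \<le> ennreal (4 * M * p powr (1 / \<nu>))" by (simp add: mult.assoc)
qed

section \<open>Tails of Littlewood-Paley decompositions\<close>

text \<open>Comparison with the integral of \<open>t powr -s\<close> by the mean value theorem.\<close>

lemma sum_powr_tail_le:
  fixes s :: real
  assumes s: "s > 1"
  shows "(\<Sum>k\<in>{q<..M}. (1 + real k) powr - s) \<le> (1 + real q) powr (1 - s) / (s - 1)"
proof -
  have step: "(s - 1) * (1 + real k) powr - s \<le> real k powr (1 - s) - (1 + real k) powr (1 - s)" if "k \<ge> 1" for k
  proof -
    have "\<exists>z. real k < z \<and> z < 1 + real k \<and>
        (1 + real k) powr (1 - s) - real k powr (1 - s) = (1 + real k - real k) * ((1 - s) * z powr (1 - s - 1))"
      using that by (intro MVT2 has_real_derivative_powr) auto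
    then obtain z where z: "real k < z" "z < 1 + real k"
      "(1 + real k) powr (1 - s) - real k powr (1 - s) = (1 - s) * z powr - s" by auto
    have "(1 + real k) powr - s \<le> z powr - s" using z that s by (intro powr_mono2') auto
    then have "(s - 1) * (1 + real k) powr - s \<le> (s - 1) * z powr - s" using s by (intro mult_left_mono) auto
    then show ?thesis using z(3) by (simp add: algebra_simps)
  qed
  have "(s - 1) * (\<Sum>k\<in>{q<..M}. (1 + real k) powr - s) \<le> (1 + real q) powr (1 - s) - (1 + real M) powr (1 - s)"
    if "q \<le> M" using that
  proof (induction M rule: dec_induct)
    case (step M)
    have "{q<..Suc M} = insert (Suc M) {q<..M}" using step.hyps by auto
    then have "(s - 1) * (\<Sum>k\<in>{q<..Suc M}. (1 + real k) powr - s)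
      = (s - 1) * (1 + real (Suc M)) powr - s + (s - 1) * (\<Sum>k\<in>{q<..M}. (1 + real k) powr - s)"
      by (simp add: distrib_left)
    also have "\<dots> \<le> (real (Suc M) powr (1 - s) - (1 + real (Suc M)) powr (1 - s))
        + ((1 + real q) powr (1 - s) - (1 + real M) powr (1 - s))"
      by (intro add_mono step.IH \<open>\<And>k. 1 \<le> k \<Longrightarrow> (s - 1) * (1 + real k) powr - s \<le> _\<close>) simp
    finally show ?case by (simp add: add.commute)
  qed simp
  moreover have "(1 + real M) powr (1 - s) \<ge> 0" by simp
  ultimately have "q \<le> M \<Longrightarrow> (s - 1) * (\<Sum>k\<in>{q<..M}. (1 + real k) powr - s) \<le> (1 + real q) powr (1 - s)"
    by linarith
  then show ?thesis using s by (cases "q \<le> M") (auto simp: field_simps)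
qed

definition admissible_exponents :: "real \<Rightarrow> real \<Rightarrow> bool" where
  "admissible_exponents \<nu> \<gamma> \<longleftrightarrow> \<nu> > 0 \<and> ((\<gamma> > 1/2 \<and> \<nu> < 2) \<or> (\<nu> \<ge> 2 \<and> \<gamma> > 1 - 1/\<nu>))"

text \<open>The common name \<open>\<beta>\<close> for \<open>\<gamma> - 1/2\<close> and \<open>\<gamma> - 1 + 1/\<nu>\<close>: tails after \<open>K\<close> pieces decay like
  \<open>K powr -\<beta>\<close>.\<close>

definition decay_exponent :: "real \<Rightarrow> real \<Rightarrow> real" where
  "decay_exponent \<nu> \<gamma> = (if \<nu> < 2 then \<gamma> - 1/2 else \<gamma> + 1/\<nu> - 1)"

lemma admissible_exponentsD:
  assumes "admissible_exponents \<nu> \<gamma>"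
  shows "\<nu> > 0" "\<gamma> > 1/2" "decay_exponent \<nu> \<gamma> > 0"
proof -
  have half: "1 / \<nu> \<le> 1 / 2" if "\<nu> \<ge> 2" using that by (intro divide_left_mono) auto
  show "\<nu> > 0" using assms by (simp add: admissible_exponents_def)
  show "\<gamma> > 1/2" "decay_exponent \<nu> \<gamma> > 0"
    using assms half unfolding admissible_exponents_def decay_exponent_def
    by (cases "\<nu> < 2"; simp; linarith)+
qed

abbreviation shell_sum :: "(nat \<Rightarrow> int \<Rightarrow> complex) \<Rightarrow> nat set \<Rightarrow> real \<Rightarrow> complex" where
  "shell_sum c F x \<equiv> \<Sum>k\<in>F. tsum (dyadic_shell k) (c k) x"

text \<open>The condition \<open>LG_norm f \<le> A\<close> in terms of an abstract sequence of pieces; limits of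
  decompositions need not come from a function that is known in advance.\<close>

definition shell_bounded :: "real \<Rightarrow> real \<Rightarrow> (nat \<Rightarrow> int \<Rightarrow> complex) \<Rightarrow> bool" where
  "shell_bounded \<gamma> A c \<longleftrightarrow> (\<forall>k x. norm (tsum (dyadic_shell k) (c k) x) \<le> A * (1 + real k) powr - \<gamma>)"

lemma continuous_shell_sum: "continuous_on UNIV (shell_sum c F)"
  by (intro continuous_on_sum continuous_tsum)

lemma measurable_shell_sum: "shell_sum c F \<in> borel_measurable torus"
  by (rule borel_measurable_torus_continuous[OF continuous_shell_sum])

lemma shell_tail_Lp:
  assumes \<gamma>: "\<gamma> > 1/2" and A: "A > 0" and c: "shell_bounded \<gamma> A c" and p: "p \<ge> 1"
  shows "Lp_norm p (shell_sum c {q<..M})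
    \<le> ennreal (5000 / sqrt (2 * \<gamma> - 1) * A * (1 + real q) powr (1/2 - \<gamma>) * sqrt p)"
proof -
  define s where "s = A * (1 + real q) powr (1/2 - \<gamma>) / sqrt (2 * \<gamma> - 1)"
  have s: "s > 0" using A \<gamma> by (simp add: s_def)
  have "(\<Sum>k\<in>{q<..M}. (A * (1 + real k) powr - \<gamma>)\<^sup>2) = A\<^sup>2 * (\<Sum>k\<in>{q<..M}. (1 + real k) powr - (2 * \<gamma>))"
    by (simp add: power_mult_distrib sum_distrib_left power2_eq_square[of "_ powr _"] flip: powr_add)
  also have "\<dots> \<le> A\<^sup>2 * ((1 + real q) powr (1 - 2 * \<gamma>) / (2 * \<gamma> - 1))"
    using \<gamma> by (intro mult_left_mono sum_powr_tail_le) auto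
  also have "\<dots> = s\<^sup>2"
    using \<gamma> by (simp add: s_def power_mult_distrib power_divide power2_eq_square[of "_ powr _"] flip: powr_add)
  finally have "Lp_norm p (shell_sum c {q<..M}) \<le> ennreal (5000 * s * sqrt p)"
    using c by (intro subgaussian_Lp[OF _ _ _ _ s p, where a = "\<lambda>k. A * (1 + real k) powr - \<gamma>"])
      (auto simp: shell_bounded_def)
  then show ?thesis by (simp add: s_def mult_ac)
qed

text \<open>For \<open>\<nu> < 2\<close> the factor \<open>sqrt p\<close> is absorbed by \<open>p powr (1/\<nu>)\<close>. For \<open>\<nu> \<ge> 2\<close> this
  works only for frequencies above the level \<open>p\<close>, where \<open>sqrt p\<close> can be traded for a power of \<open>k\<close>. Below the
  level \<open>p\<close> the sup norms are added, and \<open>p powr (1/\<nu>)\<close> dominates \<open>k powr (1/\<nu>)\<close>.\<close>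

lemma shell_tail_expL:
  assumes adm: "admissible_exponents \<nu> \<gamma>"
  shows "\<exists>C>0. \<forall>A c K M. A > 0 \<longrightarrow> shell_bounded \<gamma> A c \<longrightarrow>
    expL_norm \<nu> (shell_sum c {K<..M}) \<le> ennreal (C * A * (1 + real K) powr - decay_exponent \<nu> \<gamma>)"
proof -
  define \<beta> where "\<beta> = decay_exponent \<nu> \<gamma>"
  define B where "B = 5000 / sqrt (2 * \<gamma> - 1)"
  note pos = admissible_exponentsD[OF adm]
  have B: "B > 0" using pos by (simp add: B_def)
  have \<beta>: "\<beta> > 0" using pos by (simp add: \<beta>_def)
  define C where "C = 4 * (2 / \<beta> + B)"
  have C: "C > 0" using \<beta> B by (simp add: C_def add_pos_pos)
  have "expL_norm \<nu> (shell_sum c {K<..M}) \<le> ennreal (C * A * (1 + real K) powr - \<beta>)"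
    if A: "A > 0" and c: "shell_bounded \<gamma> A c" for A c K M
  proof (subst expL_norm_le_iff, use A C in simp, intro allI impI)
    fix p :: real assume p: "p \<ge> 1"
    show "Lp_norm p (shell_sum c {K<..M}) \<le> ennreal (C * A * (1 + real K) powr - \<beta> * p powr (1 / \<nu>))"
    proof (cases "\<nu> < 2")
      case True
      have "Lp_norm p (shell_sum c {K<..M}) \<le> ennreal (B * A * (1 + real K) powr (1/2 - \<gamma>) * sqrt p)"
        unfolding B_def by (rule shell_tail_Lp[OF pos(2) A c p])
      also have "\<dots> \<le> ennreal (C * A * (1 + real K) powr - \<beta> * p powr (1 / \<nu>))"
      proof (intro ennreal_leI mult_mono)
        show "B \<le> C" using \<beta> B by (simp add: C_def)
        have "1/2 \<le> 1/\<nu>" using True pos by (intro divide_left_mono) auto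
        then show "sqrt p \<le> p powr (1 / \<nu>)" using p by (simp add: powr_half_sqrt[symmetric] powr_mono)
        show "(1 + real K) powr (1/2 - \<gamma>) \<le> (1 + real K) powr - \<beta>"
          using True by (simp add: \<beta>_def decay_exponent_def)
      qed (use A B C p in auto)
      finally show ?thesis .
    next
      case False
      \<comment> \<open>the level that separates trivial summation from the subgaussian estimate\<close>
      define q where "q = max K (nat \<lfloor>p\<rfloor>)"
      define N where "N = A * (2 / \<beta> + B) * (1 + real K) powr - \<beta> * p powr (1 / \<nu>)"
      have N: "N \<ge> 0" using A B \<beta> by (simp add: N_def)
      have q: "K \<le> q" "p \<le> 1 + real q" using p unfolding q_def by linarith+
      have low: "Lp_norm p (shell_sum c {K<..min q M}) \<le> ennreal N"
      proof (rule Lp_norm_bounded[OF p N])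
        fix x
        have "norm (shell_sum c {K<..min q M} x) \<le> (\<Sum>k\<in>{K<..min q M}. A * (2 * p powr (1 / \<nu>)) * (1 + real k) powr - (1 + \<beta>))"
        proof (rule order_trans[OF norm_sum sum_mono])
          fix k assume "k \<in> {K<..min q M}"
          then have "K < k" "k \<le> q" by auto
          then have "k \<le> nat \<lfloor>p\<rfloor>" by (auto simp: q_def)
          then have k: "1 + real k \<le> 2 * p" using p by linarith
          have "(1 + real k) powr - \<gamma> = (1 + real k) powr (1 / \<nu>) * (1 + real k) powr - (1 + \<beta>)"
            using False by (simp add: \<beta>_def decay_exponent_def flip: powr_add)
          also have "\<dots> \<le> (2 * p) powr (1 / \<nu>) * (1 + real k) powr - (1 + \<beta>)"
            using k pos by (intro mult_right_mono powr_mono2) auto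
          also have "\<dots> \<le> 2 * p powr (1 / \<nu>) * (1 + real k) powr - (1 + \<beta>)"
          proof -
            have "(2::real) powr (1 / \<nu>) \<le> 2 powr 1" using False by (intro powr_mono) auto
            then show ?thesis using p by (simp add: powr_mult mult_right_mono)
          qed
          finally have "(1 + real k) powr - \<gamma> \<le> 2 * p powr (1 / \<nu>) * (1 + real k) powr - (1 + \<beta>)" .
          then have "A * (1 + real k) powr - \<gamma> \<le> A * (2 * p powr (1 / \<nu>) * (1 + real k) powr - (1 + \<beta>))"
            using A by (intro mult_left_mono) auto
          then show "norm (tsum (dyadic_shell k) (c k) x) \<le> A * (2 * p powr (1 / \<nu>)) * (1 + real k) powr - (1 + \<beta>)"
            using c unfolding shell_bounded_def by (simp add: mult_ac) (metis order_trans)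
        qed
        also have "\<dots> \<le> A * (2 * p powr (1 / \<nu>)) * ((1 + real K) powr (1 - (1 + \<beta>)) / (1 + \<beta> - 1))"
          unfolding sum_distrib_left[symmetric] using A \<beta>
          by (intro mult_left_mono sum_powr_tail_le) auto
        also have "\<dots> = A * (2 / \<beta>) * (1 + real K) powr - \<beta> * p powr (1 / \<nu>)" by simp
        also have "\<dots> \<le> N" unfolding N_def using A B by (intro mult_right_mono mult_left_mono) auto
        finally show "norm (shell_sum c {K<..min q M} x) \<le> N" .
      qed
      have high: "Lp_norm p (shell_sum c {q<..M}) \<le> ennreal N"
      proof -
        have "Lp_norm p (shell_sum c {q<..M}) \<le> ennreal (B * A * (1 + real q) powr (1/2 - \<gamma>) * sqrt p)"
          unfolding B_def by (rule shell_tail_Lp[OF pos(2) A c p])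
        also have "\<dots> \<le> ennreal N"
        proof (rule ennreal_leI)
          have "sqrt p = p powr (1/2 - 1/\<nu>) * p powr (1 / \<nu>)"
            using p by (simp add: powr_half_sqrt flip: powr_add)
          also have "\<dots> \<le> (1 + real q) powr (1/2 - 1/\<nu>) * p powr (1 / \<nu>)"
            using p q False by (intro mult_right_mono powr_mono2) (auto simp: field_simps)
          finally have "(1 + real q) powr (1/2 - \<gamma>) * sqrt p
              \<le> (1 + real q) powr (1/2 - \<gamma>) * ((1 + real q) powr (1/2 - 1/\<nu>) * p powr (1 / \<nu>))"
            by (intro mult_left_mono) auto
          also have "\<dots> = (1 + real q) powr - \<beta> * p powr (1 / \<nu>)"
          proof -
            have "(1/2 - \<gamma>) + (1/2 - 1/\<nu>) = - \<beta>" using False by (simp add: \<beta>_def decay_exponent_def)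
            then show ?thesis unfolding mult.assoc[symmetric] powr_add[symmetric] by simp
          qed
          also have "\<dots> \<le> (1 + real K) powr - \<beta> * p powr (1 / \<nu>)"
            using q \<beta> by (intro mult_right_mono powr_mono2') auto
          finally have "B * A * ((1 + real q) powr (1/2 - \<gamma>) * sqrt p) \<le> B * A * ((1 + real K) powr - \<beta> * p powr (1 / \<nu>))"
            using A B by (intro mult_left_mono) auto
          also have "\<dots> \<le> (A * (2 / \<beta> + B)) * ((1 + real K) powr - \<beta> * p powr (1 / \<nu>))"
            using A \<beta> by (intro mult_right_mono) (auto simp: algebra_simps)
          finally show "B * A * (1 + real q) powr (1/2 - \<gamma>) * sqrt p \<le> N" by (simp add: N_def mult.assoc)
        qed
        finally show ?thesis .
      qed
      have "{K<..M} = {K<..min q M} \<union> {q<..M}" using q(1) by auto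
      moreover have "{K<..min q M} \<inter> {q<..M} = {}" by auto
      ultimately have split: "shell_sum c {K<..M} x = shell_sum c {K<..min q M} x + shell_sum c {q<..M} x" for x
        by (simp add: sum.union_disjoint)
      have "Lp_norm p (shell_sum c {K<..M}) \<le> ennreal (4 * N)"
        unfolding split
        by (intro Lp_norm_quasi_triangle[OF p N _ _ low high] measurable_shell_sum AE_I2 norm_triangle_ineq)
      also have "4 * N = C * A * (1 + real K) powr - \<beta> * p powr (1 / \<nu>)" by (simp add: N_def C_def)
      finally show ?thesis .
    qed
  qed
  then show ?thesis using C unfolding \<beta>_def by blast
qed

lemma expL_norm_imp_L1:
  assumes "expL_norm \<nu> f \<le> ennreal M" "M \<ge> 0"
  shows "(\<integral>\<^sup>+ x. ennreal (norm (f x)) \<partial>torus) \<le> ennreal M"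
proof -
  have "Lp_norm 1 f \<le> ennreal (M * 1 powr (1 / \<nu>))" using assms expL_norm_le_iff[of M \<nu> f] by auto
  then show ?thesis using Lp_norm_le_iff[of 1 M f] assms by simp
qed

text \<open>The partial sums form a Cauchy sequence in \<open>L^1\<close>, so a subsequence converges almost everywhere,
  and Fatou's lemma carries the tail estimate over to the limit.\<close>

lemma shell_synthesis:
  assumes adm: "admissible_exponents \<nu> \<gamma>"
  shows "\<exists>C>0. \<forall>A c. A > 0 \<longrightarrow> shell_bounded \<gamma> A c \<longrightarrow>
    (\<exists>g. periodic1 g \<and> g \<in> borel_measurable torus \<and>
      (\<forall>K. expL_norm \<nu> (\<lambda>x. g x - shell_sum c {..K} x) \<le> ennreal (C * A * (1 + real K) powr - decay_exponent \<nu> \<gamma>)))"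
proof -
  define \<beta> where "\<beta> = decay_exponent \<nu> \<gamma>"
  have \<beta>: "\<beta> > 0" using admissible_exponentsD[OF adm] by (simp add: \<beta>_def)
  obtain C where C: "C > 0" and tail: "\<And>A c K M. A > 0 \<Longrightarrow> shell_bounded \<gamma> A c \<Longrightarrow>
    expL_norm \<nu> (shell_sum c {K<..M}) \<le> ennreal (C * A * (1 + real K) powr - \<beta>)"
    using shell_tail_expL[OF adm] unfolding \<beta>_def by blast
  have "\<exists>g. periodic1 g \<and> g \<in> borel_measurable torus \<and>
      (\<forall>K. expL_norm \<nu> (\<lambda>x. g x - shell_sum c {..K} x) \<le> ennreal (C * A * (1 + real K) powr - \<beta>))"
    if A: "A > 0" and c: "shell_bounded \<gamma> A c" for A c
  proof -
    define s where "s N = shell_sum c {..N}" for N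
    have diff: "s M x - s K x = shell_sum c {K<..M} x" if "K \<le> M" for K M x
    proof -
      have "{..M} = {..K} \<union> {K<..M}" using that by auto
      then show ?thesis by (simp add: s_def sum.union_disjoint ivl_disj_int)
    qed
    have ms: "s N \<in> borel_measurable torus" for N unfolding s_def by (rule measurable_shell_sum)
    have "\<exists>n. C * A * (1 + real n) powr - \<beta> \<le> e" if "e > 0" for e
    proof -
      have "(\<lambda>n. (1 + real n) powr - \<beta>) \<longlonglongrightarrow> 0"
        using \<beta> by (intro tendsto_neg_powr filterlim_tendsto_add_at_top[OF tendsto_const] filterlim_real_sequentially) auto
      then have "(\<lambda>n. C * A * (1 + real n) powr - \<beta>) \<longlonglongrightarrow> C * A * 0"
        by (intro tendsto_mult tendsto_const)
      then have "\<forall>\<^sub>F n in sequentially. C * A * (1 + real n) powr - \<beta> < e"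
        using that by (intro order_tendstoD) auto
      then show ?thesis by (auto simp: eventually_sequentially intro: less_imp_le)
    qed
    then have "\<forall>i. \<exists>n. C * A * (1 + real n) powr - \<beta> \<le> (1/2) ^ i" by simp
    then obtain m where m: "\<And>i. C * A * (1 + real (m i)) powr - \<beta> \<le> (1/2) ^ i" by metis
    \<comment> \<open>a nondecreasing unbounded sequence of indices with \<open>r i \<ge> m i\<close>\<close>
    define r where "r i = i + (\<Sum>j\<le>i. m j)" for i
    have r_mono: "r i \<le> r (Suc i)" for i by (simp add: r_def)
    have r_ge: "i \<le> r i" for i by (simp add: r_def)
    have r: "C * A * (1 + real (r i)) powr - \<beta> \<le> (1/2) ^ i" for i
    proof -
      have "m i \<le> r i" unfolding r_def by (rule trans_le_add2) (rule member_le_sum, auto)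
      then have "(1 + real (r i)) powr - \<beta> \<le> (1 + real (m i)) powr - \<beta>" using \<beta> by (intro powr_mono2') auto
      then have "C * A * (1 + real (r i)) powr - \<beta> \<le> C * A * (1 + real (m i)) powr - \<beta>"
        using C A by (intro mult_left_mono) auto
      then show ?thesis using m[of i] by linarith
    qed
    have step: "(\<integral>\<^sup>+ x. ennreal (norm (s (r (Suc i)) x - s (r i) x)) \<partial>torus) \<le> ennreal ((1/2) ^ i)" for i
      unfolding diff[OF r_mono]
      by (rule expL_norm_imp_L1[OF order_trans[OF tail[OF A c] ennreal_leI[OF r]]]) simp
    have "(\<integral>\<^sup>+ x. (\<Sum>i. ennreal (norm (s (r (Suc i)) x - s (r i) x))) \<partial>torus)
       = (\<Sum>i. \<integral>\<^sup>+ x. ennreal (norm (s (r (Suc i)) x - s (r i) x)) \<partial>torus)"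
      using ms by (intro nn_integral_suminf) measurable
    also have "\<dots> \<le> (\<Sum>i. ennreal ((1/2) ^ i))"
      by (intro suminf_le step) auto
    also have "\<dots> = ennreal (\<Sum>i. (1/2) ^ i)"
      by (intro suminf_ennreal2) (auto intro: summable_geometric)
    also have "\<dots> < \<infinity>" by simp
    finally have fin: "(\<integral>\<^sup>+ x. (\<Sum>i. ennreal (norm (s (r (Suc i)) x - s (r i) x))) \<partial>torus) \<noteq> \<infinity>" by simp
    have "AE x in torus. (\<Sum>i. ennreal (norm (s (r (Suc i)) x - s (r i) x))) \<noteq> \<infinity>"
      using ms by (intro nn_integral_PInf_AE fin) measurable
    then have conv: "AE x in torus. convergent (\<lambda>i. s (r i) x)"
    proof eventually_elim
      fix x assume "(\<Sum>i. ennreal (norm (s (r (Suc i)) x - s (r i) x))) \<noteq> \<infinity>"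
      then have "summable (\<lambda>i. norm (s (r (Suc i)) x - s (r i) x))"
        by (intro summable_suminf_not_top) auto
      then have "summable (\<lambda>i. s (r (Suc i)) x - s (r i) x)" by (rule summable_norm_cancel)
      then have "convergent (\<lambda>n. \<Sum>i<n. s (r (Suc i)) x - s (r i) x)"
        by (simp add: summable_iff_convergent)
      then have "convergent (\<lambda>n. s (r n) x - s (r 0) x)"
        by (simp add: sum_lessThan_telescope[of "\<lambda>i. s (r i) x"])
      then have "convergent (\<lambda>n. (s (r n) x - s (r 0) x) + s (r 0) x)"
        by (intro convergent_add convergent_const)
      then show "convergent (\<lambda>i. s (r i) x)" by simp
    qed
    \<comment> \<open>where the limit does not exist, \<open>g x\<close> is some value that depends only on the sequence, so \<open>g\<close> is periodic\<close>
    define g where "g x = lim (\<lambda>i. s (r i) x)" for x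
    have "periodic1 g" by (simp add: periodic1_def g_def s_def)
    moreover have mg: "g \<in> borel_measurable torus"
      unfolding g_def using ms by (intro borel_measurable_lim_metric) measurable
    moreover have "expL_norm \<nu> (\<lambda>x. g x - s K x) \<le> ennreal (C * A * (1 + real K) powr - \<beta>)" for K
    proof (subst expL_norm_le_iff, use A C in simp, intro allI impI)
      fix p :: real assume p: "p \<ge> 1"
      define b where "b = C * A * (1 + real K) powr - \<beta> * p powr (1 / \<nu>)"
      have b: "b \<ge> 0" using A C by (simp add: b_def)
      have part: "(\<integral>\<^sup>+ x. ennreal (norm (s N x - s K x) powr p) \<partial>torus) \<le> ennreal (b powr p)" if "K \<le> N" for N
      proof -
        have "Lp_norm p (\<lambda>x. s N x - s K x) \<le> ennreal b"
          unfolding diff[OF that] b_def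
          using tail[OF A c, of K N] p A C by (subst (asm) expL_norm_le_iff) auto
        then show ?thesis using Lp_norm_le_iff[OF p b] by simp
      qed
      have "(\<integral>\<^sup>+ x. ennreal (norm (g x - s K x) powr p) \<partial>torus)
         = (\<integral>\<^sup>+ x. liminf (\<lambda>i. ennreal (norm (s (r i) x - s K x) powr p)) \<partial>torus)"
      proof (rule nn_integral_cong_AE, use conv in eventually_elim)
        fix x assume "convergent (\<lambda>i. s (r i) x)"
        then have "(\<lambda>i. s (r i) x) \<longlonglongrightarrow> g x" by (simp add: g_def convergent_LIMSEQ_iff)
        then have "(\<lambda>i. norm (s (r i) x - s K x) powr p) \<longlonglongrightarrow> norm (g x - s K x) powr p"
          using p by (intro tendsto_powr' tendsto_norm tendsto_diff tendsto_const) auto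
        then have "(\<lambda>i. ennreal (norm (s (r i) x - s K x) powr p)) \<longlonglongrightarrow> ennreal (norm (g x - s K x) powr p)"
          by (rule tendsto_ennrealI)
        then show "ennreal (norm (g x - s K x) powr p) = liminf (\<lambda>i. ennreal (norm (s (r i) x - s K x) powr p))"
          by (intro lim_imp_Liminf[symmetric]) auto
      qed
      also have "\<dots> \<le> liminf (\<lambda>i. \<integral>\<^sup>+ x. ennreal (norm (s (r i) x - s K x) powr p) \<partial>torus)"
        using ms by (intro nn_integral_liminf) measurable
      also have "\<dots> \<le> liminf (\<lambda>i. ennreal (b powr p))"
      proof (rule Liminf_mono)
        have "\<forall>\<^sub>F i in sequentially. K \<le> i" by (rule eventually_ge_at_top)
        then show "\<forall>\<^sub>F i in sequentially. (\<integral>\<^sup>+ x. ennreal (norm (s (r i) x - s K x) powr p) \<partial>torus) \<le> ennreal (b powr p)"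
          by eventually_elim (intro part order_trans[OF _ r_ge])
      qed
      also have "\<dots> = ennreal (b powr p)" by (simp add: Liminf_const)
      finally show "Lp_norm p (\<lambda>x. g x - s K x) \<le> ennreal (C * A * (1 + real K) powr - \<beta> * p powr (1 / \<nu>))"
        using Lp_norm_le_iff[OF p b] by (simp add: b_def)
    qed
    ultimately show ?thesis unfolding s_def by blast
  qed
  then show ?thesis using C unfolding \<beta>_def by blast
qed

section \<open>Uniqueness of Fourier coefficients of integrable functions\<close>

lemma AE_torus_notin_negligible:
  assumes "negligible N"
  shows "AE x in torus. x \<notin> N"
proof -
  have "AE x in lebesgue. x \<notin> N"
    using assms by (intro AE_not_in) (simp add: negligible_iff_null_sets)
  then show ?thesis by (subst AE_restrict_space_iff) auto
qed

lemma borel_measurable_torus_of_borel: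
  "g \<in> borel_measurable borel \<Longrightarrow> g \<in> borel_measurable torus"
  by (intro measurable_restrict_space1 measurable_completion) auto

lemma integrable_torus_times:
  fixes h :: "real \<Rightarrow> complex" and v :: "real \<Rightarrow> complex"
  assumes h: "integrable torus h" and v: "v \<in> borel_measurable torus" "\<And>x. norm (v x) \<le> b"
  shows "integrable torus (\<lambda>x. h x * v x)"
proof (rule Bochner_Integration.integrable_bound)
  show "integrable torus (\<lambda>x. b *\<^sub>R h x)" using h by simp
  show "(\<lambda>x. h x * v x) \<in> borel_measurable torus"
    by (intro borel_measurable_times borel_measurable_integrable h v)
  show "AE x in torus. norm (h x * v x) \<le> norm (b *\<^sub>R h x)"
  proof (rule AE_I2)
    fix x
    have "norm (h x) * norm (v x) \<le> norm (h x) * b" by (intro mult_left_mono v) auto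
    moreover have "0 \<le> b" using v(2)[of 0] norm_ge_zero order_trans by blast
    ultimately show "norm (h x * v x) \<le> norm (b *\<^sub>R h x)" by (simp add: norm_mult mult.commute)
  qed
qed

lemma cos_eq_echar:
  "complex_of_real (cos (2 * pi * (x - m))) = (echar (-1) m * echar 1 x + echar 1 m * echar (-1) x) / 2"
proof -
  have "echar (-1) m * echar 1 x = cis (2 * pi * (x - m))"
    by (simp add: echar_def cis_mult algebra_simps)
  moreover have "echar 1 m * echar (-1) x = cis (- (2 * pi * (x - m)))"
    by (simp add: echar_def cis_mult algebra_simps)
  ultimately show ?thesis by (simp add: complex_eq_iff)
qed

text \<open>Multiplication by the cosine shifts the frequency by \<open>1\<close> and \<open>-1\<close>.\<close>

lemma integral_times_cos_power_eq_0:
  assumes h: "integrable torus h" and zero: "\<And>n. fourier_coeff h n = 0"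
  shows "(\<integral>x. h x * (of_real (cos (2 * pi * (x - m))) ^ k * echar n x) \<partial>torus) = 0"
proof (induction k arbitrary: n)
  case 0
  show ?case using zero[of "- n"] by (simp add: fourier_coeff_echar)
next
  case (Suc k)
  let ?v = "\<lambda>n x. of_real (cos (2 * pi * (x - m))) ^ k * echar n x :: complex"
  have int: "integrable torus (\<lambda>x. h x * ?v n x)" for n
  proof (rule integrable_torus_times[OF h])
    show "?v n \<in> borel_measurable torus"
      by (intro borel_measurable_torus_continuous continuous_intros)
    show "norm (?v n x) \<le> 1" for x
      by (simp add: norm_mult norm_power power_le_one)
  qed
  have "h x * (of_real (cos (2 * pi * (x - m))) ^ Suc k * echar n x)
     = echar (-1) m / 2 * (h x * ?v (1 + n) x) + echar 1 m / 2 * (h x * ?v (-1 + n) x)" for x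
    unfolding power_Suc cos_eq_echar echar_add by (simp add: algebra_simps add_divide_distrib)
  then show ?case
    using Suc.IH int by simp
qed

text \<open>Weierstrass approximation on \<open>[-1, 1]\<close>.\<close>

lemma integral_times_continuous_cos_eq_0:
  fixes F :: "real \<Rightarrow> real"
  assumes h: "integrable torus h" and zero: "\<And>n. fourier_coeff h n = 0"
    and F: "continuous_on UNIV F"
  shows "(\<integral>x. h x * of_real (F (cos (2 * pi * (x - m)))) \<partial>torus) = 0"
proof -
  let ?u = "\<lambda>x. cos (2 * pi * (x - m))"
  have cont: "continuous_on UNIV (\<lambda>x. complex_of_real (G (?u x)))" if "continuous_on UNIV G" for G :: "real \<Rightarrow> real"
    by (intro continuous_on_of_real continuous_on_compose2[OF that] continuous_intros) auto
  have bnd: "\<exists>b. \<forall>x. norm (complex_of_real (G (?u x))) \<le> b" if "continuous_on UNIV G" for G :: "real \<Rightarrow> real"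
  proof -
    have "compact (G ` {-1..1})" by (intro compact_continuous_image continuous_on_subset[OF that]) auto
    then obtain b where "\<forall>y\<in>G ` {-1..1}. norm y \<le> b" using compact_imp_bounded bounded_iff by metis
    then show ?thesis by (intro exI[of _ b]) auto
  qed
  have int: "integrable torus (\<lambda>x. h x * of_real (G (?u x)))" if G: "continuous_on UNIV G" for G :: "real \<Rightarrow> real"
  proof -
    obtain b where "\<And>x. norm (complex_of_real (G (?u x))) \<le> b" using bnd[OF G] by blast
    then show ?thesis by (intro integrable_torus_times[OF h] borel_measurable_torus_continuous cont G)
  qed
  have "norm (\<integral>x. h x * of_real (F (?u x)) \<partial>torus) \<le> e * (\<integral>x. norm (h x) \<partial>torus)" if e: "e > 0" for e
  proof -
    obtain g where g: "real_polynomial_function g" "\<And>t. t \<in> {-1..1} \<Longrightarrow> \<bar>F t - g t\<bar> < e"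
      using Stone_Weierstrass_real_polynomial_function[of "{-1..1}" F e] e continuous_on_subset[OF F] by blast
    then obtain a N where gs: "g = (\<lambda>t. \<Sum>i\<le>N. a i * t ^ i)"
      unfolding real_polynomial_function_iff_sum by blast
    have cg: "continuous_on UNIV g" unfolding gs by (intro continuous_intros)
    have intk: "integrable torus (\<lambda>x. h x * of_real (?u x) ^ k)" for k
      using int[of "\<lambda>t. t ^ k"] by (simp add: continuous_on_power continuous_on_id)
    have "(\<integral>x. h x * of_real (g (?u x)) \<partial>torus) = (\<integral>x. (\<Sum>i\<le>N. of_real (a i) * (h x * of_real (?u x) ^ i)) \<partial>torus)"
      by (simp add: gs sum_distrib_left mult_ac)
    also have "\<dots> = (\<Sum>i\<le>N. of_real (a i) * (\<integral>x. h x * of_real (?u x) ^ i \<partial>torus))"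
      using intk by (subst Bochner_Integration.integral_sum) auto
    also have "\<dots> = 0"
      using integral_times_cos_power_eq_0[OF h zero, where n = 0 and m = m] by simp
    finally have eq: "(\<integral>x. h x * of_real (F (?u x)) \<partial>torus)
       = (\<integral>x. h x * of_real (F (?u x)) - h x * of_real (g (?u x)) \<partial>torus)"
      using int[OF F] int[OF cg] by simp
    have "norm (\<integral>x. h x * of_real (F (?u x)) \<partial>torus)
        \<le> (\<integral>x. norm (h x * of_real (F (?u x)) - h x * of_real (g (?u x))) \<partial>torus)"
      unfolding eq by (rule integral_norm_bound)
    also have "\<dots> \<le> (\<integral>x. e * norm (h x) \<partial>torus)"
    proof (rule integral_mono)
      show "integrable torus (\<lambda>x. norm (h x * of_real (F (?u x)) - h x * of_real (g (?u x))))"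
        by (rule integrable_norm[OF Bochner_Integration.integrable_diff[OF int[OF F] int[OF cg]]])
      show "integrable torus (\<lambda>x. e * norm (h x))" using h by simp
      fix x
      have "norm (h x * of_real (F (?u x)) - h x * of_real (g (?u x))) = norm (h x) * \<bar>F (?u x) - g (?u x)\<bar>"
        by (simp flip: right_diff_distrib of_real_diff add: norm_mult)
      also have "\<dots> \<le> norm (h x) * e"
        using g(2)[of "?u x"] by (intro mult_left_mono) auto
      finally show "norm (h x * of_real (F (?u x)) - h x * of_real (g (?u x))) \<le> e * norm (h x)"
        by (simp add: mult.commute)
    qed
    finally show ?thesis by simp
  qed
  then have "norm (\<integral>x. h x * of_real (F (?u x)) \<partial>torus) \<le> 0"
  proof -
    assume *: "\<And>e. e > 0 \<Longrightarrow> norm (\<integral>x. h x * of_real (F (?u x)) \<partial>torus) \<le> e * (\<integral>x. norm (h x) \<partial>torus)"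
    define I where "I = (\<integral>x. norm (h x) \<partial>torus)"
    have I: "I \<ge> 0" by (simp add: I_def)
    show ?thesis
    proof (rule field_le_epsilon)
      fix e :: real assume e: "e > 0"
      have "norm (\<integral>x. h x * of_real (F (?u x)) \<partial>torus) \<le> e / (I + 1) * I"
      proof -
        have "0 < e / (I + 1)" using e I by simp
        from *[OF this] show ?thesis by (simp only: I_def)
      qed
      also have "\<dots> \<le> e" using e I by (simp add: field_simps)
      finally show "norm (\<integral>x. h x * of_real (F (?u x)) \<partial>torus) \<le> 0 + e" by simp
    qed
  qed
  then show ?thesis by simp
qed

text \<open>An arc of the circle is cut out by a half plane, so its indicator is a function of a single
  cosine.\<close>

lemma cos_gt_iff_arc:
  assumes ab: "0 \<le> a" "a < b" "b \<le> 1" and x: "0 \<le> x" "x < 1"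
  shows "cos (2 * pi * (x - (a + b) / 2)) > cos (2 * pi * ((b - a) / 2)) \<longleftrightarrow> a < x \<and> x < b"
proof -
  define d where "d = \<bar>x - (a + b) / 2\<bar>"
  define r where "r = (b - a) / 2"
  have r: "0 < r" "r \<le> 1/2" using ab by (auto simp: r_def)
  have d: "0 \<le> d" "d \<le> 1 - r" using ab x by (auto simp: d_def r_def abs_if field_simps)
  have "cos (2 * pi * (x - (a + b) / 2)) = cos \<bar>2 * pi * (x - (a + b) / 2)\<bar>" by simp
  also have "\<dots> = cos (2 * pi * d)" by (simp only: abs_mult d_def) simp
  finally have eq: "cos (2 * pi * (x - (a + b) / 2)) = cos (2 * pi * d)" .
  have "cos (2 * pi * r) < cos (2 * pi * d) \<longleftrightarrow> d < r"
  proof (cases "d \<le> 1/2")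
    case True
    then show ?thesis using d r by (subst cos_mono_less_eq) auto
  next
    case False
    have "cos (2 * pi * d) = cos (2 * pi * (1 - d))"
    proof -
      have "cos (2 * pi * (1 - d)) = cos (2 * pi - 2 * pi * d)" by (simp add: algebra_simps)
      then show ?thesis by (simp add: cos_diff)
    qed
    moreover have "cos (2 * pi * (1 - d)) \<le> cos (2 * pi * r)"
      using d r False by (subst cos_mono_le_eq) auto
    ultimately show ?thesis using d r False by auto
  qed
  moreover have "d < r \<longleftrightarrow> a < x \<and> x < b" by (auto simp: d_def r_def abs_if field_simps)
  ultimately show ?thesis using eq by (simp add: r_def)
qed

lemma integral_times_arc_eq_0:
  assumes h: "integrable torus h" and zero: "\<And>n. fourier_coeff h n = 0"
    and ab: "0 \<le> a" "a < b" "b \<le> 1"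
  shows "(\<integral>x. indicat_real {a<..<b} x *\<^sub>R h x \<partial>torus) = 0"
proof -
  define c where "c = cos (2 * pi * ((b - a) / 2))"
  define u where "u x = cos (2 * pi * (x - (a + b) / 2))" for x
  \<comment> \<open>continuous functions that increase to the indicator of \<open>t > c\<close>\<close>
  define F where "F j t = min 1 (max 0 (real j * (t - c)))" for j t
  have cF: "continuous_on UNIV (F j)" for j unfolding F_def by (intro continuous_intros)
  have cu: "continuous_on UNIV (\<lambda>x. complex_of_real (F j (u x)))" for j
    unfolding u_def by (intro continuous_on_of_real continuous_on_compose2[OF cF] continuous_intros) auto
  have "(\<lambda>j. \<integral>x. h x * of_real (F j (u x)) \<partial>torus) \<longlonglongrightarrow> (\<integral>x. indicat_real {a<..<b} x *\<^sub>R h x \<partial>torus)"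
  proof (rule integral_dominated_convergence[where w = "\<lambda>x. norm (h x)"])
    show "(\<lambda>x. indicat_real {a<..<b} x *\<^sub>R h x) \<in> borel_measurable torus"
      by (intro borel_measurable_scaleR borel_measurable_integrable[OF h] borel_measurable_torus_of_borel) simp
    show "(\<lambda>x. h x * of_real (F j (u x))) \<in> borel_measurable torus" for j
      by (intro borel_measurable_times borel_measurable_integrable[OF h] borel_measurable_torus_continuous cu)
    show "integrable torus (\<lambda>x. norm (h x))" using h by simp
    show "AE x in torus. norm (h x * of_real (F j (u x))) \<le> norm (h x)" for j
      by (rule AE_I2) (auto simp: norm_mult F_def intro!: mult_left_le)
    show "AE x in torus. (\<lambda>j. h x * of_real (F j (u x))) \<longlonglongrightarrow> indicat_real {a<..<b} x *\<^sub>R h x"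
    proof (rule AE_I2)
      fix x assume "x \<in> space torus"
      then have x: "0 \<le> x" "x < 1" by (auto simp: space_torus)
      have iff: "u x > c \<longleftrightarrow> a < x \<and> x < b" unfolding u_def c_def by (rule cos_gt_iff_arc[OF ab x])
      have "(\<lambda>j. F j (u x)) \<longlonglongrightarrow> indicat_real {a<..<b} x"
      proof (cases "u x > c")
        case True
        obtain N where N: "1 / (u x - c) < real N" using reals_Archimedean2 by blast
        have "F j (u x) = 1" if "j \<ge> N" for j
        proof -
          have "1 / (u x - c) \<le> real j" using N that by linarith
          then have "1 \<le> real j * (u x - c)" using True by (simp add: field_simps)
          then show ?thesis by (simp add: F_def)
        qed
        then have "(\<lambda>j. F j (u x)) \<longlonglongrightarrow> 1"
          by (intro tendsto_eventually) (auto simp: eventually_sequentially)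
        then show ?thesis using True iff by simp
      next
        case False
        then have "real j * (u x - c) \<le> 0" for j by (intro mult_nonneg_nonpos) auto
        then have "F j (u x) = 0" for j by (simp add: F_def max_absorb1)
        moreover have "indicat_real {a<..<b} x = 0" using False iff by (auto simp: indicator_def)
        ultimately show ?thesis by simp
      qed
      then have "(\<lambda>j. h x * of_real (F j (u x))) \<longlonglongrightarrow> h x * of_real (indicat_real {a<..<b} x)"
        by (rule tendsto_mult[OF tendsto_const tendsto_of_real])
      then show "(\<lambda>j. h x * of_real (F j (u x))) \<longlonglongrightarrow> indicat_real {a<..<b} x *\<^sub>R h x"
        by (simp add: scaleR_conv_of_real mult.commute)
    qed
  qed
  moreover have "(\<integral>x. h x * of_real (F j (u x)) \<partial>torus) = 0" for j
    unfolding u_def by (rule integral_times_continuous_cos_eq_0[OF h zero cF])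
  ultimately show ?thesis by (simp add: LIMSEQ_const_iff)
qed

text \<open>The integral of \<open>h\<close> vanishes over arcs, hence over Borel sets by the monotone class argument,
  hence over Lebesgue sets.\<close>

lemma fourier_uniqueness:
  assumes h: "integrable torus h" and zero: "\<And>n. fourier_coeff h n = 0"
  shows "AE x in torus. h x = 0"
proof (rule torus.density_zero[OF h])
  have sb: "B \<inter> {0..<1} \<in> sets torus" if "B \<in> sets borel" for B :: "real set"
    using that by (auto simp: sets_restrict_space)
  have ib: "integrable torus (\<lambda>x. indicat_real B x *\<^sub>R h x)" if "B \<in> sets borel" for B
  proof -
    have "integrable torus (\<lambda>x. indicat_real (B \<inter> {0..<1}) x *\<^sub>R h x)"
      by (intro integrable_mult_indicator sb that h)
    then show ?thesis
      by (rule Bochner_Integration.integrable_cong[THEN iffD1, rotated -1]) (auto simp: space_torus indicator_def)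
  qed
  have open01: "(\<integral>x. indicat_real {0<..<1} x *\<^sub>R h x \<partial>torus) = 0"
    by (rule integral_times_arc_eq_0[OF h zero]) auto
  have total: "(\<integral>x. h x \<partial>torus) = 0"
    using zero[of 0] by (simp add: fourier_coeff_echar)
  have borel: "(\<integral>x. indicat_real B x *\<^sub>R h x \<partial>torus) = 0" if "B \<in> sets borel" for B
    using that
  proof (induction B rule: borel_set_induct)
    case empty
    then show ?case by simp
  next
    case (interval a b)
    let ?a = "max a 0" and ?b = "min b 1"
    have neg: "negligible {0, a, b}" by simp
    have ae: "AE x in torus. indicat_real {a..b} x *\<^sub>R h x = indicat_real {?a<..<?b} x *\<^sub>R h x"
      using AE_torus_notin_negligible[OF neg] AE_space[of torus]
      by eventually_elim (auto simp: indicator_def space_torus)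
    have "(\<integral>x. indicat_real {a..b} x *\<^sub>R h x \<partial>torus) = (\<integral>x. indicat_real {?a<..<?b} x *\<^sub>R h x \<partial>torus)"
      by (intro integral_cong_AE ae borel_measurable_integrable ib) auto
    also have "\<dots> = 0"
    proof (cases "?a < ?b")
      case True
      then show ?thesis by (intro integral_times_arc_eq_0[OF h zero]) auto
    next
      case False
      then have empty: "{?a<..<?b} = {}" by (intro greaterThanLessThan_empty) (simp only: not_less)
      show ?thesis unfolding empty by simp
    qed
    finally show ?case .
  next
    case (compl B)
    have "indicat_real (- B) x *\<^sub>R h x = h x - indicat_real B x *\<^sub>R h x" for x by (simp add: indicator_def)
    then show ?case using compl ib[of B] h total by simp
  next
    case (union B)
    have "(\<lambda>n. \<integral>x. indicat_real (\<Union>i<n. B i) x *\<^sub>R h x \<partial>torus) \<longlonglongrightarrow> (\<integral>x. indicat_real (\<Union>i. B i) x *\<^sub>R h x \<partial>torus)"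
    proof (rule integral_dominated_convergence[where w = "\<lambda>x. norm (h x)"])
      show "AE x in torus. (\<lambda>n. indicat_real (\<Union>i<n. B i) x *\<^sub>R h x) \<longlonglongrightarrow> indicat_real (\<Union>i. B i) x *\<^sub>R h x"
        by (intro AE_I2 tendsto_scaleR LIMSEQ_indicator_UN tendsto_const)
      show "AE x in torus. norm (indicat_real (\<Union>i<n. B i) x *\<^sub>R h x) \<le> norm (h x)" for n
        by (intro AE_I2) (auto simp: indicator_def)
    qed (use union h in \<open>auto intro!: borel_measurable_integrable ib\<close>)
    moreover have "(\<integral>x. indicat_real (\<Union>i<n. B i) x *\<^sub>R h x \<partial>torus) = 0" for n
    proof -
      have "indicat_real (\<Union>i<n. B i) x = (\<Sum>i<n. indicat_real (B i) x)" for x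
        using union by (intro indicator_UN_disjoint) (auto simp: disjoint_family_on_def)
      then have "(\<integral>x. indicat_real (\<Union>i<n. B i) x *\<^sub>R h x \<partial>torus) = (\<integral>x. (\<Sum>i<n. indicat_real (B i) x *\<^sub>R h x) \<partial>torus)"
        by (simp add: scaleR_sum_left)
      also have "\<dots> = (\<Sum>i<n. \<integral>x. indicat_real (B i) x *\<^sub>R h x \<partial>torus)"
        using union by (intro Bochner_Integration.integral_sum ib) auto
      finally show ?thesis using union by simp
    qed
    ultimately show ?case by (simp add: LIMSEQ_const_iff)
  qed
  fix A assume A: "A \<in> sets torus"
  then have "A \<in> sets lebesgue" by (auto simp: sets_restrict_space)
  then obtain B N where BN: "B \<in> sets borel" "negligible N" "B \<union> N = A"
    by (rule sets_lebesgue_almost_borel)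
  have "AE x in torus. indicat_real A x *\<^sub>R h x = indicat_real B x *\<^sub>R h x"
    using AE_torus_notin_negligible[OF BN(2)] by eventually_elim (auto simp: indicator_def BN(3)[symmetric])
  then have "(\<integral>x. indicat_real A x *\<^sub>R h x \<partial>torus) = (\<integral>x. indicat_real B x *\<^sub>R h x \<partial>torus)"
    by (intro integral_cong_AE borel_measurable_integrable ib BN integrable_mult_indicator A h)
  then show "set_lebesgue_integral torus A h = 0"
    unfolding set_lebesgue_integral_def using borel[OF BN(1)] by simp
qed

section \<open>The Littlewood-Paley decomposition\<close>

lemma cutoff_eq_1: "admissible_cutoff \<Phi> \<Longrightarrow> \<bar>s\<bar> \<le> 1 \<Longrightarrow> \<Phi> s = 1"
  by (simp add: admissible_cutoff_def)

lemma cutoff_eq_0: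
  assumes "admissible_cutoff \<Phi>" "\<bar>s\<bar> \<ge> 2"
  shows "\<Phi> s = 0"
proof (rule ccontr)
  assume "\<Phi> s \<noteq> 0"
  then have "s \<in> closure {s. \<Phi> s \<noteq> 0}" by (intro subsetD[OF closure_subset]) simp
  then have "s \<in> {-2<..<2}" using assms(1) by (auto simp: admissible_cutoff_def)
  then show False using assms(2) by auto
qed

lemma dyadic_cutoff_alt:
  "dyadic_cutoff \<Phi> k s = (if k = 0 then \<Phi> s else \<Phi> (s / 2 ^ k) - \<Phi> (s / 2 ^ (k - 1)))"
proof (cases k)
  case (Suc l)
  have "2 powr (- real k) = 1 / 2 ^ k" "2 powr (- real k + 1) = 1 / 2 ^ (k - 1)"
    by (simp_all add: Suc powr_diff powr_add powr_minus_divide flip: powr_realpow)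
  then show ?thesis by (simp add: dyadic_cutoff_def)
qed (simp add: dyadic_cutoff_def)

lemma sum_dyadic_cutoff: "(\<Sum>k\<le>K. dyadic_cutoff \<Phi> k s) = \<Phi> (s / 2 ^ K)"
  by (induction K) (simp_all add: dyadic_cutoff_alt)

lemma dyadic_cutoff_eq_0:
  assumes \<Phi>: "admissible_cutoff \<Phi>" and n: "n \<notin> dyadic_shell k"
  shows "dyadic_cutoff \<Phi> k (of_int n) = 0"
proof (cases k)
  case 0
  then have "\<bar>n\<bar> \<ge> 2" using n by (auto simp: dyadic_shell_def)
  then have "\<bar>real_of_int n\<bar> \<ge> 2" by linarith
  then show ?thesis using 0 cutoff_eq_0[OF \<Phi>] by (simp add: dyadic_cutoff_alt)
next
  case (Suc l)
  have "\<bar>n\<bar> < 2 ^ l \<or> \<bar>n\<bar> > 2 ^ (l + 2)" using n by (auto simp: dyadic_shell_def Suc)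
  then show ?thesis
  proof
    assume "\<bar>n\<bar> < 2 ^ l"
    then have "real_of_int \<bar>n\<bar> < of_int (2 ^ l)" by (simp only: of_int_less_iff)
    then have a: "\<bar>real_of_int n\<bar> < 2 ^ l" by simp
    then have "\<bar>real_of_int n / 2 ^ l\<bar> \<le> 1" "\<bar>real_of_int n / 2 ^ Suc l\<bar> \<le> 1" by simp_all
    then show ?thesis using cutoff_eq_1[OF \<Phi>] by (simp add: dyadic_cutoff_alt Suc)
  next
    assume "\<bar>n\<bar> > 2 ^ (l + 2)"
    then have "real_of_int \<bar>n\<bar> > of_int (2 ^ (l + 2))" by (simp only: of_int_less_iff)
    then have "\<bar>real_of_int n\<bar> > 4 * 2 ^ l" by simp
    then have "\<bar>real_of_int n / 2 ^ l\<bar> \<ge> 2" "\<bar>real_of_int n / 2 ^ Suc l\<bar> \<ge> 2" by (simp_all add: field_simps)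
    then show ?thesis using cutoff_eq_0[OF \<Phi>] by (simp add: dyadic_cutoff_alt Suc)
  qed
qed

definition LP_coeff :: "(real \<Rightarrow> real) \<Rightarrow> (real \<Rightarrow> complex) \<Rightarrow> nat \<Rightarrow> int \<Rightarrow> complex" where
  "LP_coeff \<Phi> f k n = of_real (dyadic_cutoff \<Phi> k (of_int n)) * fourier_coeff f n"

lemma LP_piece_eq_tsum:
  assumes "admissible_cutoff \<Phi>"
  shows "LP_piece \<Phi> k f = tsum (dyadic_shell k) (LP_coeff \<Phi> f k)"
proof
  fix x
  have "LP_piece \<Phi> k f x = (\<Sum>\<^sub>\<infinity>n\<in>UNIV. LP_coeff \<Phi> f k n * echar n x)"
  proof -
    have "exp (2 * of_real pi * \<i> * of_int n * of_real x) = echar n x" for n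
      by (simp add: echar_def cis_conv_exp mult_ac)
    then show ?thesis by (simp only: LP_piece_def LP_coeff_def)
  qed
  also have "\<dots> = (\<Sum>\<^sub>\<infinity>n\<in>dyadic_shell k. LP_coeff \<Phi> f k n * echar n x)"
    by (intro infsum_cong_neutral) (auto simp: LP_coeff_def dyadic_cutoff_eq_0[OF assms])
  also have "\<dots> = tsum (dyadic_shell k) (LP_coeff \<Phi> f k) x"
    by (simp add: tsum_def)
  finally show "LP_piece \<Phi> k f x = tsum (dyadic_shell k) (LP_coeff \<Phi> f k) x" .
qed

text \<open>For a continuous function, a bound almost everywhere is a bound everywhere: the excess
  \<open>max 0 (|h| - b)\<close> is continuous with integral 0.\<close>

lemma Linf_norm_le_iff:
  assumes cont: "continuous_on UNIV h" and per: "periodic1 h" and b: "b \<ge> 0"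
  shows "Linf_norm h \<le> ennreal b \<longleftrightarrow> (\<forall>x. norm (h x) \<le> b)"
proof
  have meas: "(\<lambda>x. ennreal (norm (h x))) \<in> borel_measurable torus"
    by (intro measurable_compose[OF borel_measurable_torus_continuous measurable_ennreal] continuous_on_norm cont)
  {
    assume "\<forall>x. norm (h x) \<le> b"
    then show "Linf_norm h \<le> ennreal b"
      unfolding Linf_norm_def by (intro esssup_I meas AE_I2 ennreal_leI) auto
  next
    assume L: "Linf_norm h \<le> ennreal b"
    define u where "u x = max 0 (norm (h x) - b)" for x
    have cu: "continuous_on UNIV u" unfolding u_def by (intro continuous_intros cont)
    have "AE x in torus. ennreal (norm (h x)) \<le> Linf_norm h"
      unfolding Linf_norm_def by (rule esssup_AE)
    then have "AE x in torus. u x = 0"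
    proof eventually_elim
      case (elim x)
      then have "ennreal (norm (h x)) \<le> ennreal b" using L by (rule order_trans)
      then show ?case using b by (simp add: u_def)
    qed
    then have "integral\<^sup>L torus u = 0" by (rule integral_eq_zero_AE)
    then have "integral {0..1} u = 0" using integral_torus_continuous[OF cu] by simp
    moreover have "u x \<ge> 0" for x by (simp add: u_def)
    moreover have "continuous_on {0..1} u" by (rule continuous_on_subset[OF cu]) simp
    ultimately have z: "\<forall>x\<in>{0..1}. u x = 0"
      using integral_eq_0_iff[of 0 1 u] by simp
    show "\<forall>x. norm (h x) \<le> b"
    proof
      fix x
      have shift: "h (y + of_int k) = h y" for y and k :: int
      proof (induction k rule: int_induct[where k = 0])
        case (step1 i)
        have "h (y + of_int (i + 1)) = h ((y + of_int i) + 1)" by (simp add: add.assoc)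
        then show ?case using per step1 by (simp only: periodic1_def)
      next
        case (step2 i)
        have "h ((y + of_int (i - 1)) + 1) = h (y + of_int i)" by (simp add: add.assoc)
        then show ?case using per step2 by (simp only: periodic1_def)
      qed simp
      have "h x = h (frac x)" using shift[of "frac x" "\<lfloor>x\<rfloor>"] by (simp add: frac_def)
      moreover have "u (frac x) = 0" using z frac_ge_0[of x] frac_lt_1[of x] by auto
      ultimately show "norm (h x) \<le> b" by (simp add: u_def max_def split: if_splits)
    qed
  }
qed

lemma LG_norm_le_iff:
  assumes \<Phi>: "admissible_cutoff \<Phi>" and A: "A \<ge> 0"
  shows "LG_norm \<Phi> \<gamma> f \<le> ennreal A \<longleftrightarrow> shell_bounded \<gamma> A (LP_coeff \<Phi> f)"
proof -
  have "ennreal ((1 + real k) powr \<gamma>) * Linf_norm (LP_piece \<Phi> k f) \<le> ennreal A \<longleftrightarrow>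
      (\<forall>x. norm (tsum (dyadic_shell k) (LP_coeff \<Phi> f k) x) \<le> A * (1 + real k) powr - \<gamma>)" for k
  proof -
    have "ennreal ((1 + real k) powr \<gamma>) * Linf_norm (LP_piece \<Phi> k f) \<le> ennreal A \<longleftrightarrow>
        Linf_norm (LP_piece \<Phi> k f) \<le> ennreal (A * (1 + real k) powr - \<gamma>)"
    proof (cases "Linf_norm (LP_piece \<Phi> k f)")
      case (real l)
      have "(1 + real k) powr \<gamma> * l \<le> A \<longleftrightarrow> l \<le> A * (1 + real k) powr - \<gamma>"
        by (simp add: powr_minus field_simps)
      then show ?thesis using real A by (simp flip: ennreal_mult)
    next
      case top
      then show ?thesis by (simp add: ennreal_mult_top top_unique)
    qed
    then show ?thesis unfolding LP_piece_eq_tsum[OF \<Phi>]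
      using A by (subst (asm) Linf_norm_le_iff[OF continuous_tsum periodic1_tsum]) auto
  qed
  then show ?thesis unfolding LG_norm_def SUP_le_iff shell_bounded_def by auto
qed

lemma fourier_coeff_diff:
  assumes "integrable torus f" "integrable torus g"
  shows "fourier_coeff (\<lambda>x. f x - g x) n = fourier_coeff f n - fourier_coeff g n"
  using integrable_times_echar[OF assms(1)] integrable_times_echar[OF assms(2)]
  by (simp add: fourier_coeff_echar left_diff_distrib)

lemma fourier_coeff_shell_sum:
  assumes "finite F"
  shows "fourier_coeff (shell_sum c F) n = (\<Sum>k\<in>F. if n \<in> dyadic_shell k then c k n else 0)"
proof -
  have "fourier_coeff (shell_sum c F) n = (\<Sum>k\<in>F. fourier_coeff (tsum (dyadic_shell k) (c k)) n)"
    unfolding fourier_coeff_echar sum_distrib_right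
    by (intro Bochner_Integration.integral_sum integrable_times_echar integrable_torus_continuous continuous_tsum)
  then show ?thesis by (simp add: fourier_coeff_tsum)
qed

text \<open>The cutoffs telescope to \<open>\<Phi> (n / 2^K)\<close>, which is 1 for \<open>|n| \<le> 2^K\<close>.\<close>

lemma fourier_coeff_shell_sum_LP:
  assumes \<Phi>: "admissible_cutoff \<Phi>" and n: "\<bar>n\<bar> \<le> 2 ^ K"
  shows "fourier_coeff (shell_sum (LP_coeff \<Phi> f) {..K}) n = fourier_coeff f n"
proof -
  have "fourier_coeff (shell_sum (LP_coeff \<Phi> f) {..K}) n = (\<Sum>k\<le>K. LP_coeff \<Phi> f k n)"
    by (subst fourier_coeff_shell_sum) (auto intro!: sum.cong simp: LP_coeff_def dyadic_cutoff_eq_0[OF \<Phi>])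
  also have "\<dots> = of_real (\<Sum>k\<le>K. dyadic_cutoff \<Phi> k (of_int n)) * fourier_coeff f n"
    by (simp add: LP_coeff_def sum_distrib_right)
  also have "(\<Sum>k\<le>K. dyadic_cutoff \<Phi> k (of_int n)) = 1"
  proof -
    have "real_of_int \<bar>n\<bar> \<le> of_int (2 ^ K)" using n by (simp only: of_int_le_iff)
    then have "\<bar>real_of_int n / 2 ^ K\<bar> \<le> 1" by simp
    then show ?thesis unfolding sum_dyadic_cutoff by (rule cutoff_eq_1[OF \<Phi>])
  qed
  finally show ?thesis by simp
qed

text \<open>The function synthesised from the pieces of \<open>f\<close> has the Fourier coefficients of \<open>f\<close>, so it is
  \<open>f\<close>.\<close>

lemma LG_tail_expL:
  assumes \<Phi>: "admissible_cutoff \<Phi>" and adm: "admissible_exponents \<nu> \<gamma>"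
  shows "\<exists>C>0. \<forall>A f. A > 0 \<longrightarrow> f \<in> LG \<Phi> \<gamma> \<longrightarrow> LG_norm \<Phi> \<gamma> f \<le> ennreal A \<longrightarrow>
    (\<forall>K. expL_norm \<nu> (\<lambda>x. f x - shell_sum (LP_coeff \<Phi> f) {..K} x)
       \<le> ennreal (C * A * (1 + real K) powr - decay_exponent \<nu> \<gamma>))"
proof -
  define \<beta> where "\<beta> = decay_exponent \<nu> \<gamma>"
  have \<beta>: "\<beta> > 0" using admissible_exponentsD[OF adm] by (simp add: \<beta>_def)
  obtain C where C: "C > 0" and syn: "\<And>A c. A > 0 \<Longrightarrow> shell_bounded \<gamma> A c \<Longrightarrow>
    \<exists>g. periodic1 g \<and> g \<in> borel_measurable torus \<and>
      (\<forall>K. expL_norm \<nu> (\<lambda>x. g x - shell_sum c {..K} x) \<le> ennreal (C * A * (1 + real K) powr - \<beta>))"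
    using shell_synthesis[OF adm] unfolding \<beta>_def by blast
  have "expL_norm \<nu> (\<lambda>x. f x - shell_sum (LP_coeff \<Phi> f) {..K} x) \<le> ennreal (C * A * (1 + real K) powr - \<beta>)"
    if A: "A > 0" and f: "f \<in> LG \<Phi> \<gamma>" and fA: "LG_norm \<Phi> \<gamma> f \<le> ennreal A" for A f K
  proof -
    define s where "s K = shell_sum (LP_coeff \<Phi> f) {..K}" for K
    have sb: "shell_bounded \<gamma> A (LP_coeff \<Phi> f)" using fA LG_norm_le_iff[OF \<Phi>] A by simp
    obtain g where g: "g \<in> borel_measurable torus"
      "\<And>K. expL_norm \<nu> (\<lambda>x. g x - s K x) \<le> ennreal (C * A * (1 + real K) powr - \<beta>)"
      using syn[OF A sb] unfolding s_def by blast
    have fi: "integrable torus f" using f by (simp add: LG_def)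
    have si: "integrable torus (s K)" for K
      unfolding s_def by (intro integrable_torus_continuous continuous_shell_sum)
    have L1: "(\<integral>\<^sup>+ x. ennreal (norm (g x - s K x)) \<partial>torus) \<le> ennreal (C * A * (1 + real K) powr - \<beta>)" for K
      using g(2) A C by (intro expL_norm_imp_L1) auto
    have di: "integrable torus (\<lambda>x. g x - s K x)" for K
    proof (rule integrableI_bounded)
      show "(\<lambda>x. g x - s K x) \<in> borel_measurable torus"
        by (intro borel_measurable_diff g borel_measurable_integrable si)
      show "(\<integral>\<^sup>+ x. ennreal (norm (g x - s K x)) \<partial>torus) < \<infinity>"
        using L1[of K] by (rule le_less_trans) simp
    qed
    have gi: "integrable torus g"
      using Bochner_Integration.integrable_add[OF di[of 0] si[of 0]] by simp
    have "fourier_coeff (\<lambda>x. f x - g x) n = 0" for n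
    proof -
      have le: "norm (fourier_coeff (\<lambda>x. f x - g x) n) \<le> C * A * (1 + real K) powr - \<beta>" if "\<bar>n\<bar> \<le> 2 ^ K" for K
      proof -
        have "fourier_coeff (\<lambda>x. f x - g x) n = fourier_coeff (s K) n - fourier_coeff g n"
          using fourier_coeff_shell_sum_LP[OF \<Phi> that, of f] fourier_coeff_diff[OF fi gi]
          by (simp add: s_def)
        also have "\<dots> = - fourier_coeff (\<lambda>x. g x - s K x) n"
          by (simp add: fourier_coeff_diff gi si)
        also have "norm \<dots> \<le> (\<integral>x. norm (g x - s K x) \<partial>torus)"
          using norm_fourier_coeff_le[OF di] by simp
        also have "\<dots> \<le> C * A * (1 + real K) powr - \<beta>"
          using L1[of K] nn_integral_eq_integral[OF integrable_norm[OF di[of K]]] A C by simp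
        finally show ?thesis .
      qed
      have "(\<lambda>K. (1 + real K) powr - \<beta>) \<longlonglongrightarrow> 0"
        using \<beta> by (intro tendsto_neg_powr filterlim_tendsto_add_at_top[OF tendsto_const] filterlim_real_sequentially) auto
      then have lim: "(\<lambda>K. C * A * (1 + real K) powr - \<beta>) \<longlonglongrightarrow> C * A * 0"
        by (intro tendsto_mult tendsto_const)
      have "\<bar>n\<bar> \<le> 2 ^ K" if "nat \<bar>n\<bar> \<le> K" for K
      proof -
        have "nat \<bar>n\<bar> < 2 ^ K" using that less_exp[of K] by (rule le_less_trans)
        then have "int (nat \<bar>n\<bar>) < int (2 ^ K)" by (simp only: of_nat_less_iff)
        then show ?thesis by simp
      qed
      then have "norm (fourier_coeff (\<lambda>x. f x - g x) n) \<le> C * A * 0"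
        by (intro LIMSEQ_le_const[OF lim]) (blast intro: le)
      then show ?thesis by simp
    qed
    then have "AE x in torus. f x - g x = 0"
      by (rule fourier_uniqueness[OF Bochner_Integration.integrable_diff[OF fi gi]])
    then have "AE x in torus. f x - s K x = g x - s K x" by eventually_elim simp
    then show ?thesis using g(2)[of K] expL_norm_cong_AE[of "\<lambda>x. f x - s K x" "\<lambda>x. g x - s K x" \<nu>]
      by (simp add: s_def)
  qed
  then show ?thesis using C unfolding \<beta>_def by blast
qed

lemma norm_shell_sum_le:
  assumes "shell_bounded \<gamma> A c" "A \<ge> 0" "\<gamma> \<ge> 0" "finite F"
  shows "norm (shell_sum c F x) \<le> A * card F"
proof -
  have "norm (shell_sum c F x) \<le> (\<Sum>k\<in>F. A)"
  proof (rule order_trans[OF norm_sum sum_mono])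
    fix k
    have "(1 + real k) powr - \<gamma> \<le> 1 powr - \<gamma>" using assms by (intro powr_mono2') auto
    then have "A * (1 + real k) powr - \<gamma> \<le> A * 1" using assms by (intro mult_left_mono) auto
    then show "norm (tsum (dyadic_shell k) (c k) x) \<le> A"
      using assms(1) unfolding shell_bounded_def by (metis mult.right_neutral order_trans)
  qed
  then show ?thesis by (simp add: mult.commute)
qed

lemma LG_norm_imp_expL_norm:
  assumes \<Phi>: "admissible_cutoff \<Phi>" and adm: "admissible_exponents \<nu> \<gamma>"
  shows "\<exists>C>0. \<forall>A f. A > 0 \<longrightarrow> f \<in> LG \<Phi> \<gamma> \<longrightarrow> LG_norm \<Phi> \<gamma> f \<le> ennreal A \<longrightarrow> expL_norm \<nu> f \<le> ennreal (C * A)"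
proof -
  obtain C where C: "C > 0" and tail: "\<And>A f K. A > 0 \<Longrightarrow> f \<in> LG \<Phi> \<gamma> \<Longrightarrow> LG_norm \<Phi> \<gamma> f \<le> ennreal A \<Longrightarrow>
    expL_norm \<nu> (\<lambda>x. f x - shell_sum (LP_coeff \<Phi> f) {..K} x)
       \<le> ennreal (C * A * (1 + real K) powr - decay_exponent \<nu> \<gamma>)"
    using LG_tail_expL[OF \<Phi> adm] by blast
  note pos = admissible_exponentsD[OF adm]
  have "expL_norm \<nu> f \<le> ennreal (4 * (C + 1) * A)"
    if A: "A > 0" and f: "f \<in> LG \<Phi> \<gamma>" "LG_norm \<Phi> \<gamma> f \<le> ennreal A" for A f
  proof -
    let ?s = "shell_sum (LP_coeff \<Phi> f) {..0}"
    have sb: "shell_bounded \<gamma> A (LP_coeff \<Phi> f)" using f LG_norm_le_iff[OF \<Phi>] A by simp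
    have "expL_norm \<nu> (\<lambda>x. f x - ?s x) \<le> ennreal (C * A)" using tail[OF A f, of 0] by simp
    also have "\<dots> \<le> ennreal ((C + 1) * A)" using A by (intro ennreal_leI) (simp add: distrib_right)
    finally have 1: "expL_norm \<nu> (\<lambda>x. f x - ?s x) \<le> ennreal ((C + 1) * A)" .
    have 2: "expL_norm \<nu> ?s \<le> ennreal ((C + 1) * A)"
    proof (rule expL_norm_bounded)
      fix x
      have "norm (?s x) \<le> A * card {..0::nat}" using A pos by (intro norm_shell_sum_le[OF sb]) auto
      also have "\<dots> \<le> (C + 1) * A" using A C by (simp add: distrib_right)
      finally show "norm (?s x) \<le> (C + 1) * A" .
    qed (use pos A C in auto)
    have "expL_norm \<nu> f \<le> ennreal (4 * ((C + 1) * A))"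
    proof (rule expL_norm_quasi_triangle[OF _ _ _ 1 2])
      have "f \<in> borel_measurable torus" using f by (auto simp: LG_def)
      then show "(\<lambda>x. f x - ?s x) \<in> borel_measurable torus"
        by (intro borel_measurable_diff measurable_shell_sum)
      show "AE x in torus. norm (f x) \<le> norm (f x - ?s x) + norm (?s x)"
        using norm_triangle_ineq[of "f x - ?s x" "?s x" for x] by (intro AE_I2) (simp add: norm_triangle_sub add.commute)
      show "?s \<in> borel_measurable torus" by (rule measurable_shell_sum)
    qed (use A C in auto)
    then show ?thesis by (simp only: mult.assoc)
  qed
  then show ?thesis using C by (intro exI[of _ "4 * (C + 1)"]) auto
qed

lemma LG_subset_expL:
  assumes \<Phi>: "admissible_cutoff \<Phi>" and adm: "admissible_exponents \<nu> \<gamma>"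
  shows "LG \<Phi> \<gamma> \<subseteq> expL \<nu>"
proof
  fix f assume f: "f \<in> LG \<Phi> \<gamma>"
  then have "LG_norm \<Phi> \<gamma> f < \<infinity>" by (simp add: LG_def)
  then obtain A where A: "LG_norm \<Phi> \<gamma> f = ennreal A" "A \<ge> 0" by (cases "LG_norm \<Phi> \<gamma> f") auto
  then have "LG_norm \<Phi> \<gamma> f \<le> ennreal (A + 1)" by (simp add: ennreal_leI)
  then obtain C where "expL_norm \<nu> f \<le> ennreal (C * (A + 1))"
    using LG_norm_imp_expL_norm[OF \<Phi> adm] f A(2) by (metis add_nonneg_pos zero_less_one)
  then have "expL_norm \<nu> f < \<infinity>" by (rule le_less_trans) simp
  then show "f \<in> expL \<nu>" using f by (auto simp: expL_def LG_def)
qed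

section \<open>Upper bound for the entropy numbers\<close>

lemma entropy_number_le:
  assumes Z: "finite Z" "Z \<noteq> {}" "Z \<subseteq> X" "card Z \<le> 2 ^ (n - 1)" and e: "e > 0"
    and cover: "\<And>y. y \<in> unit_ball Y NY \<Longrightarrow> y \<in> X \<and> (\<exists>z\<in>Z. NX (y - z) \<le> ennreal e)"
  shows "entropy_number n Y NY X NX \<le> ennreal e"
proof -
  obtain h where h: "bij_betw h {0..<card Z} Z" using ex_bij_betw_nat_finite[OF Z(1)] by blast
  obtain z0 where z0: "z0 \<in> Z" using Z(2) by blast
  define c where "c i = (if i < card Z then h i else z0)" for i
  have cZ: "c i \<in> Z" for i using h z0 by (auto simp: c_def bij_betw_def)
  have "unit_ball Y NY \<subseteq> (\<Union>i<2 ^ (n - 1). norm_ball X NX (c i) e)"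
  proof
    fix y assume "y \<in> unit_ball Y NY"
    then obtain z where z: "y \<in> X" "z \<in> Z" "NX (y - z) \<le> ennreal e" using cover by blast
    then have "z \<in> h ` {0..<card Z}" using h by (simp add: bij_betw_def)
    then obtain i where i: "i < card Z" "z = h i" by auto
    then have "y \<in> norm_ball X NX (c i) e" using z by (simp add: norm_ball_def c_def)
    moreover have "i < 2 ^ (n - 1)" using i Z(4) by simp
    ultimately show "y \<in> (\<Union>i<2 ^ (n - 1). norm_ball X NX (c i) e)" by blast
  qed
  then have "ennreal e \<in> {ennreal \<epsilon> | \<epsilon>. \<epsilon> > 0 \<and>
        (\<exists>c :: nat \<Rightarrow> 'a. (\<forall>i < 2 ^ (n - 1). c i \<in> X) \<and>
           unit_ball Y NY \<subseteq> (\<Union>i < 2 ^ (n - 1). norm_ball X NX (c i) \<epsilon>))}"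
    using e cZ Z(3) by blast
  then show ?thesis unfolding entropy_number_def by (rule Inf_lower)
qed

lemma tsum_in_expL: "\<nu> > 0 \<Longrightarrow> finite A \<Longrightarrow> tsum A c \<in> expL \<nu>"
proof -
  assume \<nu>: "\<nu> > 0"
  have "expL_norm \<nu> (tsum A c) \<le> ennreal (\<Sum>n\<in>A. norm (c n))"
    by (intro expL_norm_bounded \<nu> sum_nonneg norm_tsum_le) auto
  then have "expL_norm \<nu> (tsum A c) < \<infinity>" by (rule le_less_trans) simp
  then show ?thesis by (simp add: expL_def periodic1_tsum borel_measurable_torus_continuous continuous_tsum)
qed

text \<open>The real and imaginary parts of the coefficients are rounded to multiples of a mesh width
  \<open>\<delta>\<close>. With \<open>\<delta>\<close> of order \<open>4^-K\<close> the error is at most \<open>2^-K\<close> uniformly, because there are about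
  \<open>2^(K+2)\<close> coefficients.\<close>

lemma grid_net:
  fixes K :: nat
  defines "A \<equiv> {- (2 ^ (K + 1))..(2 ^ (K + 1) :: int)}"
  shows "\<exists>Z. finite Z \<and> Z \<noteq> {} \<and> card Z \<le> 2 ^ 2 ^ (2 * K + 7) \<and> (\<forall>z\<in>Z. \<exists>c. z = tsum A c) \<and>
    (\<forall>d. (\<forall>n\<in>A. norm (d n) \<le> real (K + 1)) \<longrightarrow> (\<exists>z\<in>Z. \<forall>x. norm (tsum A d x - z x) \<le> 1 / 2 ^ K))"
proof -
  define \<delta> :: real where "\<delta> = 1 / 2 ^ (2 * K + 4)"
  \<comment> \<open>the rounded parts are at most \<open>(K + 1) / \<delta> + 1 \<le> R\<close>\<close>
  define R :: int where "R = 2 ^ (3 * K + 5)"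
  define T where "T = {-R..R} \<times> {-R..R}"
  define G where "G q n = complex_of_real \<delta> * Complex (of_int (fst (q n))) (of_int (snd (q n)))"
    for q :: "int \<Rightarrow> int \<times> int" and n
  define Z where "Z = (\<lambda>q. tsum A (G q)) ` (A \<rightarrow>\<^sub>E T)"
  have \<delta>: "\<delta> > 0" by (simp add: \<delta>_def)
  have fin: "finite (A \<rightarrow>\<^sub>E T)" by (intro finite_PiE) (auto simp: A_def T_def)
  have K: "K + 1 \<le> 2 ^ K" by (induction K) auto
  have K': "3 * K + 7 \<le> 2 ^ (K + 3)"
  proof (induction K)
    case (Suc K)
    have "3 * Suc K + 7 = (3 * K + 7) + 3" by simp
    also have "\<dots> \<le> 2 ^ (K + 3) + 2 ^ (K + 3)"
    proof (rule add_mono[OF Suc])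
      have "(2::nat) ^ 2 \<le> 2 ^ (K + 3)" by (intro power_increasing) auto
      then show "(3::nat) \<le> 2 ^ (K + 3)" by (simp only: power2_eq_square)
    qed
    also have "\<dots> = 2 ^ (Suc K + 3)" by (simp add: power_add)
    finally show ?case .
  qed simp
  have cardA: "card A \<le> 2 ^ (K + 3)"
  proof -
    define b :: int where "b = 2 ^ (K + 1)"
    have b0: "b \<ge> 0" unfolding b_def by simp
    have A_eq: "A = {- b..b}" unfolding A_def b_def ..
    have "int (card A) = 2 * b + 1" unfolding A_eq card_atLeastAtMost_int using b0 by simp
    also have "\<dots> = 4 * 2 ^ K + 1" unfolding b_def by simp
    also have "\<dots> \<le> 8 * 2 ^ K" using one_le_power[of "2::int" K] by linarith
    also have "\<dots> = int (2 ^ (K + 3))" by (simp add: power_add)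
    finally show ?thesis by (simp only: of_nat_le_iff)
  qed
  have "card Z \<le> card (A \<rightarrow>\<^sub>E T)" unfolding Z_def by (rule card_image_le[OF fin])
  also have "\<dots> = card T ^ card A" by (rule card_funcsetE) (simp add: A_def)
  also have "card T = nat (2 * R + 1) ^ 2"
    by (simp add: T_def card_cartesian_product power2_eq_square)
  also have "(nat (2 * R + 1) ^ 2) ^ card A \<le> ((2 ^ (3 * K + 7)) ^ 2) ^ card A"
  proof (intro power_mono)
    have "2 * R + 1 \<le> 4 * 2 ^ (3 * K + 5)"
      using one_le_power[of "2::int" "3 * K + 5"] unfolding R_def by linarith
    also have "\<dots> = int (2 ^ (3 * K + 7))" by (simp add: power_add)
    finally show "nat (2 * R + 1) \<le> 2 ^ (3 * K + 7)" by (simp only: nat_le_iff)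
  qed auto
  also have "\<dots> \<le> ((2 ^ (3 * K + 7)) ^ 2) ^ (2 ^ (K + 3))"
    using cardA by (intro power_increasing) auto
  also have "\<dots> = (2::nat) ^ ((3 * K + 7) * 2 * 2 ^ (K + 3))"
    by (simp only: power_mult)
  also have "\<dots> \<le> 2 ^ (2 ^ (K + 3) * 2 * 2 ^ (K + 3))"
    using K' by (intro power_increasing mult_right_mono) auto
  also have "2 ^ (K + 3) * 2 * 2 ^ (K + 3) = (2::nat) ^ (2 * K + 7)"
  proof -
    have "(2::nat) ^ (K + 3) * 2 * 2 ^ (K + 3) = 2 ^ ((K + 3) + 1 + (K + 3))"
      by (simp only: power_add power_one_right)
    also have "(K + 3) + 1 + (K + 3) = 2 * K + 7" by linarith
    finally show ?thesis .
  qed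
  finally have card: "card Z \<le> 2 ^ 2 ^ (2 * K + 7)" .
  have net: "\<exists>z\<in>Z. \<forall>x. norm (tsum A d x - z x) \<le> 1 / 2 ^ K" if d: "\<And>n. n \<in> A \<Longrightarrow> norm (d n) \<le> real (K + 1)" for d
  proof -
    define q where "q = (\<lambda>n\<in>A. (\<lfloor>Re (d n) / \<delta>\<rfloor>, \<lfloor>Im (d n) / \<delta>\<rfloor>))"
    have in_range: "\<lfloor>t / \<delta>\<rfloor> \<in> {-R..R}" if "\<bar>t\<bar> \<le> real (K + 1)" for t
    proof -
      have "real (K + 1) \<le> 2 ^ K" using K by (metis of_nat_le_iff of_nat_numeral of_nat_power)
      then have "\<bar>t\<bar> * 2 ^ (2 * K + 4) \<le> 2 ^ K * 2 ^ (2 * K + 4)" using that by (intro mult_right_mono) auto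
      also have "\<dots> = (2::real) ^ (3 * K + 4)" by (simp flip: power_add)
      finally have "\<bar>t / \<delta>\<bar> \<le> 2 ^ (3 * K + 4)" by (simp add: \<delta>_def abs_mult)
      moreover have "real_of_int R = 2 * 2 ^ (3 * K + 4)" by (simp add: R_def power_add)
      moreover have "(1::real) \<le> 2 ^ (3 * K + 4)" by simp
      ultimately have "- real_of_int R \<le> t / \<delta>" "t / \<delta> < real_of_int R + 1" by (simp_all only: abs_le_iff) linarith+
      then show ?thesis by (simp add: le_floor_iff floor_le_iff)
    qed
    have "\<lfloor>Re (d n) / \<delta>\<rfloor> \<in> {-R..R}" "\<lfloor>Im (d n) / \<delta>\<rfloor> \<in> {-R..R}" if "n \<in> A" for n
      by (intro in_range order_trans[OF abs_Re_le_cmod d] order_trans[OF abs_Im_le_cmod d] that)+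
    then have "q \<in> A \<rightarrow>\<^sub>E T" by (auto simp: q_def T_def)
    then have z: "tsum A (G q) \<in> Z" by (auto simp: Z_def)
    have near: "norm (d n - G q n) \<le> 2 * \<delta>" if "n \<in> A" for n
    proof -
      have fl: "\<bar>t - \<delta> * of_int \<lfloor>t / \<delta>\<rfloor>\<bar> \<le> \<delta>" for t
      proof -
        have "t = \<delta> * (t / \<delta>)" using \<delta> by simp
        then have "t - \<delta> * of_int \<lfloor>t / \<delta>\<rfloor> = \<delta> * (t / \<delta> - of_int \<lfloor>t / \<delta>\<rfloor>)"
          by (metis right_diff_distrib)
        moreover have "\<bar>t / \<delta> - of_int \<lfloor>t / \<delta>\<rfloor>\<bar> \<le> 1" by linarith
        ultimately show ?thesis using \<delta> by (simp add: abs_mult mult_left_le)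
      qed
      have "norm (d n - G q n) \<le> \<bar>Re (d n - G q n)\<bar> + \<bar>Im (d n - G q n)\<bar>" by (rule cmod_le)
      also have "\<dots> \<le> \<delta> + \<delta>"
        using that fl[of "Re (d n)"] fl[of "Im (d n)"] by (intro add_mono) (simp_all add: G_def q_def)
      finally show ?thesis by simp
    qed
    have "norm (tsum A d x - tsum A (G q) x) \<le> 1 / 2 ^ K" for x
    proof -
      have "norm (tsum A d x - tsum A (G q) x) \<le> (\<Sum>n\<in>A. norm (d n - G q n))"
        unfolding tsum_diff[symmetric] by (rule norm_tsum_le)
      also have "\<dots> \<le> (\<Sum>n\<in>A. 2 * \<delta>)" by (intro sum_mono near)
      also have "\<dots> = real (card A) * (2 * \<delta>)" by simp
      also have "\<dots> \<le> 2 ^ (K + 3) * (2 * \<delta>)"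
      proof -
        have "real (card A) \<le> real (2 ^ (K + 3))" using cardA by (simp only: of_nat_le_iff)
        then show ?thesis using \<delta> by (intro mult_right_mono) auto
      qed
      also have "\<dots> = 1 / 2 ^ K" proof -
        have "(2::real) ^ ((K + 3) + 1 + K) = 2 ^ (2 * K + 4)"
          by (rule arg_cong[where f = "power 2"]) linarith
        then have "(2::real) ^ (K + 3) * 2 * 2 ^ K = 2 ^ (2 * K + 4)"
          by (simp only: power_add power_one_right)
        then have "\<delta> = 1 / (2 ^ (K + 3) * 2 * 2 ^ K)" by (simp only: \<delta>_def)
        then show ?thesis by (simp only:) (simp add: field_simps)
      qed
      finally show ?thesis .
    qed
    then show ?thesis using z by blast
  qed
  have ne: "Z \<noteq> {}"
  proof -
    have "(\<lambda>n\<in>A. (0, 0)) \<in> A \<rightarrow>\<^sub>E T" by (auto simp: T_def R_def)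
    then show ?thesis unfolding Z_def by blast
  qed
  have form: "\<forall>z\<in>Z. \<exists>c. z = tsum A c" by (auto simp: Z_def)
  have finZ: "finite Z" unfolding Z_def using fin by simp
  show ?thesis
    by (intro exI[of _ Z] conjI finZ ne card form allI impI net) (erule (1) bspec)
qed

lemma shell_sum_eq_tsum:
  "shell_sum c {..K} = tsum {- (2 ^ (K + 1))..2 ^ (K + 1)} (\<lambda>n. \<Sum>k\<le>K. if n \<in> dyadic_shell k then c k n else 0)"
proof
  fix x
  let ?A = "{- (2 ^ (K + 1))..(2 ^ (K + 1) :: int)}"
  have "tsum (dyadic_shell k) (c k) x = (\<Sum>n\<in>?A. (if n \<in> dyadic_shell k then c k n else 0) * echar n x)" if "k \<le> K" for k
  proof -
    have "(2::int) ^ (k + 1) \<le> 2 ^ (K + 1)" using that by (intro power_increasing) auto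
    then have "{- int (2 ^ (k + 1))..int (2 ^ (k + 1))} \<subseteq> ?A" by auto
    then have "dyadic_shell k \<subseteq> ?A" using dyadic_shell_subset[of k] by (rule order_trans[rotated])
    then show ?thesis unfolding tsum_def by (intro sum.mono_neutral_cong_left) auto
  qed
  then have "shell_sum c {..K} x = (\<Sum>k\<le>K. \<Sum>n\<in>?A. (if n \<in> dyadic_shell k then c k n else 0) * echar n x)"
    by (intro sum.cong) auto
  also have "\<dots> = tsum ?A (\<lambda>n. \<Sum>k\<le>K. if n \<in> dyadic_shell k then c k n else 0) x"
    unfolding tsum_def sum_distrib_right by (rule sum.swap)
  finally show "shell_sum c {..K} x = tsum ?A (\<lambda>n. \<Sum>k\<le>K. if n \<in> dyadic_shell k then c k n else 0) x" .
qed

text \<open>\<open>t powr \<beta>\<close> is at most a constant times \<open>2 powr t\<close>, from \<open>a * t \<le> exp (a * t)\<close> with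
  \<open>a = ln 2 / \<beta>\<close>.\<close>

lemma powr_le_power_2:
  assumes "\<beta> > 0"
  shows "\<exists>C>0. \<forall>K. 1 / 2 ^ K \<le> C * (1 + real K) powr - \<beta>"
proof -
  define a where "a = ln 2 / \<beta>"
  have a: "a > 0" using assms by (simp add: a_def)
  have "1 / 2 ^ K \<le> 2 * (1 / a) powr \<beta> * (1 + real K) powr - \<beta>" for K
  proof -
    define t where "t = 1 + real K"
    have t: "t > 0" by (simp add: t_def)
    have "a * t \<le> exp (a * t)" using exp_ge_add_one_self[of "a * t"] by linarith
    then have "(a * t) powr \<beta> \<le> exp (a * t) powr \<beta>" using a t assms by (intro powr_mono2) auto
    also have "\<dots> = exp (t * ln 2)" using assms by (simp add: exp_powr_real a_def)
    also have "\<dots> = 2 powr t" by (simp add: powr_def)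
    also have "\<dots> = 2 * 2 ^ K" by (simp add: t_def powr_add powr_realpow)
    finally have "a powr \<beta> * t powr \<beta> \<le> 2 * 2 ^ K" using a t by (simp add: powr_mult)
    then show ?thesis using a t by (simp add: t_def[symmetric] powr_minus powr_divide field_simps)
  qed
  then show ?thesis using a by (intro exI[of _ "2 * (1 / a) powr \<beta>"]) auto
qed

text \<open>The centres are the grid points for the first \<open>K\<close> pieces; for \<open>K = 0\<close> the single centre 0 will do.\<close>

lemma entropy_upper_dyadic:
  assumes \<Phi>: "admissible_cutoff \<Phi>" and adm: "admissible_exponents \<nu> \<gamma>"
  shows "\<exists>C>0. \<forall>K n. (K = 0 \<or> 2 ^ (2 * K + 7) \<le> n - 1) \<longrightarrow>
    entropy_number n (LG \<Phi> \<gamma>) (LG_norm \<Phi> \<gamma>) (expL \<nu>) (expL_norm \<nu>)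
      \<le> ennreal (C * (1 + real K) powr - decay_exponent \<nu> \<gamma>)"
proof -
  define \<beta> where "\<beta> = decay_exponent \<nu> \<gamma>"
  note pos = admissible_exponentsD[OF adm]
  have \<beta>: "\<beta> > 0" using pos by (simp add: \<beta>_def)
  obtain C1 where C1: "C1 > 0" and tail: "\<And>A f K. A > 0 \<Longrightarrow> f \<in> LG \<Phi> \<gamma> \<Longrightarrow> LG_norm \<Phi> \<gamma> f \<le> ennreal A \<Longrightarrow>
    expL_norm \<nu> (\<lambda>x. f x - shell_sum (LP_coeff \<Phi> f) {..K} x) \<le> ennreal (C1 * A * (1 + real K) powr - \<beta>)"
    using LG_tail_expL[OF \<Phi> adm] unfolding \<beta>_def by blast
  obtain C2 where C2: "C2 > 0" and whole: "\<And>A f. A > 0 \<Longrightarrow> f \<in> LG \<Phi> \<gamma> \<Longrightarrow> LG_norm \<Phi> \<gamma> f \<le> ennreal A \<Longrightarrow>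
    expL_norm \<nu> f \<le> ennreal (C2 * A)"
    using LG_norm_imp_expL_norm[OF \<Phi> adm] by blast
  obtain C3 where C3: "C3 > 0" and small: "\<And>K. 1 / 2 ^ K \<le> C3 * (1 + real K) powr - \<beta>"
    using powr_le_power_2[OF \<beta>] by blast
  define C where "C = C2 + 4 * (C1 + C3)"
  have C: "C > 0" using C1 C2 C3 by (simp add: C_def)
  have "entropy_number n (LG \<Phi> \<gamma>) (LG_norm \<Phi> \<gamma>) (expL \<nu>) (expL_norm \<nu>) \<le> ennreal (C * (1 + real K) powr - \<beta>)"
    if Kn: "K = 0 \<or> 2 ^ (2 * K + 7) \<le> n - 1" for K n
  proof (cases "K = 0")
    case True
    have "entropy_number n (LG \<Phi> \<gamma>) (LG_norm \<Phi> \<gamma>) (expL \<nu>) (expL_norm \<nu>) \<le> ennreal C"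
    proof (rule entropy_number_le[where Z = "{tsum {} (\<lambda>_. 0)}"])
      show "{tsum {} (\<lambda>_. 0)} \<subseteq> expL \<nu>" using tsum_in_expL[OF pos(1)] by simp
      fix f assume f: "f \<in> unit_ball (LG \<Phi> \<gamma>) (LG_norm \<Phi> \<gamma>)"
      then have "expL_norm \<nu> f \<le> ennreal C2" using whole[of 1 f] by (simp add: unit_ball_def)
      also have "\<dots> \<le> ennreal C" using C1 C3 by (intro ennreal_leI) (simp add: C_def)
      finally have "expL_norm \<nu> f \<le> ennreal C" .
      moreover have "f - tsum {} (\<lambda>_. 0) = f" by (simp add: fun_eq_iff tsum_def)
      ultimately show "f \<in> expL \<nu> \<and> (\<exists>z\<in>{tsum {} (\<lambda>_. 0)}. expL_norm \<nu> (f - z) \<le> ennreal C)"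
        using f LG_subset_expL[OF \<Phi> adm] by (auto simp: unit_ball_def)
    qed (use C in auto)
    then show ?thesis using True by simp
  next
    case False
    then have n: "2 ^ (2 * K + 7) \<le> n - 1" using Kn by blast
    let ?A = "{- (2 ^ (K + 1))..(2 ^ (K + 1) :: int)}"
    from grid_net[of K] obtain Z where Z: "finite Z" "Z \<noteq> {}" "card Z \<le> 2 ^ 2 ^ (2 * K + 7)"
      "\<forall>z\<in>Z. \<exists>c. z = tsum ?A c"
      and net: "\<forall>d. (\<forall>n\<in>?A. norm (d n) \<le> real (K + 1)) \<longrightarrow> (\<exists>z\<in>Z. \<forall>x. norm (tsum ?A d x - z x) \<le> 1 / 2 ^ K)"
      by (elim exE conjE)
    show ?thesis
    proof (rule entropy_number_le[where Z = Z])
      show "Z \<subseteq> expL \<nu>" using Z(4) tsum_in_expL[OF pos(1), of ?A] by auto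
      have "(2::nat) ^ 2 ^ (2 * K + 7) \<le> 2 ^ (n - 1)" by (rule power_increasing[OF n]) simp
      then show "card Z \<le> 2 ^ (n - 1)" using Z(3) by (rule order_trans[rotated])
      fix f assume "f \<in> unit_ball (LG \<Phi> \<gamma>) (LG_norm \<Phi> \<gamma>)"
      then have f: "f \<in> LG \<Phi> \<gamma>" "LG_norm \<Phi> \<gamma> f \<le> ennreal 1" by (simp_all add: unit_ball_def)
      have sb: "shell_bounded \<gamma> 1 (LP_coeff \<Phi> f)" using f LG_norm_le_iff[OF \<Phi>, of 1] by simp
      let ?s = "shell_sum (LP_coeff \<Phi> f) {..K}"
      define d where "d n = (\<Sum>k\<le>K. if n \<in> dyadic_shell k then LP_coeff \<Phi> f k n else 0)" for n
      have s: "?s x = tsum ?A d x" for x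
        unfolding d_def by (rule fun_cong[OF shell_sum_eq_tsum])
      have "norm (?s x) \<le> 1 * real (card {..K})" for x
        using pos by (intro norm_shell_sum_le[OF sb]) auto
      then have "norm (tsum ?A d x) \<le> real (K + 1)" for x
        by (simp only: s card_atMost mult_1 Suc_eq_plus1)
      then have "\<forall>n\<in>?A. norm (d n) \<le> real (K + 1)"
        using norm_tsum_coeff_le[OF finite_atLeastAtMost_int] by blast
      then obtain z where z: "z \<in> Z" "\<And>x. norm (?s x - z x) \<le> 1 / 2 ^ K"
        using net unfolding s by blast
      obtain c where c: "z = tsum ?A c" using Z(4) z(1) by blast
      define M where "M = (C1 + C3) * (1 + real K) powr - \<beta>"
      have M: "M \<ge> 0" using C1 C3 by (simp add: M_def)
      have 1: "expL_norm \<nu> (\<lambda>x. f x - ?s x) \<le> ennreal M"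
      proof (rule order_trans[OF tail[OF zero_less_one f] ennreal_leI])
        show "C1 * 1 * (1 + real K) powr - \<beta> \<le> M" using C3 by (simp add: M_def distrib_right)
      qed
      have 2: "expL_norm \<nu> (\<lambda>x. ?s x - z x) \<le> ennreal M"
      proof (rule expL_norm_bounded[OF pos(1) M])
        fix x
        have "norm (?s x - z x) \<le> C3 * (1 + real K) powr - \<beta>" using z(2)[of x] small[of K] by linarith
        also have "\<dots> \<le> M" using C1 by (simp add: M_def distrib_right)
        finally show "norm (?s x - z x) \<le> M" .
      qed
      have "expL_norm \<nu> (f - z) \<le> ennreal (4 * M)"
      proof (rule expL_norm_quasi_triangle[OF M _ _ 1 2])
        have "f \<in> borel_measurable torus" using f by (auto simp: LG_def)
        then show "(\<lambda>x. f x - ?s x) \<in> borel_measurable torus"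
          by (intro borel_measurable_diff measurable_shell_sum)
        show "(\<lambda>x. ?s x - z x) \<in> borel_measurable torus" unfolding c
          by (intro borel_measurable_diff measurable_shell_sum borel_measurable_torus_continuous continuous_tsum)
        show "AE x in torus. norm ((f - z) x) \<le> norm (f x - ?s x) + norm (?s x - z x)"
          using norm_triangle_ineq[of "f x - ?s x" "?s x - z x" for x] by (intro AE_I2) (simp add: add.commute)
      qed
      also have "\<dots> \<le> ennreal (C * (1 + real K) powr - \<beta>)"
        using C2 by (intro ennreal_leI) (simp add: M_def C_def distrib_right)
      finally show "f \<in> expL \<nu> \<and> (\<exists>z\<in>Z. expL_norm \<nu> (f - z) \<le> ennreal (C * (1 + real K) powr - \<beta>))"
        using f z LG_subset_expL[OF \<Phi> adm] by blast
    qed (use Z C in auto)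
  qed
  then show ?thesis using C unfolding \<beta>_def by blast
qed

text \<open>The largest admissible \<open>K\<close> satisfies \<open>n \<le> 2^(2K+9)\<close>, hence \<open>ln n \<le> 9 (1 + K)\<close>.\<close>

lemma entropy_upper:
  assumes \<Phi>: "admissible_cutoff \<Phi>" and adm: "admissible_exponents \<nu> \<gamma>"
  shows "\<exists>C>0. \<forall>n\<ge>2. entropy_number n (LG \<Phi> \<gamma>) (LG_norm \<Phi> \<gamma>) (expL \<nu>) (expL_norm \<nu>)
      \<le> ennreal (C * ln (real n) powr - decay_exponent \<nu> \<gamma>)"
proof -
  define \<beta> where "\<beta> = decay_exponent \<nu> \<gamma>"
  have \<beta>: "\<beta> > 0" using admissible_exponentsD[OF adm] by (simp add: \<beta>_def)
  obtain C where C: "C > 0" and up: "\<And>K n. (K = 0 \<or> 2 ^ (2 * K + 7) \<le> n - 1) \<Longrightarrow>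
    entropy_number n (LG \<Phi> \<gamma>) (LG_norm \<Phi> \<gamma>) (expL \<nu>) (expL_norm \<nu>) \<le> ennreal (C * (1 + real K) powr - \<beta>)"
    using entropy_upper_dyadic[OF \<Phi> adm] unfolding \<beta>_def by blast
  have "entropy_number n (LG \<Phi> \<gamma>) (LG_norm \<Phi> \<gamma>) (expL \<nu>) (expL_norm \<nu>) \<le> ennreal (C * 9 powr \<beta> * ln (real n) powr - \<beta>)"
    if n: "n \<ge> 2" for n
  proof -
    have ex: "\<exists>L. n - 1 < 2 ^ (2 * L + 7)"
    proof
      have "n - 1 < 2 ^ (n - 1)" by (rule less_exp)
      also have "\<dots> \<le> 2 ^ (2 * n + 7)" by (intro power_increasing) auto
      finally show "n - 1 < 2 ^ (2 * n + 7)" .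
    qed
    define L where "L = (LEAST L. n - 1 < 2 ^ (2 * L + 7))"
    define K where "K = L - 1"
    have L: "n - 1 < 2 ^ (2 * L + 7)" unfolding L_def by (rule LeastI_ex[OF ex])
    have K: "K = 0 \<or> 2 ^ (2 * K + 7) \<le> n - 1"
    proof (cases "L = 0")
      case False
      then have "\<not> n - 1 < 2 ^ (2 * K + 7)" unfolding L_def K_def by (intro not_less_Least) auto
      then show ?thesis by simp
    qed (simp add: K_def)
    have "n \<le> 2 ^ (2 * L + 7)" using L by linarith
    also have "\<dots> \<le> 2 ^ (2 * K + 9)" by (intro power_increasing) (auto simp: K_def)
    finally have "real n \<le> real (2 ^ (2 * K + 9))" by (simp only: of_nat_le_iff)
    then have "ln (real n) \<le> ln (2 ^ (2 * K + 9))" using n by (subst ln_le_cancel_iff) auto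
    also have "\<dots> = real (2 * K + 9) * ln 2" by (simp add: ln_realpow)
    also have "\<dots> \<le> real (2 * K + 9) * 1" using ln_2_less_1 by (intro mult_left_mono) auto
    also have "\<dots> \<le> 9 * (1 + real K)" by simp
    finally have "ln (real n) / 9 \<le> 1 + real K" by simp
    moreover have ln: "ln (real n) > 0" using n by simp
    ultimately have "(1 + real K) powr - \<beta> \<le> (ln (real n) / 9) powr - \<beta>"
      using \<beta> by (intro powr_mono2') auto
    also have "\<dots> = 9 powr \<beta> * ln (real n) powr - \<beta>"
      using ln by (simp add: powr_divide powr_minus field_simps)
    finally have "C * (1 + real K) powr - \<beta> \<le> C * 9 powr \<beta> * ln (real n) powr - \<beta>"
      using C by simp
    then show ?thesis using up[OF K] by (meson ennreal_leI order_trans)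
  qed
  then show ?thesis using C unfolding \<beta>_def by (intro exI[of _ "C * 9 powr \<beta>"]) (simp add: \<beta>_def)
qed

section \<open>Compactness of the embedding\<close>

text \<open>Diagonal extraction.\<close>

lemma pointwise_convergent_subsequence:
  fixes a :: "nat \<Rightarrow> int \<Rightarrow> complex"
  assumes M: "\<And>j n. norm (a j n) \<le> M"
  obtains r l where "strict_mono (r :: nat \<Rightarrow> nat)" "\<And>n. (\<lambda>j. a (r j) n) \<longlonglongrightarrow> l n"
proof -
  define e :: "nat \<Rightarrow> int" where "e = from_nat_into UNIV"
  have e: "range e = UNIV" unfolding e_def by (rule range_from_nat_into) auto
  interpret subseqs "\<lambda>i s. convergent (\<lambda>j. a (s j) (e i))"
  proof
    fix i and s :: "nat \<Rightarrow> nat"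
    have "bounded (range (\<lambda>j. a (s j) (e i)))" using M by (auto intro: boundedI)
    then obtain l r where "strict_mono (r :: nat \<Rightarrow> nat)" "((\<lambda>j. a (s j) (e i)) \<circ> r) \<longlonglongrightarrow> l"
      using bounded_imp_convergent_subsequence by blast
    then show "\<exists>r. strict_mono r \<and> convergent (\<lambda>j. a ((s \<circ> r) j) (e i))"
      by (auto simp: convergent_def o_def)
  qed
  have "convergent (\<lambda>j. a (diagseq j) n)" for n
  proof -
    obtain i where i: "n = e i" using e by blast
    have "convergent (\<lambda>j. a ((diagseq \<circ> (+) (Suc i)) j) (e i))"
    proof (rule diagseq_holds)
      fix r s :: "nat \<Rightarrow> nat" and k
      assume "strict_mono r" "convergent (\<lambda>j. a (s j) (e k))"
      then show "convergent (\<lambda>j. a ((s \<circ> r) j) (e k))"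
        using convergent_subseq_convergent[of "\<lambda>j. a (s j) (e k)" r] by (simp add: o_def)
    qed
    then have "convergent (\<lambda>j. a (diagseq (j + Suc i)) (e i))"
      by (simp only: o_def add.commute[of _ "Suc i"])
    then obtain L where "(\<lambda>j. a (diagseq (j + Suc i)) (e i)) \<longlonglongrightarrow> L" unfolding convergent_def by blast
    then have "(\<lambda>j. a (diagseq j) (e i)) \<longlonglongrightarrow> L"
      by (rule LIMSEQ_offset[where f = "\<lambda>j. a (diagseq j) (e i)"])
    then show ?thesis unfolding i convergent_def by blast
  qed
  then have "(\<lambda>j. a (diagseq j) n) \<longlonglongrightarrow> lim (\<lambda>j. a (diagseq j) n)" for n
    by (simp add: convergent_LIMSEQ_iff)
  then show ?thesis by (rule that[OF subseq_diagseq])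
qed

lemma tendsto_tsum:
  assumes "\<And>n. n \<in> A \<Longrightarrow> (\<lambda>j. c j n) \<longlonglongrightarrow> d n"
  shows "(\<lambda>j. tsum A (c j) x) \<longlonglongrightarrow> tsum A d x"
  unfolding tsum_def by (intro tendsto_sum tendsto_mult assms tendsto_const)

text \<open>Along a subsequence all Fourier coefficients converge. The limits define pieces with the same bounds,
  and these synthesise to the limit function \<open>g\<close>. Given \<open>e\<close>, cut at a level \<open>K\<close> where the tails of all
  functions involved are at most \<open>e\<close>; the finitely many remaining coefficients converge.\<close>

theorem LG_compact_embedding:
  assumes \<Phi>: "admissible_cutoff \<Phi>" and adm: "admissible_exponents \<nu> \<gamma>"
  shows "compact_embedding (LG \<Phi> \<gamma>) (LG_norm \<Phi> \<gamma>) (expL \<nu>) (expL_norm \<nu>)"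
  unfolding compact_embedding_def
proof (intro conjI allI impI)
  show "LG \<Phi> \<gamma> \<subseteq> expL \<nu>" by (rule LG_subset_expL[OF \<Phi> adm])
  fix u :: "nat \<Rightarrow> real \<Rightarrow> complex"
  assume "\<forall>j. u j \<in> unit_ball (LG \<Phi> \<gamma>) (LG_norm \<Phi> \<gamma>)"
  then have u: "u j \<in> LG \<Phi> \<gamma>" "LG_norm \<Phi> \<gamma> (u j) \<le> ennreal 1" for j by (auto simp: unit_ball_def)
  define \<beta> where "\<beta> = decay_exponent \<nu> \<gamma>"
  note pos = admissible_exponentsD[OF adm]
  have \<beta>: "\<beta> > 0" using pos by (simp add: \<beta>_def)
  obtain C1 where C1: "C1 > 0" and tail: "\<And>A f K. A > 0 \<Longrightarrow> f \<in> LG \<Phi> \<gamma> \<Longrightarrow> LG_norm \<Phi> \<gamma> f \<le> ennreal A \<Longrightarrow>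
    expL_norm \<nu> (\<lambda>x. f x - shell_sum (LP_coeff \<Phi> f) {..K} x) \<le> ennreal (C1 * A * (1 + real K) powr - \<beta>)"
    using LG_tail_expL[OF \<Phi> adm] unfolding \<beta>_def by blast
  obtain C2 where C2: "C2 > 0" and whole: "\<And>A f. A > 0 \<Longrightarrow> f \<in> LG \<Phi> \<gamma> \<Longrightarrow> LG_norm \<Phi> \<gamma> f \<le> ennreal A \<Longrightarrow>
    expL_norm \<nu> f \<le> ennreal (C2 * A)"
    using LG_norm_imp_expL_norm[OF \<Phi> adm] by blast
  have bounded: "norm (fourier_coeff (u j) n) \<le> C2" for j n
  proof -
    have i: "integrable torus (u j)" using u by (simp add: LG_def)
    have "norm (fourier_coeff (u j) n) \<le> (\<integral>x. norm (u j x) \<partial>torus)" by (rule norm_fourier_coeff_le[OF i])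
    also have "\<dots> \<le> C2"
      using expL_norm_imp_L1[of \<nu> "u j" C2] whole[OF zero_less_one u] C2
        nn_integral_eq_integral[OF integrable_norm[OF i]] by simp
    finally show ?thesis .
  qed
  obtain r l where r: "strict_mono r" and l: "\<And>n. (\<lambda>j. fourier_coeff (u (r j)) n) \<longlonglongrightarrow> l n"
    using pointwise_convergent_subsequence[where a = "\<lambda>j n. fourier_coeff (u j) n" and M = C2, OF bounded] by blast
  define c where "c k n = of_real (dyadic_cutoff \<Phi> k (of_int n)) * l n" for k n
  have lim: "(\<lambda>j. tsum (dyadic_shell k) (LP_coeff \<Phi> (u (r j)) k) x) \<longlonglongrightarrow> tsum (dyadic_shell k) (c k) x" for k x
    unfolding LP_coeff_def c_def by (intro tendsto_tsum tendsto_mult tendsto_const l)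
  have sbu: "shell_bounded \<gamma> 1 (LP_coeff \<Phi> (u j))" for j
    using u LG_norm_le_iff[OF \<Phi>, of 1] by simp
  have sb: "shell_bounded \<gamma> 1 c"
    unfolding shell_bounded_def
  proof (intro allI)
    fix k x
    show "norm (tsum (dyadic_shell k) (c k) x) \<le> 1 * (1 + real k) powr - \<gamma>"
      using sbu unfolding shell_bounded_def
      by (intro LIMSEQ_le_const2[OF tendsto_norm[OF lim]]) blast
  qed
  obtain C3 where C3: "C3 > 0" and "\<exists>g. periodic1 g \<and> g \<in> borel_measurable torus \<and>
      (\<forall>K. expL_norm \<nu> (\<lambda>x. g x - shell_sum c {..K} x) \<le> ennreal (C3 * 1 * (1 + real K) powr - \<beta>))"
    using shell_synthesis[OF adm] sb zero_less_one unfolding \<beta>_def by blast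
  then obtain g where g: "periodic1 g" "g \<in> borel_measurable torus"
    and gt: "\<And>K. expL_norm \<nu> (\<lambda>x. g x - shell_sum c {..K} x) \<le> ennreal (C3 * 1 * (1 + real K) powr - \<beta>)"
    by blast
  have mu: "u j \<in> borel_measurable torus" for j using u(1)[of j] by (auto simp: LG_def)
  have close: "\<forall>\<^sub>F j in sequentially. expL_norm \<nu> (u (r j) - g) \<le> ennreal (16 * e)" if e: "e > 0" for e
  proof -
    have "(\<lambda>K. (1 + real K) powr - \<beta>) \<longlonglongrightarrow> 0"
      using \<beta> by (intro tendsto_neg_powr filterlim_tendsto_add_at_top[OF tendsto_const] filterlim_real_sequentially) auto
    then have "(\<lambda>K. (C1 + C3) * (1 + real K) powr - \<beta>) \<longlonglongrightarrow> (C1 + C3) * 0"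
      by (intro tendsto_mult tendsto_const)
    then have "\<forall>\<^sub>F K in sequentially. (C1 + C3) * (1 + real K) powr - \<beta> < e"
      using e by (intro order_tendstoD) auto
    then obtain K where K: "(C1 + C3) * (1 + real K) powr - \<beta> < e"
      by (auto simp: eventually_sequentially)
    have K1: "C1 * 1 * (1 + real K) powr - \<beta> \<le> e" and K3: "C3 * 1 * (1 + real K) powr - \<beta> \<le> e"
    proof -
      have "0 \<le> C1 * (1 + real K) powr - \<beta>" "0 \<le> C3 * (1 + real K) powr - \<beta>" using C1 C3 by simp_all
      then show "C1 * 1 * (1 + real K) powr - \<beta> \<le> e" "C3 * 1 * (1 + real K) powr - \<beta> \<le> e"
        using K unfolding distrib_right mult_1_right by linarith+
    qed
    define D where "D j = (\<Sum>k\<le>K. \<Sum>n\<in>dyadic_shell k. norm (LP_coeff \<Phi> (u (r j)) k n - c k n))" for j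
    have "D \<longlonglongrightarrow> (\<Sum>k\<le>K. \<Sum>n\<in>dyadic_shell k. norm (c k n - c k n))"
      unfolding D_def LP_coeff_def c_def by (intro tendsto_sum tendsto_norm tendsto_diff tendsto_mult tendsto_const l)
    then have "\<forall>\<^sub>F j in sequentially. D j < e" using e by (intro order_tendstoD) auto
    then show ?thesis
    proof eventually_elim
      case (elim j)
      let ?s = "shell_sum (LP_coeff \<Phi> (u (r j))) {..K}" and ?t = "shell_sum c {..K}"
      have 1: "expL_norm \<nu> (\<lambda>x. u (r j) x - ?s x) \<le> ennreal e"
        by (rule order_trans[OF tail[OF zero_less_one u] ennreal_leI[OF K1]])
      have 2: "expL_norm \<nu> (\<lambda>x. ?s x - ?t x) \<le> ennreal e"
      proof (rule expL_norm_bounded[OF pos(1)])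
        fix x
        have "norm (?s x - ?t x) \<le> (\<Sum>k\<le>K. norm (tsum (dyadic_shell k) (\<lambda>n. LP_coeff \<Phi> (u (r j)) k n - c k n) x))"
          unfolding sum_subtractf[symmetric] tsum_diff by (rule norm_sum)
        also have "\<dots> \<le> D j" unfolding D_def by (intro sum_mono norm_tsum_le)
        finally show "norm (?s x - ?t x) \<le> e" using elim by simp
      qed (use e in simp)
      have 3: "expL_norm \<nu> (\<lambda>x. g x - ?t x) \<le> ennreal (4 * e)"
      proof (rule order_trans[OF gt ennreal_leI])
        show "C3 * 1 * (1 + real K) powr - \<beta> \<le> 4 * e" using K3 e by linarith
      qed
      have 4: "expL_norm \<nu> (\<lambda>x. u (r j) x - ?t x) \<le> ennreal (4 * e)"
      proof (rule expL_norm_quasi_triangle[OF _ _ _ 1 2])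
        show "AE x in torus. norm (u (r j) x - ?t x) \<le> norm (u (r j) x - ?s x) + norm (?s x - ?t x)"
          using norm_triangle_ineq[of "u (r j) x - ?s x" "?s x - ?t x" for x] by (intro AE_I2) (simp add: add.commute)
      qed (use e in \<open>auto intro!: borel_measurable_diff mu measurable_shell_sum\<close>)
      have "expL_norm \<nu> (u (r j) - g) \<le> ennreal (4 * (4 * e))"
      proof (rule expL_norm_quasi_triangle[OF _ _ _ 4 3])
        show "AE x in torus. norm ((u (r j) - g) x) \<le> norm (u (r j) x - ?t x) + norm (g x - ?t x)"
          using norm_triangle_ineq4[of "u (r j) x - ?t x" "g x - ?t x" for x] by (intro AE_I2) simp
      qed (use e g in \<open>auto intro!: borel_measurable_diff mu measurable_shell_sum\<close>)
      then show ?case by simp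
    qed
  qed
  have "(\<lambda>j. expL_norm \<nu> (u (r j) - g)) \<longlonglongrightarrow> 0"
  proof (rule order_tendstoI)
    fix a :: ennreal assume "0 < a"
    then obtain b where b: "0 < b" "b < a" using dense by blast
    then obtain b' where b': "b = ennreal b'" "b' > 0" by (cases b) auto
    have "\<forall>\<^sub>F j in sequentially. expL_norm \<nu> (u (r j) - g) \<le> ennreal (16 * (b' / 16))"
      using b' by (intro close) simp
    then show "\<forall>\<^sub>F j in sequentially. expL_norm \<nu> (u (r j) - g) < a"
    proof eventually_elim
      case (elim j)
      then show ?case using b by (simp add: b' le_less_trans)
    qed
  qed simp
  moreover have "g \<in> expL \<nu>"
  proof -
    have "expL_norm \<nu> (\<lambda>x. g x - shell_sum c {..0} x) \<le> ennreal (C3 + 1)"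
      using order_trans[OF gt[of 0] ennreal_leI] by simp
    moreover have "expL_norm \<nu> (shell_sum c {..0}) \<le> ennreal (C3 + 1)"
    proof (rule expL_norm_bounded[OF pos(1)])
      fix x
      have "norm (shell_sum c {..0} x) \<le> 1 * real (card {..0::nat})"
        using pos by (intro norm_shell_sum_le[OF sb]) auto
      also have "\<dots> \<le> C3 + 1" using C3 by simp
      finally show "norm (shell_sum c {..0} x) \<le> C3 + 1" .
    qed (use C3 in simp)
    ultimately have "expL_norm \<nu> g \<le> ennreal (4 * (C3 + 1))"
    proof (rule expL_norm_quasi_triangle[rotated 3])
      show "AE x in torus. norm (g x) \<le> norm (g x - shell_sum c {..0} x) + norm (shell_sum c {..0} x)"
        using norm_triangle_ineq[of "g x - shell_sum c {..0} x" "shell_sum c {..0} x" for x]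
        by (intro AE_I2) (simp only: diff_add_cancel)
      show "shell_sum c {..0} \<in> borel_measurable torus" by (rule measurable_shell_sum)
      show "(\<lambda>x. g x - shell_sum c {..0} x) \<in> borel_measurable torus"
        by (intro borel_measurable_diff g measurable_shell_sum)
    qed (use C3 in simp)
    then have "expL_norm \<nu> g < \<infinity>" by (rule le_less_trans) simp
    then show ?thesis using g by (simp add: expL_def)
  qed
  ultimately show "\<exists>l\<in>expL \<nu>. \<exists>r. strict_mono r \<and> (\<lambda>j. expL_norm \<nu> (u (r j) - l)) \<longlonglongrightarrow> 0"
    using r by blast
qed

section \<open>Fejer bumps modulated by a lacunary sum\<close>

lemma echar_eq_1_imp:
  assumes "echar m (1 / real N) = 1" "N > 0"
  shows "int N dvd m"
proof -
  have "exp (\<i> * of_real (2 * pi * of_int m * (1 / real N))) = 1"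
    using assms(1) by (simp add: echar_def cis_conv_exp)
  then obtain k :: int where "2 * pi * of_int m * (1 / real N) = of_int (2 * k) * pi"
    by (auto simp: exp_eq_1)
  then have "real_of_int m = of_int (k * int N)" using assms(2) by (simp add: field_simps)
  then have "m = k * int N" by (simp only: of_int_eq_iff)
  then show ?thesis by simp
qed

lemma sum_echar_roots:
  assumes N: "N > 0" and m: "\<bar>m\<bar> < int N"
  shows "(\<Sum>j<N. echar m (real j / real N)) = (if m = 0 then of_nat N else 0)"
proof (cases "m = 0")
  case False
  define z where "z = echar m (1 / real N)"
  have pow: "echar m (real j / real N) = z ^ j" for j
    by (simp add: z_def echar_def Complex.DeMoivre mult_ac)
  have "z \<noteq> 1"
  proof
    assume "z = 1"
    then have "int N dvd m" using echar_eq_1_imp N unfolding z_def by blast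
    then show False using dvd_imp_le_int[OF False] m by fastforce
  qed
  moreover have "z ^ N = 1" using pow[of N] echar_nat[of m 1] N by simp
  ultimately have "(\<Sum>j<N. z ^ j) = 0" using geometric_sum[of z N] by simp
  then show ?thesis using False pow by simp
qed simp

text \<open>The Fejer kernel, normalised to have the value 1 at 0.\<close>

definition fejer :: "nat \<Rightarrow> real \<Rightarrow> real" where
  "fejer N x = (norm (\<Sum>l<N. echar (int l) x))\<^sup>2 / (real N)\<^sup>2"

lemma fejer_nonneg: "0 \<le> fejer N x"
  by (simp add: fejer_def)

lemma fejer_0: "N > 0 \<Longrightarrow> fejer N 0 = 1"
  by (simp add: fejer_def)

lemma fejer_eq_double_sum:
  "complex_of_real (fejer N x) = (\<Sum>l<N. \<Sum>l'<N. echar (int l - int l') x) / (of_nat N)\<^sup>2"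
proof -
  have "complex_of_real ((norm (\<Sum>l<N. echar (int l) x))\<^sup>2)
      = (\<Sum>l<N. echar (int l) x) * cnj (\<Sum>l<N. echar (int l) x)"
    by (rule complex_norm_square)
  also have "\<dots> = (\<Sum>l<N. \<Sum>l'<N. echar (int l) x * echar (- int l') x)"
    by (simp add: cnj_echar sum_product)
  also have "\<dots> = (\<Sum>l<N. \<Sum>l'<N. echar (int l - int l') x)"
    by (intro sum.cong refl) (metis echar_add uminus_add_conv_diff add.commute)
  finally show ?thesis by (simp add: fejer_def)
qed

text \<open>Summation over the translates to the grid annihilates all frequencies \<open>0 < |n| < N\<close>.\<close>

lemma fejer_partition_of_unity:
  assumes N: "N > 0"
  shows "(\<Sum>j<N. fejer N (x - real j / real N)) = 1"
proof -
  have "complex_of_real (\<Sum>j<N. fejer N (x - real j / real N))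
     = (\<Sum>j<N. \<Sum>l<N. \<Sum>l'<N. echar (int l - int l') (x - real j / real N)) / (of_nat N)\<^sup>2"
    by (simp add: fejer_eq_double_sum sum_divide_distrib)
  also have "(\<Sum>j<N. \<Sum>l<N. \<Sum>l'<N. echar (int l - int l') (x - real j / real N))
     = (\<Sum>l<N. \<Sum>j<N. \<Sum>l'<N. echar (int l - int l') (x - real j / real N))"
    by (rule sum.swap)
  also have "\<dots> = (\<Sum>l<N. \<Sum>l'<N. \<Sum>j<N. echar (int l - int l') (x - real j / real N))"
    by (intro sum.cong refl sum.swap)
  also have "\<dots> = (\<Sum>l<N. \<Sum>l'<N. if l' = l then of_nat N else 0)"
  proof (intro sum.cong refl)
    fix l l' assume "l \<in> {..<N}" "l' \<in> {..<N}"
    then have m: "\<bar>int l' - int l\<bar> < int N" by auto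
    have "echar (int l - int l') (x - real j / real N)
        = echar (int l - int l') x * echar (int l' - int l) (real j / real N)" for j
      using echar_add_arg[of "int l - int l'" x "- (real j / real N)"] by (simp add: echar_minus_arg)
    then show "(\<Sum>j<N. echar (int l - int l') (x - real j / real N)) = (if l' = l then of_nat N else 0)"
      using sum_echar_roots[OF N m] by (simp add: sum_distrib_left[symmetric])
  qed
  also have "\<dots> = (of_nat N)\<^sup>2" by (simp add: sum.delta power2_eq_square)
  finally have "complex_of_real (\<Sum>j<N. fejer N (x - real j / real N)) = complex_of_real 1" using N by simp
  then show ?thesis by (simp only: of_real_eq_iff)
qed

text \<open>The translates are nonnegative with sum 1, and at a grid point one of them is already 1.\<close>

lemma fejer_grid:
  assumes "i < N" "j < N" "i \<noteq> j"
  shows "fejer N (real i / real N - real j / real N) = 0"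
proof -
  have N: "N > 0" using assms by simp
  have "(\<Sum>k\<in>{..<N} - {i}. fejer N (real i / real N - real k / real N)) = 0"
    using fejer_partition_of_unity[OF N, of "real i / real N"] assms(1)
    by (subst (asm) sum.remove[of _ i]) (auto simp: fejer_0[OF N])
  then show ?thesis using assms by (subst (asm) sum_nonneg_eq_0_iff) (auto simp: fejer_nonneg)
qed

text \<open>The trigonometric polynomial of degree below \<open>N\<close> that interpolates \<open>d\<close> on the grid and inherits its
  bounds.\<close>

definition bump_sum :: "nat \<Rightarrow> (nat \<Rightarrow> real) \<Rightarrow> real \<Rightarrow> complex" where
  "bump_sum N d x = of_real (\<Sum>j<N. d j * fejer N (x - real j / real N))"

lemma norm_bump_sum_le:
  assumes N: "N > 0" and d: "\<And>j. \<bar>d j\<bar> \<le> 1"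
  shows "norm (bump_sum N d x) \<le> 1"
proof -
  have "norm (bump_sum N d x) = \<bar>\<Sum>j<N. d j * fejer N (x - real j / real N)\<bar>"
    unfolding bump_sum_def norm_of_real ..
  also have "\<dots> \<le> (\<Sum>j<N. \<bar>d j * fejer N (x - real j / real N)\<bar>)" by (rule sum_abs)
  also have "\<dots> \<le> (\<Sum>j<N. fejer N (x - real j / real N))"
    using d by (intro sum_mono) (simp add: abs_mult fejer_nonneg mult_le_cancel_right1 mult_left_le_one_le)
  finally show ?thesis using fejer_partition_of_unity[OF N] by simp
qed

lemma bump_sum_grid:
  assumes "i < N"
  shows "bump_sum N d (real i / real N) = of_real (d i)"
proof -
  have "(\<Sum>j<N. d j * fejer N (real i / real N - real j / real N)) = (\<Sum>j<N. if j = i then d j else 0)"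
    using assms by (intro sum.cong refl) (auto simp: fejer_grid fejer_0)
  then show ?thesis using assms by (simp add: bump_sum_def)
qed

lemma bump_sum_diff: "bump_sum N (\<lambda>j. d j - d' j) x = bump_sum N d x - bump_sum N d' x"
  by (simp add: bump_sum_def left_diff_distrib sum_subtractf)

definition has_spectrum :: "int set \<Rightarrow> (real \<Rightarrow> complex) \<Rightarrow> bool" where
  "has_spectrum A f \<longleftrightarrow> (\<exists>c. f = tsum A c)"

lemma has_spectrum_echar: "finite A \<Longrightarrow> n \<in> A \<Longrightarrow> has_spectrum A (echar n)"
  unfolding has_spectrum_def
  by (rule exI[of _ "\<lambda>k. if k = n then 1 else 0"])
     (simp add: fun_eq_iff tsum_def if_distrib[of "\<lambda>c. c * _"] sum.delta cong: if_cong)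

lemma has_spectrum_cmult: "has_spectrum A f \<Longrightarrow> has_spectrum A (\<lambda>x. a * f x)"
  unfolding has_spectrum_def
proof (elim exE)
  fix c assume "f = tsum A c"
  then show "\<exists>c. (\<lambda>x. a * f x) = tsum A c"
    by (intro exI[of _ "\<lambda>n. a * c n"]) (simp add: fun_eq_iff tsum_def sum_distrib_left mult.assoc)
qed

lemma has_spectrum_sum:
  assumes "\<And>i. i \<in> I \<Longrightarrow> has_spectrum A (f i)"
  shows "has_spectrum A (\<lambda>x. \<Sum>i\<in>I. f i x)"
proof -
  obtain c where c: "\<And>i. i \<in> I \<Longrightarrow> f i = tsum A (c i)" using assms unfolding has_spectrum_def by metis
  have "(\<Sum>i\<in>I. f i x) = tsum A (\<lambda>n. \<Sum>i\<in>I. c i n) x" for x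
  proof -
    have "(\<Sum>i\<in>I. f i x) = (\<Sum>i\<in>I. \<Sum>n\<in>A. c i n * echar n x)" by (intro sum.cong) (simp_all add: c tsum_def)
    also have "\<dots> = (\<Sum>n\<in>A. \<Sum>i\<in>I. c i n * echar n x)" by (rule sum.swap)
    finally show ?thesis by (simp add: tsum_def sum_distrib_right)
  qed
  then show ?thesis unfolding has_spectrum_def by (intro exI) (rule ext)
qed

text \<open>Expand the squares in the Fejer kernels.\<close>

lemma has_spectrum_bump_sum: "has_spectrum {- int N<..<int N} (bump_sum N d)"
proof -
  have "bump_sum N d x = (\<Sum>j<N. \<Sum>l<N. \<Sum>l'<N.
      (of_real (d j) / (of_nat N)\<^sup>2 * echar (int l - int l') (- (real j / real N))) * echar (int l - int l') x)" for x
  proof -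
    have "complex_of_real (d j * fejer N (x - real j / real N)) = (\<Sum>l<N. \<Sum>l'<N.
      (of_real (d j) / (of_nat N)\<^sup>2 * echar (int l - int l') (- (real j / real N))) * echar (int l - int l') x)" for j
    proof -
      have "complex_of_real (d j * fejer N (x - real j / real N))
          = of_real (d j) / (of_nat N)\<^sup>2 * (\<Sum>l<N. \<Sum>l'<N. echar (int l - int l') (x - real j / real N))"
        unfolding of_real_mult fejer_eq_double_sum by simp
      also have "\<dots> = of_real (d j) / (of_nat N)\<^sup>2 * (\<Sum>l<N. \<Sum>l'<N. echar (int l - int l') (- (real j / real N)) * echar (int l - int l') x)"
        using echar_add_arg[of _ "- (real j / real N)" x] by simp
      finally show ?thesis by (simp only: sum_distrib_left mult.assoc)
    qed
    then show ?thesis unfolding bump_sum_def of_real_sum by simp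
  qed
  then have "bump_sum N d = (\<lambda>x. \<Sum>j<N. \<Sum>l<N. \<Sum>l'<N.
      (of_real (d j) / (of_nat N)\<^sup>2 * echar (int l - int l') (- (real j / real N))) * echar (int l - int l') x)"
    by (rule ext)
  moreover have "has_spectrum {- int N<..<int N} (\<lambda>x. \<Sum>j<N. \<Sum>l<N. \<Sum>l'<N.
      (of_real (d j) / (of_nat N)\<^sup>2 * echar (int l - int l') (- (real j / real N))) * echar (int l - int l') x)"
    by (intro has_spectrum_sum has_spectrum_cmult has_spectrum_echar) auto
  ultimately show ?thesis by simp
qed

lemma bump_sum_near_grid:
  assumes N: "N > 0" and d: "\<And>j. \<bar>d j\<bar> \<le> 1" and i: "i < N" "\<bar>d i\<bar> = 1"
    and t: "0 \<le> t" "t \<le> 1 / (192 * real N)"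
  shows "norm (bump_sum N d (real i / real N + t)) \<ge> 1 / 2"
proof -
  obtain c where c: "bump_sum N d = tsum {- int N<..<int N} c"
    using has_spectrum_bump_sum unfolding has_spectrum_def by blast
  have b: "norm (tsum {- int N<..<int N} c x) \<le> 1" for x
    using norm_bump_sum_le[where x = x and d = d, OF N d] by (simp add: c)
  have "norm (bump_sum N d (real i / real N) - bump_sum N d (real i / real N + t)) \<le> 96 * real N * 1 * \<bar>real i / real N - (real i / real N + t)\<bar>"
    unfolding c using N by (intro tsum_lipschitz[OF _ _ b]) auto
  also have "\<dots> \<le> 1 / 2" using t N by (simp add: field_simps)
  finally have "norm (bump_sum N d (real i / real N) - bump_sum N d (real i / real N + t)) \<le> 1 / 2" .
  moreover have "norm (bump_sum N d (real i / real N)) = 1" using bump_sum_grid[OF i(1), of d] i(2) by simp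
  ultimately show ?thesis
    using norm_triangle_ineq2[of "bump_sum N d (real i / real N)" "bump_sum N d (real i / real N + t)"] by linarith
qed

text \<open>The block of frequencies with index \<open>k\<close> is \<open>2^k + n\<close> with \<open>|n| < 2^K\<close>. For
  \<open>k > K\<close> these blocks are disjoint, and each lies in the dyadic shell with the same index.\<close>

definition lacunary_bump :: "nat \<Rightarrow> (nat \<Rightarrow> real) \<Rightarrow> real \<Rightarrow> complex" where
  "lacunary_bump K d x = (\<Sum>k\<in>{K<..2 * K}. echar (2 ^ k) x * bump_sum (2 ^ K) d x)"

lemma lacunary_bump_diff:
  "lacunary_bump K (\<lambda>j. d j - d' j) x = lacunary_bump K d x - lacunary_bump K d' x"
  by (simp add: lacunary_bump_def bump_sum_diff right_diff_distrib sum_subtractf)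

lemma continuous_bump_sum: "continuous_on UNIV (bump_sum N d)"
  using has_spectrum_bump_sum[of N d] unfolding has_spectrum_def by (auto simp: continuous_tsum)

lemma modulated_tsum: "echar q x * tsum A c x = tsum ((+) q ` A) (\<lambda>n. c (n - q)) x"
proof -
  have "tsum ((+) q ` A) (\<lambda>n. c (n - q)) x = (\<Sum>n\<in>A. c n * echar (q + n) x)"
    unfolding tsum_def by (subst sum.reindex) auto
  then show ?thesis by (simp add: tsum_def sum_distrib_left echar_add mult_ac)
qed

lemma continuous_lacunary_bump: "continuous_on UNIV (lacunary_bump K d)"
  unfolding lacunary_bump_def
  by (intro continuous_on_sum continuous_on_mult continuous_on_echar continuous_on_id continuous_bump_sum)

lemma lacunary_bump_periodic: "periodic1 (lacunary_bump K d)"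
proof -
  have "bump_sum N d (x + 1) = bump_sum N d x" for N x
    using has_spectrum_bump_sum[of N d] unfolding has_spectrum_def by auto
  then show ?thesis by (simp add: periodic1_def lacunary_bump_def)
qed

text \<open>At a point of the grid all characters \<open>e(2^k x)\<close> with \<open>k > K\<close> are 1. Within distance
  \<open>4^-K / 192\<close> the characters up to \<open>k = 2K\<close> keep a real part of at least \<open>1/2\<close>, so nothing
  cancels.\<close>

lemma lacunary_bump_peak:
  assumes K: "K \<ge> 1" and d: "\<And>j. \<bar>d j\<bar> \<le> 1" and i: "i < 2 ^ K" "\<bar>d i\<bar> = 1"
    and t: "0 \<le> t" "t \<le> 1 / (192 * 4 ^ K)"
  shows "norm (lacunary_bump K d (real i / 2 ^ K + t)) \<ge> real K / 4"
proof -
  let ?x = "real i / 2 ^ K + t"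
  have e: "Re (echar (2 ^ k) ?x) \<ge> 1 / 2" if k: "k \<in> {K<..2 * K}" for k
  proof -
    have "echar (2 ^ k) (real i / 2 ^ K) = 1"
    proof -
      have "(2::real) ^ k = 2 ^ (k - K) * 2 ^ K" using k by (simp flip: power_add)
      then have "(2::real) ^ k * (real i / 2 ^ K) = real (2 ^ (k - K) * i)" by simp
      then have "cis (2 * pi * (2 ^ k * (real i / 2 ^ K))) = echar 1 (real (2 ^ (k - K) * i))"
        by (simp only: echar_def of_int_1 mult_1_right)
      moreover have "echar (2 ^ k) (real i / 2 ^ K) = cis (2 * pi * (2 ^ k * (real i / 2 ^ K)))"
        by (simp add: echar_def mult.assoc)
      ultimately show ?thesis by (simp only: echar_nat)
    qed
    then have x: "echar (2 ^ k) ?x = echar (2 ^ k) t" by (simp add: echar_add_arg)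
    have "(2::real) ^ k \<le> 2 ^ (2 * K)" using k by (intro power_increasing) auto
    then have "(2::real) ^ k * t \<le> 4 ^ K * (1 / (192 * 4 ^ K))"
      using t by (intro mult_mono) (auto simp: power_mult)
    then have "2 ^ k * t \<le> 1 / 192" by simp
    then have "2 * pi * (2 ^ k * t) \<le> 2 * pi * (1 / 192)" by (intro mult_left_mono) auto
    then have le: "2 * pi * 2 ^ k * t \<le> pi / 3" using pi_gt_zero by (simp add: mult.assoc)
    have "cos (pi / 3) \<le> cos (2 * pi * 2 ^ k * t)"
      using le t pi_gt_zero by (subst cos_mono_le_eq) auto
    then show ?thesis unfolding x by (simp add: echar_def cos_60)
  qed
  have "(\<Sum>k\<in>{K<..2 * K}. 1 / 2) \<le> (\<Sum>k\<in>{K<..2 * K}. Re (echar (2 ^ k) ?x))" by (intro sum_mono e)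
  then have "real K / 2 \<le> Re (\<Sum>k\<in>{K<..2 * K}. echar (2 ^ k) ?x)" by simp
  also have "\<dots> \<le> norm (\<Sum>k\<in>{K<..2 * K}. echar (2 ^ k) ?x)" by (rule complex_Re_le_cmod)
  finally have 1: "real K / 2 \<le> norm (\<Sum>k\<in>{K<..2 * K}. echar (2 ^ k) ?x)" .
  have "t \<le> 1 / (192 * real (2 ^ K))"
  proof (rule order_trans[OF t(2)])
    have "(2::real) ^ K \<le> 4 ^ K" by (intro power_mono) auto
    then show "1 / (192 * 4 ^ K) \<le> 1 / (192 * real (2 ^ K))" by (intro divide_left_mono mult_left_mono) auto
  qed
  then have 2: "1 / 2 \<le> norm (bump_sum (2 ^ K) d ?x)"
    using bump_sum_near_grid[of "2 ^ K" d i t] d i t by simp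
  have "real K / 2 * (1 / 2) \<le> norm (\<Sum>k\<in>{K<..2 * K}. echar (2 ^ k) ?x) * norm (bump_sum (2 ^ K) d ?x)"
    by (intro mult_mono 1 2) auto
  also have "\<dots> = norm (lacunary_bump K d ?x)"
    unfolding lacunary_bump_def sum_distrib_right[symmetric] norm_mult ..
  finally show ?thesis by simp
qed

text \<open>The \<open>K\<close> frequency blocks are disjoint translates of the spectrum of the bump sum.\<close>

lemma lacunary_bump_L2:
  assumes K: "K \<ge> 1"
  shows "(\<integral>x. (norm (lacunary_bump K d x))\<^sup>2 \<partial>torus) = real K * (\<integral>x. (norm (bump_sum (2 ^ K) d x))\<^sup>2 \<partial>torus)"
proof -
  define B where "B = {- int (2 ^ K)<..<int (2 ^ K)}"
  obtain c where c: "bump_sum (2 ^ K) d = tsum B c"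
    using has_spectrum_bump_sum unfolding has_spectrum_def B_def by blast
  define P where "P = {K<..2 * K} \<times> B"
  define \<phi> where "\<phi> p = 2 ^ fst p + snd p" for p :: "nat \<times> int"
  have finP: "finite P" by (simp add: P_def B_def)
  have less: False if "k < k'" "K < k" "n \<in> B" "n' \<in> B" "2 ^ k + n = 2 ^ k' + n'" for k k' and n n' :: int
  proof -
    have "(2::int) ^ Suc k \<le> 2 ^ k'" using that(1) by (intro power_increasing) auto
    moreover have "(2::int) ^ Suc K \<le> 2 ^ k" using that(2) by (intro power_increasing) auto
    ultimately show False using that(3-5) by (auto simp: B_def)
  qed
  have inj: "inj_on \<phi> P"
  proof (rule inj_onI)
    fix p p' assume pp: "p \<in> P" "p' \<in> P" "\<phi> p = \<phi> p'"
    obtain k n k' n' where p: "p = (k, n)" "p' = (k', n')" by (cases p, cases p')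
    then have m: "K < k" "K < k'" "n \<in> B" "n' \<in> B" "2 ^ k + n = 2 ^ k' + n'"
      using pp by (auto simp: P_def \<phi>_def)
    then have "k = k'" using less[of k k' n n'] less[of k' k n' n] by (metis linorder_neqE_nat)
    then show "p = p'" using m p by simp
  qed
  define c' where "c' q = c (snd (inv_into P \<phi> q))" for q
  have c': "c' (\<phi> p) = c (snd p)" if "p \<in> P" for p using inv_into_f_f[OF inj that] by (simp add: c'_def)
  have "lacunary_bump K d x = tsum (\<phi> ` P) c' x" for x
  proof -
    have "tsum (\<phi> ` P) c' x = (\<Sum>p\<in>P. c (snd p) * echar (2 ^ fst p + snd p) x)"
      unfolding tsum_def
    proof (subst sum.reindex[OF inj], intro sum.cong refl)
      fix p assume "p \<in> P"
      from c'[OF this] show "((\<lambda>n. c' n * echar n x) \<circ> \<phi>) p = c (snd p) * echar (2 ^ fst p + snd p) x"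
        by (simp add: \<phi>_def)
    qed
    also have "\<dots> = (\<Sum>k\<in>{K<..2 * K}. \<Sum>n\<in>B. c n * echar (2 ^ k + n) x)"
      unfolding P_def by (simp add: sum.cartesian_product case_prod_beta)
    also have "\<dots> = lacunary_bump K d x"
      unfolding lacunary_bump_def c tsum_def by (simp add: echar_add sum_distrib_left mult_ac)
    finally show ?thesis ..
  qed
  then have "(\<integral>x. (norm (lacunary_bump K d x))\<^sup>2 \<partial>torus) = (\<integral>x. (norm (tsum (\<phi> ` P) c' x))\<^sup>2 \<partial>torus)" by simp
  also have "\<dots> = (\<Sum>q\<in>\<phi> ` P. (norm (c' q))\<^sup>2)" using finP by (intro parseval_tsum) simp
  also have "\<dots> = (\<Sum>p\<in>P. (norm (c (snd p)))\<^sup>2)"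
    by (subst sum.reindex[OF inj]) (auto intro!: sum.cong simp: c')
  also have "\<dots> = (\<Sum>k\<in>{K<..2 * K}. \<Sum>n\<in>B. (norm (c n))\<^sup>2)"
    unfolding P_def sum.cartesian_product by (simp only: case_prod_unfold)
  also have "\<dots> = real K * (\<Sum>n\<in>B. (norm (c n))\<^sup>2)" by simp
  also have "(\<Sum>n\<in>B. (norm (c n))\<^sup>2) = (\<integral>x. (norm (bump_sum (2 ^ K) d x))\<^sup>2 \<partial>torus)"
    unfolding c by (rule parseval_tsum[symmetric]) (simp add: B_def)
  finally show ?thesis .
qed

section \<open>Test functions in the unit ball and binary codes\<close>

text \<open>The derivative is bounded on \<open>[-2, 2]\<close>. Since \<open>\<Phi>\<close> vanishes at the end points, its
  values do not change when the argument is clamped to this interval.\<close>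

lemma cutoff_lipschitz:
  assumes \<Phi>: "admissible_cutoff \<Phi>"
  shows "\<exists>L>0. \<forall>s t. \<bar>\<Phi> s - \<Phi> t\<bar> \<le> L * \<bar>s - t\<bar>"
proof -
  have diff: "(deriv ^^ n) \<Phi> differentiable (at x)" for n x
    using \<Phi> by (simp add: admissible_cutoff_def smooth_def)
  have D: "(\<Phi> has_real_derivative deriv \<Phi> x) (at x)" for x
    using diff[of 0 x] by (simp add: DERIV_deriv_iff_real_differentiable)
  have "deriv \<Phi> differentiable (at x)" for x using diff[of 1 x] by simp
  then have "continuous_on {-2..2} (deriv \<Phi>)"
    by (intro continuous_at_imp_continuous_on ballI differentiable_imp_continuous_within)
  then have "compact (deriv \<Phi> ` {-2..2})" by (intro compact_continuous_image) auto
  then obtain L0 where L0: "\<forall>y\<in>deriv \<Phi> ` {-2..2}. norm y \<le> L0" using compact_imp_bounded bounded_iff by metis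
  define L where "L = \<bar>L0\<bar> + 1"
  have L: "L > 0" by (simp add: L_def)
  have bound: "\<bar>deriv \<Phi> x\<bar> \<le> L" if "-2 \<le> x" "x \<le> 2" for x
  proof -
    have "norm (deriv \<Phi> x) \<le> L0" using L0 that by auto
    then show ?thesis by (simp add: L_def)
  qed
  have ordered: "\<bar>\<Phi> s - \<Phi> t\<bar> \<le> L * \<bar>s - t\<bar>" if st: "-2 \<le> s" "s < t" "t \<le> 2" for s t
  proof -
    obtain z where z: "s < z" "z < t" "\<Phi> t - \<Phi> s = (t - s) * deriv \<Phi> z"
      using MVT2[OF st(2), of \<Phi> "deriv \<Phi>"] D by blast
    have "\<bar>\<Phi> s - \<Phi> t\<bar> = \<bar>t - s\<bar> * \<bar>deriv \<Phi> z\<bar>"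
      by (metis z(3) abs_minus_commute abs_mult)
    also have "\<dots> \<le> \<bar>t - s\<bar> * L" using bound[of z] z st by (intro mult_left_mono) auto
    finally show ?thesis by (simp add: mult.commute abs_minus_commute)
  qed
  have inside: "\<bar>\<Phi> s - \<Phi> t\<bar> \<le> L * \<bar>s - t\<bar>" if "-2 \<le> s" "s \<le> 2" "-2 \<le> t" "t \<le> 2" for s t
    using ordered[of s t] ordered[of t s] that
    by (cases s t rule: linorder_cases) (auto simp: abs_minus_commute)
  define cl where "cl s = max (-2) (min 2 s)" for s :: real
  have cl: "\<Phi> s = \<Phi> (cl s)" for s
    using cutoff_eq_0[OF \<Phi>, of s] cutoff_eq_0[OF \<Phi>, of 2] cutoff_eq_0[OF \<Phi>, of "-2"]
    by (cases "s < -2"; cases "s > 2") (auto simp: cl_def)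
  have "\<bar>\<Phi> s - \<Phi> t\<bar> \<le> L * \<bar>s - t\<bar>" for s t
  proof -
    have "\<bar>\<Phi> s - \<Phi> t\<bar> \<le> L * \<bar>cl s - cl t\<bar>" unfolding cl[of s] cl[of t] by (rule inside) (auto simp: cl_def)
    also have "\<dots> \<le> L * \<bar>s - t\<bar>" using L by (intro mult_left_mono) (auto simp: cl_def)
    finally show ?thesis .
  qed
  then show ?thesis using L by blast
qed

text \<open>The symbols \<open>\<phi>\<^sub>k\<close> have width \<open>2^(k+1)\<close> and Lipschitz constant of order \<open>2^-k\<close>.\<close>

lemma LP_multiplier_bound:
  assumes \<Phi>: "admissible_cutoff \<Phi>"
  shows "\<exists>C>0. \<forall>k A c b x. finite A \<longrightarrow> (\<forall>y. norm (tsum A c y) \<le> b) \<longrightarrow>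
    norm (tsum A (\<lambda>n. of_real (dyadic_cutoff \<Phi> k (of_int n)) * c n) x) \<le> C * b"
proof -
  obtain L where L: "L > 0" and lip: "\<And>s t. \<bar>\<Phi> s - \<Phi> t\<bar> \<le> L * \<bar>s - t\<bar>"
    using cutoff_lipschitz[OF \<Phi>] by blast
  have \<Phi>b: "\<bar>\<Phi> s\<bar> \<le> 4 * L" for s
  proof (cases "\<bar>s\<bar> \<ge> 2")
    case True
    then show ?thesis using cutoff_eq_0[OF \<Phi>] L by simp
  next
    case False
    have "\<bar>\<Phi> s\<bar> \<le> L * \<bar>s - 2\<bar>" using lip[of s 2] cutoff_eq_0[OF \<Phi>, of 2] by simp
    also have "\<dots> \<le> L * 4" using False L by (intro mult_left_mono) auto
    finally show ?thesis by simp
  qed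
  have size: "\<bar>dyadic_cutoff \<Phi> k s\<bar> \<le> 14 * L" for k s
  proof (cases "k = 0")
    case True
    then show ?thesis using \<Phi>b[of s] L by (simp add: dyadic_cutoff_alt)
  next
    case False
    have "\<bar>\<Phi> (s / 2 ^ k) - \<Phi> (s / 2 ^ (k - 1))\<bar> \<le> \<bar>\<Phi> (s / 2 ^ k)\<bar> + \<bar>\<Phi> (s / 2 ^ (k - 1))\<bar>" by (rule abs_triangle_ineq4)
    also have "\<dots> \<le> 4 * L + 4 * L" by (intro add_mono \<Phi>b)
    also have "\<dots> \<le> 14 * L" using L by simp
    finally show ?thesis using False by (simp add: dyadic_cutoff_alt)
  qed
  have step: "\<bar>dyadic_cutoff \<Phi> k (s + 1) - dyadic_cutoff \<Phi> k s\<bar> \<le> 14 * L / 2 ^ (k + 1)" for k s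
  proof (cases k)
    case 0
    then show ?thesis using lip[of "s + 1" s] L by (simp add: dyadic_cutoff_alt)
  next
    case (Suc l)
    have d: "\<bar>\<Phi> ((s + 1) / 2 ^ m) - \<Phi> (s / 2 ^ m)\<bar> \<le> L / 2 ^ m" for m
      using lip[of "(s + 1) / 2 ^ m" "s / 2 ^ m"] by (simp add: add_divide_distrib)
    have "dyadic_cutoff \<Phi> k (s + 1) - dyadic_cutoff \<Phi> k s
        = (\<Phi> ((s + 1) / 2 ^ k) - \<Phi> (s / 2 ^ k)) - (\<Phi> ((s + 1) / 2 ^ l) - \<Phi> (s / 2 ^ l))"
      by (simp add: dyadic_cutoff_alt Suc)
    then have "\<bar>dyadic_cutoff \<Phi> k (s + 1) - dyadic_cutoff \<Phi> k s\<bar> \<le> L / 2 ^ k + L / 2 ^ l"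
      using d[of k] d[of l] by linarith
    also have "\<dots> = 6 * L / 2 ^ (k + 1)" by (simp add: Suc field_simps)
    also have "\<dots> \<le> 14 * L / 2 ^ (k + 1)" using L by (intro divide_right_mono) auto
    finally show ?thesis .
  qed
  have "norm (tsum A (\<lambda>n. of_real (dyadic_cutoff \<Phi> k (of_int n)) * c n) x) \<le> 6 * (14 * L) * b"
    if "finite A" "\<And>y. norm (tsum A c y) \<le> b" for k A c b x
  proof (rule multiplier_bound[where m = "\<lambda>n. of_real (dyadic_cutoff \<Phi> k (of_int n))" and D = "2 ^ (k + 1)" and c = c])
    show "complex_of_real (dyadic_cutoff \<Phi> k (of_int n)) = 0" if "\<bar>n\<bar> > int (2 ^ (k + 1))" for n
      using dyadic_cutoff_eq_0[OF \<Phi>, of n k] dyadic_shell_subset[of k] that by fastforce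
    show "norm (complex_of_real (dyadic_cutoff \<Phi> k (of_int n))) \<le> 14 * L" for n
      using size by simp
    show "norm (complex_of_real (dyadic_cutoff \<Phi> k (of_int (n + 1))) - of_real (dyadic_cutoff \<Phi> k (of_int n)))
        \<le> 14 * L / real (2 ^ (k + 1))" for n
      using step[of k "of_int n"] by (simp flip: of_real_diff)
  qed (use that in auto)
  then show ?thesis using L by (intro exI[of _ "6 * (14 * L)"]) auto
qed

lemma fourier_coeff_cmult: "fourier_coeff (\<lambda>x. a * f x) n = a * fourier_coeff f n"
  by (simp add: fourier_coeff_echar mult.assoc)

text \<open>Each frequency block meets only the shells \<open>k - 1\<close>, \<open>k\<close>, \<open>k + 1\<close>. So a Littlewood-Paley
  piece sees at most three blocks, and only pieces with index up to \<open>2K + 1\<close> occur.\<close>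

lemma lacunary_bump_shell_bounded:
  assumes \<Phi>: "admissible_cutoff \<Phi>" and \<gamma>: "\<gamma> \<ge> 0"
  shows "\<exists>C>0. \<forall>K d. K \<ge> 1 \<longrightarrow> (\<forall>j. \<bar>d j\<bar> \<le> 1) \<longrightarrow>
    shell_bounded \<gamma> (C * real K powr \<gamma>) (LP_coeff \<Phi> (lacunary_bump K d))"
proof -
  obtain C where C: "C > 0" and mult: "\<And>k A c b x. finite A \<Longrightarrow> (\<And>y. norm (tsum A c y) \<le> b) \<Longrightarrow>
    norm (tsum A (\<lambda>n. of_real (dyadic_cutoff \<Phi> k (of_int n)) * c n) x) \<le> C * b"
    using LP_multiplier_bound[OF \<Phi>] by blast
  have "shell_bounded \<gamma> (3 * C * 4 powr \<gamma> * real K powr \<gamma>) (LP_coeff \<Phi> (lacunary_bump K d))"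
    if K: "K \<ge> 1" and d: "\<And>j. \<bar>d j\<bar> \<le> 1" for K d
    unfolding shell_bounded_def
  proof (intro allI)
    fix m x
    define B where "B = {- int (2 ^ K)<..<int (2 ^ K)}"
    obtain c where c: "bump_sum (2 ^ K) d = tsum B c"
      using has_spectrum_bump_sum unfolding has_spectrum_def B_def by blast
    define A where "A k = (+) (2 ^ k) ` B" for k :: nat
    define e where "e k n = c (n - 2 ^ k)" for k :: nat and n
    have finA: "finite (A k)" for k by (simp add: A_def B_def)
    have piece: "echar (2 ^ k) y * bump_sum (2 ^ K) d y = tsum (A k) (e k) y" for k y
      unfolding c modulated_tsum A_def e_def ..
    have unit: "norm (tsum (A k) (e k) y) \<le> 1" for k y
      using norm_bump_sum_le[where d = d and N = "2 ^ K" and x = y] d unfolding piece[symmetric]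
      by (simp add: norm_mult)
    define F where "F k n = (if n \<in> A k then e k n else 0)" for k n
    have "fourier_coeff (lacunary_bump K d) n = (\<Sum>k\<in>{K<..2 * K}. F k n)" for n
    proof -
      have "fourier_coeff (lacunary_bump K d) n = (\<Sum>k\<in>{K<..2 * K}. fourier_coeff (tsum (A k) (e k)) n)"
        unfolding fourier_coeff_echar lacunary_bump_def piece sum_distrib_right
        by (intro Bochner_Integration.integral_sum integrable_times_echar integrable_torus_continuous continuous_tsum)
      then show ?thesis by (simp add: fourier_coeff_tsum[OF finA] F_def)
    qed
    then have "tsum (dyadic_shell m) (LP_coeff \<Phi> (lacunary_bump K d) m) x
       = (\<Sum>k\<in>{K<..2 * K}. tsum (dyadic_shell m) (\<lambda>n. of_real (dyadic_cutoff \<Phi> m (of_int n)) * F k n) x)"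
      unfolding tsum_def LP_coeff_def by (subst sum.swap) (simp add: sum_distrib_left sum_distrib_right)
    also have "norm \<dots> \<le> (\<Sum>k\<in>{K<..2 * K}. if k \<le> m + 1 \<and> m \<le> k + 1 then C else 0)"
    proof (rule order_trans[OF norm_sum sum_mono])
      fix k assume k: "k \<in> {K<..2 * K}"
      let ?\<phi> = "\<lambda>n. complex_of_real (dyadic_cutoff \<Phi> m (of_int n))"
      show "norm (tsum (dyadic_shell m) (\<lambda>n. ?\<phi> n * F k n) x) \<le> (if k \<le> m + 1 \<and> m \<le> k + 1 then C else 0)"
      proof (cases "k \<le> m + 1 \<and> m \<le> k + 1")
        case True
        have "tsum (dyadic_shell m) (\<lambda>n. ?\<phi> n * F k n) x = tsum (dyadic_shell m \<union> A k) (\<lambda>n. ?\<phi> n * F k n) x"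
          using finA by (intro tsum_mono_neutral) (auto simp: dyadic_cutoff_eq_0[OF \<Phi>])
        also have "\<dots> = tsum (A k) (\<lambda>n. ?\<phi> n * F k n) x"
          using finA by (intro tsum_mono_neutral[symmetric]) (auto simp: F_def)
        also have "\<dots> = tsum (A k) (\<lambda>n. ?\<phi> n * e k n) x"
          unfolding tsum_def by (intro sum.cong) (auto simp: F_def)
        finally show ?thesis using mult[OF finA unit, of k m x] True by simp
      next
        case False
        have "F k n = 0" if n: "n \<in> dyadic_shell m" for n
        proof (rule ccontr)
          assume "F k n \<noteq> 0"
          then have "n \<in> A k" by (auto simp: F_def split: if_splits)
          then obtain q where q: "n = 2 ^ k + q" "\<bar>q\<bar> < 2 ^ K" by (auto simp: A_def B_def)
          obtain l where l: "k = Suc l" "K \<le> l" using k by (cases k) auto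
          have e: "(2::int) ^ k = 2 * 2 ^ l" "(2::int) ^ (k + 1) = 4 * 2 ^ l" by (simp_all add: l)
          have "(2::int) ^ K \<le> 2 ^ l" using l by (intro power_increasing) auto
          then have n': "2 ^ l < n" "n < 2 ^ (k + 1)" using q unfolding e by linarith+
          show False
          proof (cases m)
            case 0
            have "(2::int) ^ 1 \<le> 2 ^ l" using K l by (intro power_increasing) auto
            then show False using n n' 0 by (auto simp: dyadic_shell_def)
          next
            case (Suc p)
            have n0: "0 < n" using zero_less_power[of "2::int" l] n'(1) by linarith
            have "2 ^ p \<le> n" "n \<le> 2 ^ (m + 1)" using n n0 Suc by (auto simp: dyadic_shell_def abs_if split: if_splits)
            then have less: "(2::int) ^ p < 2 ^ (k + 1)" "(2::int) ^ l < 2 ^ (m + 1)" using n' by linarith+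
            have "p < k + 1" by (rule power_less_imp_less_exp[OF _ less(1)]) simp
            moreover have "l < m + 1" by (rule power_less_imp_less_exp[OF _ less(2)]) simp
            ultimately show False using False Suc l by simp
          qed
        qed
        then have "tsum (dyadic_shell m) (\<lambda>n. ?\<phi> n * F k n) x = 0" by (simp add: tsum_def)
        then show ?thesis using C by simp
      qed
    qed
    also have "\<dots> \<le> 3 * C * 4 powr \<gamma> * real K powr \<gamma> * (1 + real m) powr - \<gamma>"
    proof (cases "m \<le> 2 * K + 1")
      case True
      have "(\<Sum>k\<in>{K<..2 * K}. if k \<le> m + 1 \<and> m \<le> k + 1 then C else 0)
          \<le> (\<Sum>k\<in>{m - 1, m, m + 1}. C)"
      proof -
        have "(\<Sum>k\<in>{K<..2 * K}. if k \<le> m + 1 \<and> m \<le> k + 1 then C else 0)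
            = (\<Sum>k\<in>{k \<in> {K<..2 * K}. k \<le> m + 1 \<and> m \<le> k + 1}. C)"
          by (rule sum.inter_filter[symmetric]) simp
        also have "\<dots> \<le> (\<Sum>k\<in>{m - 1, m, m + 1}. C)" using C by (intro sum_mono2) auto
        finally show ?thesis .
      qed
      also have "\<dots> \<le> 3 * C"
      proof -
        have "card {m - 1, m, m + 1} \<le> Suc (Suc (Suc 0))"
          by (intro order_trans[OF card_insert_le_m1] card_insert_le_m1) auto
        then have "real (card {m - 1, m, m + 1}) \<le> 3" by linarith
        then show ?thesis using C by simp
      qed
      also have "\<dots> \<le> 3 * C * (4 powr \<gamma> * real K powr \<gamma> * (1 + real m) powr - \<gamma>)"
      proof -
        have "1 + real m \<le> 4 * real K" using True K by linarith
        then have "(1 + real m) powr \<gamma> \<le> (4 * real K) powr \<gamma>" using \<gamma> by (intro powr_mono2) auto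
        then have "1 \<le> 4 powr \<gamma> * real K powr \<gamma> * (1 + real m) powr - \<gamma>"
          by (simp add: powr_mult powr_minus field_simps)
        then have "3 * C * 1 \<le> 3 * C * (4 powr \<gamma> * real K powr \<gamma> * (1 + real m) powr - \<gamma>)"
          using C by (intro mult_left_mono) auto
        then show ?thesis by simp
      qed
      finally show ?thesis by (simp only: mult.assoc)
    next
      case False
      then have "(\<Sum>k\<in>{K<..2 * K}. if k \<le> m + 1 \<and> m \<le> k + 1 then C else 0) = 0"
        by (intro sum.neutral) auto
      then show ?thesis using C by simp
    qed
    finally show "norm (tsum (dyadic_shell m) (LP_coeff \<Phi> (lacunary_bump K d) m) x)
       \<le> 3 * C * 4 powr \<gamma> * real K powr \<gamma> * (1 + real m) powr - \<gamma>" .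
  qed
  then show ?thesis using C by (intro exI[of _ "3 * C * 4 powr \<gamma>"]) auto
qed

lemma sum_powr_card_Pow:
  fixes x :: real
  assumes "finite A"
  shows "(\<Sum>U\<in>Pow A. x ^ card U) = (1 + x) ^ card A"
  using assms
proof (induction A)
  case (insert a A)
  have inj: "inj_on (insert a) (Pow A)" using insert.hyps by (auto simp: inj_on_def)
  have "(\<Sum>U\<in>Pow (insert a A). x ^ card U) = (\<Sum>U\<in>Pow A. x ^ card U) + (\<Sum>U\<in>insert a ` Pow A. x ^ card U)"
    unfolding Pow_insert using insert.hyps by (intro sum.union_disjoint) auto
  also have "(\<Sum>U\<in>insert a ` Pow A. x ^ card U) = (\<Sum>U\<in>Pow A. x * x ^ card U)"
    unfolding sum.reindex[OF inj] o_def
  proof (intro sum.cong refl)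
    fix U assume "U \<in> Pow A"
    then have "card (insert a U) = Suc (card U)" using insert.hyps by (auto intro: card_insert_disjoint finite_subset)
    then show "x ^ card (insert a U) = x * x ^ card U" by simp
  qed
  finally show ?case using insert by (simp add: sum_distrib_left[symmetric] algebra_simps)
qed simp

text \<open>The Chernoff bound: a set \<open>U\<close> with at most \<open>N/16\<close> elements has weight
  \<open>4 powr (N/16) * (1/4)^|U| \<ge> 1\<close>, and the weights of all subsets add up to
  \<open>4 powr (N/16) * (5/4)^N\<close>. Finally \<open>5/4 \<le> 2 powr (3/8)\<close>.\<close>

lemma card_small_subsets_le:
  "real (card {U. U \<subseteq> {..<N} \<and> 16 * card U \<le> N}) \<le> 2 powr (real N / 2)"
proof -
  have "real (card {U. U \<subseteq> {..<N} \<and> 16 * card U \<le> N}) = (\<Sum>U | U \<subseteq> {..<N} \<and> 16 * card U \<le> N. 1)" by simp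
  also have "\<dots> \<le> (\<Sum>U | U \<subseteq> {..<N} \<and> 16 * card U \<le> N. 4 powr (real N / 16) * (1/4) ^ card U)"
  proof (rule sum_mono)
    fix U assume "U \<in> {U. U \<subseteq> {..<N} \<and> 16 * card U \<le> N}"
    then have "real (card U) \<le> real N / 16" by simp
    then have "4 powr (real (card U)) \<le> 4 powr (real N / 16)" by (intro powr_mono) auto
    then show "1 \<le> 4 powr (real N / 16) * (1/4) ^ card U"
      by (simp add: powr_realpow power_one_over field_simps)
  qed
  also have "\<dots> \<le> (\<Sum>U\<in>Pow {..<N}. 4 powr (real N / 16) * (1/4) ^ card U)"
    by (intro sum_mono2) auto
  also have "\<dots> = 4 powr (real N / 16) * (1 + 1/4) ^ N"
    by (simp add: sum_distrib_left[symmetric] sum_powr_card_Pow)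
  also have "\<dots> \<le> 2 powr (real N / 8) * (2 powr (3/8)) ^ N"
  proof (intro mult_mono power_mono)
    have "(5/4 :: real) powr 8 \<le> 2 powr 3" by (simp add: powr_numeral power_divide)
    then have "((5/4 :: real) powr 8) powr (1/8) \<le> (2 powr 3) powr (1/8)" by (intro powr_mono2) auto
    moreover have "((5/4 :: real) powr 8) powr (1/8) = 1 + 1/4" by (subst powr_powr) simp
    moreover have "((2::real) powr 3) powr (1/8) = 2 powr (3/8)" by (subst powr_powr) simp
    ultimately show "1 + 1/4 \<le> (2::real) powr (3/8)" by (simp only:)
    have "((2::real) powr 2) powr (real N / 16) = 2 powr (real N / 8)" by (subst powr_powr) simp
    moreover have "(2::real) powr 2 = 4" by (simp add: powr_numeral)
    ultimately show "(4::real) powr (real N / 16) \<le> 2 powr (real N / 8)" by (simp only:)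
  qed auto
  also have "\<dots> = 2 powr (real N / 2)"
  proof -
    have "(2 powr (3/8)) ^ N = (2 powr (3/8)) powr real N" by (simp add: powr_realpow)
    also have "\<dots> = (2::real) powr (3 * real N / 8)" by (subst powr_powr) simp
    finally have e: "(2 powr (3/8)) ^ N = (2::real) powr (3 * real N / 8)" .
    show ?thesis unfolding e powr_add[symmetric] by simp
  qed
  finally show ?thesis .
qed

text \<open>Gilbert and Varshamov: the balls of radius \<open>N/16\<close> around the words of a maximal code cover the
  cube.\<close>

lemma binary_code_exists:
  "\<exists>\<C>\<subseteq>Pow {..<N}. 2 powr (real N / 2) \<le> real (card \<C>) \<and>
    (\<forall>S\<in>\<C>. \<forall>T\<in>\<C>. S \<noteq> T \<longrightarrow> N < 16 * card (sym_diff S T))"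
proof -
  define code where "code \<C> \<longleftrightarrow> \<C> \<subseteq> Pow {..<N} \<and> (\<forall>S\<in>\<C>. \<forall>T\<in>\<C>. S \<noteq> T \<longrightarrow> N < 16 * card (sym_diff S T))" for \<C>
  have "finite {\<C>. code \<C>}" by (rule finite_subset[of _ "Pow (Pow {..<N})"]) (auto simp: code_def)
  moreover have "{} \<in> {\<C>. code \<C>}" by (simp add: code_def)
  ultimately obtain \<C> where \<C>: "code \<C>" and max: "\<And>\<D>. code \<D> \<Longrightarrow> \<C> \<subseteq> \<D> \<Longrightarrow> \<C> = \<D>"
    using finite_has_maximal[of "{\<C>. code \<C>}"] by blast
  define B where "B = {U. U \<subseteq> {..<N} \<and> 16 * card U \<le> N}"
  have fin: "finite \<C>" "finite B" using \<C> by (auto simp: code_def B_def intro: finite_subset[of _ "Pow {..<N}"])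
  have cover: "Pow {..<N} \<subseteq> (\<lambda>(S, U). sym_diff S U) ` (\<C> \<times> B)"
  proof
    fix T assume T: "T \<in> Pow {..<N}"
    have "\<exists>S\<in>\<C>. 16 * card (sym_diff S T) \<le> N"
    proof (rule ccontr)
      assume "\<not> ?thesis"
      then have far: "N < 16 * card (sym_diff S T)" if "S \<in> \<C>" for S using that by (auto simp: not_le)
      have "sym_diff T S = sym_diff S T" for S by auto
      then have "code (insert T \<C>)" using \<C> T far unfolding code_def by auto
      then have "T \<in> \<C>" using max[of "insert T \<C>"] by auto
      then show False using far[of T] by simp
    qed
    then obtain S where S: "S \<in> \<C>" "16 * card (sym_diff S T) \<le> N" by blast
    have "sym_diff S T \<in> B" using S \<C> T by (auto simp: B_def code_def)
    moreover have "T = sym_diff S (sym_diff S T)" by auto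
    ultimately show "T \<in> (\<lambda>(S, U). sym_diff S U) ` (\<C> \<times> B)" using S(1) by (intro image_eqI[of _ _ "(S, sym_diff S T)"]) auto
  qed
  have "2 ^ N = card (Pow {..<N})" by (simp add: card_Pow)
  also have "\<dots> \<le> card (\<C> \<times> B)" using fin by (intro surj_card_le[OF _ cover]) auto
  also have "\<dots> = card \<C> * card B" by (rule card_cartesian_product)
  finally have "real (2 ^ N) \<le> real (card \<C> * card B)" by (simp only: of_nat_le_iff)
  also have "\<dots> \<le> real (card \<C>) * 2 powr (real N / 2)"
    using card_small_subsets_le[of N] by (simp add: B_def mult_left_mono)
  finally have "2 powr (real N / 2) * 2 powr (real N / 2) \<le> real (card \<C>) * 2 powr (real N / 2)"
    by (simp add: powr_realpow flip: powr_add)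
  then have large: "2 powr (real N / 2) \<le> real (card \<C>)" by simp
  show ?thesis
    by (rule exI[of _ \<C>]) (intro conjI large \<C>[unfolded code_def, THEN conjunct1] \<C>[unfolded code_def, THEN conjunct2])
qed

section \<open>Lower bound for the entropy numbers\<close>

text \<open>More points than balls: two points share a ball.\<close>

lemma entropy_number_ge:
  assumes T: "T \<subseteq> unit_ball Y NY" "finite T" "2 ^ (n - 1) < card T"
    and sep: "\<And>f g c e. f \<in> T \<Longrightarrow> g \<in> T \<Longrightarrow> f \<noteq> g \<Longrightarrow> c \<in> X \<Longrightarrow> e > 0 \<Longrightarrow>
      NX (f - c) \<le> ennreal e \<Longrightarrow> NX (g - c) \<le> ennreal e \<Longrightarrow> \<sigma> \<le> e"
  shows "ennreal \<sigma> \<le> entropy_number n Y NY X NX"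
  unfolding entropy_number_def
proof (rule Inf_greatest, clarify)
  fix \<epsilon> :: real and c :: "nat \<Rightarrow> 'a"
  assume e: "\<epsilon> > 0" and c: "\<forall>i<2 ^ (n - 1). c i \<in> X"
    and cover: "unit_ball Y NY \<subseteq> (\<Union>i<2 ^ (n - 1). norm_ball X NX (c i) \<epsilon>)"
  have "\<forall>f\<in>T. \<exists>i<2 ^ (n - 1). f \<in> norm_ball X NX (c i) \<epsilon>" using T(1) cover by blast
  then obtain h where h: "\<And>f. f \<in> T \<Longrightarrow> h f < 2 ^ (n - 1) \<and> f \<in> norm_ball X NX (c (h f)) \<epsilon>" by metis
  then have "h ` T \<subseteq> {..<2 ^ (n - 1)}" by auto
  then have "card (h ` T) \<le> 2 ^ (n - 1)" using card_mono[of "{..<2 ^ (n - 1)}" "h ` T"] by simp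
  then have "\<not> inj_on h T" using T(3) by (auto dest: card_image)
  then obtain f g where fg: "f \<in> T" "g \<in> T" "f \<noteq> g" "h f = h g" by (auto simp: inj_on_def)
  have "\<sigma> \<le> \<epsilon>"
    using h[OF fg(1)] h[OF fg(2)] fg(4) c e
    by (intro sep[OF fg(1-3), of "c (h f)"]) (auto simp: norm_ball_def)
  then show "ennreal \<sigma> \<le> ennreal \<epsilon>" by (rule ennreal_leI)
qed

lemma Lp_norm_lower:
  assumes p: "p \<ge> 1" and M: "M \<ge> 0" and f: "Lp_norm p f \<le> ennreal M"
    and E: "E \<in> sets torus" "ennreal m \<le> emeasure torus E" and b: "b \<ge> 0" "m \<ge> 0" "\<And>x. x \<in> E \<Longrightarrow> b \<le> norm (f x)"
  shows "b powr p * m \<le> M powr p"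
proof -
  have "ennreal (b powr p) * ennreal m \<le> ennreal (b powr p) * emeasure torus E" using E by (intro mult_left_mono) auto
  also have "\<dots> = (\<integral>\<^sup>+ x. ennreal (b powr p) * indicator E x \<partial>torus)"
    using E by (simp add: nn_integral_cmult_indicator)
  also have "\<dots> \<le> (\<integral>\<^sup>+ x. ennreal (norm (f x) powr p) \<partial>torus)"
    using p b by (intro nn_integral_mono) (auto simp: indicator_def intro!: ennreal_leI powr_mono2)
  also have "\<dots> \<le> ennreal (M powr p)" using f Lp_norm_le_iff[OF p M] by simp
  finally show ?thesis using b M by (simp flip: ennreal_mult)
qed

lemma emeasure_torus_Icc:
  assumes "0 \<le> a" "a \<le> b" "b < 1"
  shows "{a..b} \<in> sets torus" "emeasure torus {a..b} = ennreal (b - a)"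
proof -
  have sub: "{a..b} \<subseteq> {0..<1}" using assms by auto
  then show "{a..b} \<in> sets torus" by (auto simp: sets_restrict_space)
  have "emeasure torus {a..b} = emeasure lebesgue {a..b}" using sub by (intro emeasure_restrict_space) auto
  then show "emeasure torus {a..b} = ennreal (b - a)" using assms by simp
qed

text \<open>The bump sum has modulus at least \<open>1/2\<close> on disjoint intervals of length
  \<open>1 / (192 N)\<close>, one for every point of \<open>J\<close>.\<close>

lemma bump_sum_L2_lower:
  assumes N: "N > 0" and d: "\<And>j. \<bar>d j\<bar> \<le> 1"
    and J: "J \<subseteq> {..<N}" "\<And>j. j \<in> J \<Longrightarrow> \<bar>d j\<bar> = 1" "N < 16 * card J"
  shows "(\<integral>x. (norm (bump_sum N d x))\<^sup>2 \<partial>torus) \<ge> 1 / 12288"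
proof -
  define I where "I j = {real j / real N..real j / real N + 1 / (192 * real N)}" for j
  define E where "E = (\<Union>j\<in>J. I j)"
  have finJ: "finite J" using J(1) finite_subset by blast
  have small: "1 / (192 * real N) < 1 / real N" using N by (intro divide_strict_left_mono) auto
  have I: "I j \<in> sets torus" "emeasure torus (I j) = ennreal (1 / (192 * real N))" if "j \<in> J" for j
  proof -
    have "j + 1 \<le> N" using that J(1) by auto
    then have "(real j + 1) / real N \<le> 1" using N by simp
    moreover have "real j / real N + 1 / (192 * real N) < (real j + 1) / real N"
      using small by (simp add: add_divide_distrib)
    ultimately have "real j / real N + 1 / (192 * real N) < 1" by linarith
    then show "I j \<in> sets torus" "emeasure torus (I j) = ennreal (1 / (192 * real N))"
      unfolding I_def using N by (simp_all add: emeasure_torus_Icc)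
  qed
  have disj: "disjoint_family_on I J"
  proof -
    have "I i \<inter> I j = {}" if "i < j" for i j
    proof -
      have "real i + 1 \<le> real j" using that by simp
      then have "(real i + 1) / real N \<le> real j / real N" using N by (intro divide_right_mono) auto
      moreover have "real i / real N + 1 / (192 * real N) < (real i + 1) / real N"
        using small by (simp add: add_divide_distrib)
      ultimately show ?thesis by (auto simp: I_def)
    qed
    then show ?thesis unfolding disjoint_family_on_def by (metis Int_commute linorder_neqE_nat)
  qed
  have E: "E \<in> sets torus" unfolding E_def using finJ I by (intro sets.finite_UN) auto
  have "emeasure torus E = (\<Sum>j\<in>J. emeasure torus (I j))"
    unfolding E_def using finJ I disj by (intro sum_emeasure[symmetric]) auto
  also have "\<dots> = (\<Sum>j\<in>J. ennreal (1 / (192 * real N)))" by (intro sum.cong refl I)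
  also have "\<dots> = ennreal (\<Sum>j\<in>J. 1 / (192 * real N))" by (rule sum_ennreal) simp
  also have "\<dots> \<ge> ennreal (1 / 3072)"
  proof (rule ennreal_leI)
    have "real N \<le> 16 * real (card J)" using J(3) by linarith
    then show "1 / 3072 \<le> (\<Sum>j\<in>J. 1 / (192 * real N))" using N by (simp add: field_simps)
  qed
  finally have mE: "ennreal (1 / 3072) \<le> emeasure torus E" .
  have lower: "1 / 2 \<le> norm (bump_sum N d x)" if xE: "x \<in> E" for x
  proof -
    obtain j where j: "j \<in> J" "x \<in> I j" using xE by (auto simp: E_def)
    have "1 / 2 \<le> norm (bump_sum N d (real j / real N + (x - real j / real N)))"
      using j J by (intro bump_sum_near_grid[OF N d]) (auto simp: I_def)
    then show ?thesis by simp
  qed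
  define R where "R = (\<integral>x. (norm (bump_sum N d x))\<^sup>2 \<partial>torus)"
  have R: "R \<ge> 0" by (simp add: R_def)
  have "(\<integral>\<^sup>+ x. ennreal (norm (bump_sum N d x) powr 2) \<partial>torus) = ennreal R"
    unfolding R_def
    by (subst nn_integral_eq_integral[symmetric])
       (auto intro!: integrable_torus_continuous continuous_on_power continuous_on_norm continuous_bump_sum
         nn_integral_cong simp: powr_numeral)
  also have "\<dots> \<le> ennreal (sqrt R powr 2)" using R by (simp add: powr_numeral)
  finally have "Lp_norm 2 (bump_sum N d) \<le> ennreal (sqrt R)" using R by (subst Lp_norm_le_iff) auto
  then have "(1 / 2) powr 2 * (1 / 3072) \<le> sqrt R powr 2"
    using R by (intro Lp_norm_lower[OF _ _ _ E mE _ _ lower]) auto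
  then show ?thesis using R by (simp add: R_def[symmetric] powr_numeral power_divide)
qed

text \<open>The exponent of \<open>K\<close> is \<open>1/2\<close> or \<open>1 - 1/\<nu>\<close>. For \<open>\<nu> < 2\<close> the \<open>L^2\<close> norm is used,
  which sees all points of \<open>J\<close>. For \<open>\<nu> \<ge> 2\<close> the \<open>L^K\<close> norm is used, for which a single peak of
  height \<open>K/4\<close> on an interval of length \<open>4^-K / 192\<close> suffices: the \<open>K\<close>-th root of this length is
  bounded below.\<close>

lemma lacunary_bump_separation:
  assumes adm: "admissible_exponents \<nu> \<gamma>"
  shows "\<exists>c>0. \<forall>K d J a M. K \<ge> 1 \<longrightarrow> (\<forall>j. \<bar>d j\<bar> \<le> 1) \<longrightarrow> J \<subseteq> {..<2 ^ K} \<longrightarrow> (\<forall>j\<in>J. \<bar>d j\<bar> = 1) \<longrightarrow>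
    2 ^ K < 16 * card J \<longrightarrow> a \<ge> 0 \<longrightarrow> M \<ge> 0 \<longrightarrow>
    expL_norm \<nu> (\<lambda>x. of_real a * lacunary_bump K d x) \<le> ennreal M \<longrightarrow>
    c * a * real K powr (\<gamma> - decay_exponent \<nu> \<gamma>) \<le> M"
proof (cases "\<nu> < 2")
  case True
  have "(1 / (111 * 2 powr (1 / \<nu>))) * a * real K powr (\<gamma> - decay_exponent \<nu> \<gamma>) \<le> M"
    if K: "K \<ge> 1" and d: "\<And>j. \<bar>d j\<bar> \<le> 1" and J: "J \<subseteq> {..<2 ^ K}" "\<And>j. j \<in> J \<Longrightarrow> \<bar>d j\<bar> = 1" "2 ^ K < 16 * card J"
      and a: "a \<ge> 0" and M: "M \<ge> 0" and D: "expL_norm \<nu> (\<lambda>x. of_real a * lacunary_bump K d x) \<le> ennreal M"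
    for K d J a M
  proof -
    define M' where "M' = M * 2 powr (1 / \<nu>)"
    have M': "M' \<ge> 0" using M by (simp add: M'_def)
    have c: "continuous_on UNIV (\<lambda>x. (norm (complex_of_real a * lacunary_bump K d x))\<^sup>2)"
      by (intro continuous_on_power continuous_on_norm continuous_on_mult continuous_on_const continuous_lacunary_bump)
    have "Lp_norm 2 (\<lambda>x. of_real a * lacunary_bump K d x) \<le> ennreal M'"
      using D M expL_norm_le_iff[OF M, of \<nu>] unfolding M'_def by auto
    then have "(\<integral>\<^sup>+ x. ennreal (norm (of_real a * lacunary_bump K d x) powr 2) \<partial>torus) \<le> ennreal (M' powr 2)"
      using M' by (subst (asm) Lp_norm_le_iff) auto
    also have "(\<integral>\<^sup>+ x. ennreal (norm (of_real a * lacunary_bump K d x) powr 2) \<partial>torus)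
       = (\<integral>\<^sup>+ x. ennreal ((norm (of_real a * lacunary_bump K d x))\<^sup>2) \<partial>torus)"
      by (intro nn_integral_cong) (simp add: powr_numeral)
    also have "\<dots> = ennreal (\<integral>x. (norm (of_real a * lacunary_bump K d x))\<^sup>2 \<partial>torus)"
      by (intro nn_integral_eq_integral integrable_torus_continuous c AE_I2) simp
    finally have "(\<integral>x. (norm (of_real a * lacunary_bump K d x))\<^sup>2 \<partial>torus) \<le> M'\<^sup>2"
      using M' by (simp add: powr_numeral)
    moreover have "(\<integral>x. (norm (of_real a * lacunary_bump K d x))\<^sup>2 \<partial>torus)
       = a\<^sup>2 * (real K * (\<integral>x. (norm (bump_sum (2 ^ K) d x))\<^sup>2 \<partial>torus))"
      unfolding norm_mult power_mult_distrib integral_mult_right_zero lacunary_bump_L2[OF K] by simp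
    moreover have "a\<^sup>2 * (real K * (1 / 12288)) \<le> a\<^sup>2 * (real K * (\<integral>x. (norm (bump_sum (2 ^ K) d x))\<^sup>2 \<partial>torus))"
      using bump_sum_L2_lower[of "2 ^ K" d J] d J by (intro mult_left_mono) auto
    ultimately have le: "a\<^sup>2 * (real K * (1 / 12288)) \<le> M'\<^sup>2" by linarith
    \<comment> \<open>\<open>111^2 = 12321\<close> is the next square after 12288\<close>
    have "(a * sqrt (real K) / 111)\<^sup>2 = a\<^sup>2 * (real K * (1 / 12321))"
      by (simp add: power_divide power_mult_distrib)
    also have "\<dots> \<le> a\<^sup>2 * (real K * (1 / 12288))" by (intro mult_left_mono) auto
    finally have "(a * sqrt (real K) / 111)\<^sup>2 \<le> M'\<^sup>2" using le by linarith
    then have "a * sqrt (real K) / 111 \<le> M'" using M' by (rule power2_le_imp_le)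
    moreover have "sqrt (real K) = real K powr (\<gamma> - decay_exponent \<nu> \<gamma>)"
      using True by (simp add: decay_exponent_def powr_half_sqrt)
    ultimately show ?thesis unfolding M'_def by (simp add: field_simps)
  qed
  note main = this
  show ?thesis
    by (intro exI[of _ "1 / (111 * 2 powr (1 / \<nu>))"] conjI allI impI; (rule main)?; (assumption | blast | simp))
next
  case False
  have "(1 / 3072) * a * real K powr (\<gamma> - decay_exponent \<nu> \<gamma>) \<le> M"
    if K: "K \<ge> 1" and d: "\<And>j. \<bar>d j\<bar> \<le> 1" and J: "J \<subseteq> {..<2 ^ K}" "\<And>j. j \<in> J \<Longrightarrow> \<bar>d j\<bar> = 1" "2 ^ K < 16 * card J"
      and a: "a \<ge> 0" and M: "M \<ge> 0" and D: "expL_norm \<nu> (\<lambda>x. of_real a * lacunary_bump K d x) \<le> ennreal M"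
    for K d J a M
  proof -
    have "J \<noteq> {}" using J(3) by auto
    then obtain i where i: "i \<in> J" by blast
    then have i': "i < 2 ^ K" "\<bar>d i\<bar> = 1" using J by auto
    define \<delta> :: real where "\<delta> = 1 / (192 * 4 ^ K)"
    have \<delta>: "\<delta> > 0" by (simp add: \<delta>_def)
    define M' where "M' = M * real K powr (1 / \<nu>)"
    have M': "M' \<ge> 0" using M by (simp add: M'_def)
    define E where "E = {real i / 2 ^ K..real i / 2 ^ K + \<delta>}"
    have "real i / 2 ^ K + \<delta> < 1"
    proof -
      have "real (i + 1) \<le> real (2 ^ K)" using i'(1) by (simp only: of_nat_le_iff)
      then have "(real i + 1) / 2 ^ K \<le> 1" by simp
      moreover have "\<delta> < 1 / 2 ^ K"
      proof -
        have "(2::real) ^ K \<le> 4 ^ K" by (intro power_mono) auto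
        then have "(2::real) ^ K < 192 * 4 ^ K" using zero_less_power[of "4::real" K] by linarith
        then show ?thesis unfolding \<delta>_def by (intro divide_strict_left_mono) auto
      qed
      ultimately show ?thesis by (simp add: add_divide_distrib)
    qed
    then have E: "E \<in> sets torus" "ennreal \<delta> \<le> emeasure torus E"
      unfolding E_def using \<delta> by (simp_all add: emeasure_torus_Icc)
    have Lf: "Lp_norm (real K) (\<lambda>x. of_real a * lacunary_bump K d x) \<le> ennreal M'"
      using D M K expL_norm_le_iff[OF M, of \<nu>] unfolding M'_def by auto
    have "(a * (real K / 4)) powr real K * \<delta> \<le> M' powr real K"
    proof (rule Lp_norm_lower[OF _ M' Lf E])
      fix x assume "x \<in> E"
      then have "real K / 4 \<le> norm (lacunary_bump K d (real i / 2 ^ K + (x - real i / 2 ^ K)))"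
        by (intro lacunary_bump_peak[where d = d and i = i, OF K d i']) (auto simp: E_def \<delta>_def)
      then have "a * (real K / 4) \<le> a * norm (lacunary_bump K d x)"
        using a by (intro mult_left_mono) auto
      then show "a * (real K / 4) \<le> norm (complex_of_real a * lacunary_bump K d x)"
        using a by (simp only: norm_mult norm_of_real abs_of_nonneg)
    qed (use K a \<delta> in auto)
    moreover have "(1 / 768) ^ K \<le> \<delta>"
    proof -
      have "(192::real) ^ 1 \<le> 192 ^ K" using K by (intro power_increasing) auto
      then have "(192::real) * 4 ^ K \<le> 192 ^ K * 4 ^ K" by (intro mult_right_mono) auto
      also have "\<dots> = 768 ^ K" by (simp flip: power_mult_distrib)
      finally show ?thesis unfolding \<delta>_def power_one_over by (intro divide_left_mono) auto
    qed
    then have "(a * (real K / 4)) powr real K * (1 / 768) ^ K \<le> (a * (real K / 4)) powr real K * \<delta>"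
      by (intro mult_left_mono) auto
    ultimately have "(a * (real K / 4)) powr real K * (1 / 768) ^ K \<le> M' powr real K" by linarith
    moreover have "(a * (real K / 4)) powr real K * (1 / 768) ^ K = (a * (real K / 4) * (1 / 768)) powr real K"
      using a by (subst powr_mult) (auto simp: powr_realpow)
    ultimately have pw: "(a * (real K / 4) * (1 / 768)) powr real K \<le> M' powr real K" by linarith
    have "a * (real K / 4) * (1 / 768) \<le> M'"
    proof (rule ccontr)
      assume "\<not> ?thesis"
      then have "M' powr real K < (a * (real K / 4) * (1 / 768)) powr real K"
        using K M' by (intro powr_less_mono2) auto
      then show False using pw by linarith
    qed
    then have le: "a * real K / 3072 \<le> M * real K powr (1 / \<nu>)" by (simp add: M'_def)
    define Q where "Q = real K powr (1 / \<nu>)"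
    define R where "R = real K powr (\<gamma> - decay_exponent \<nu> \<gamma>)"
    have "R * Q = real K"
      using False K unfolding R_def Q_def powr_add[symmetric] by (simp add: decay_exponent_def)
    then have "(1 / 3072 * a * R) * Q = a * real K / 3072" by (simp add: mult.assoc)
    then have "(1 / 3072 * a * R) * Q \<le> M * Q" using le by (simp only: Q_def)
    moreover have "Q > 0" using K by (simp add: Q_def)
    ultimately show ?thesis unfolding R_def by (rule mult_right_le_imp_le)
  qed
  note main = this
  show ?thesis
    by (intro exI[of _ "1 / 3072"] conjI allI impI; (rule main)?; (assumption | blast | simp))
qed

text \<open>The functions are indexed by the words of a code of length \<open>2^K\<close>. If two of them are within
  \<open>e\<close> of a common centre, their difference has norm at most \<open>4 * e\<close>.\<close>

lemma entropy_lower_dyadic: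
  assumes \<Phi>: "admissible_cutoff \<Phi>" and adm: "admissible_exponents \<nu> \<gamma>"
  shows "\<exists>c>0. \<forall>K n. K \<ge> 1 \<longrightarrow> n \<ge> 1 \<longrightarrow> n \<le> 2 ^ (K - 1) \<longrightarrow>
    ennreal (c * real K powr - decay_exponent \<nu> \<gamma>) \<le> entropy_number n (LG \<Phi> \<gamma>) (LG_norm \<Phi> \<gamma>) (expL \<nu>) (expL_norm \<nu>)"
proof -
  note pos = admissible_exponentsD[OF adm]
  obtain C where C: "C > 0" and bdd: "\<And>K d. K \<ge> 1 \<Longrightarrow> (\<And>j. \<bar>d j\<bar> \<le> 1) \<Longrightarrow>
    shell_bounded \<gamma> (C * real K powr \<gamma>) (LP_coeff \<Phi> (lacunary_bump K d))"
    using lacunary_bump_shell_bounded[OF \<Phi>, of \<gamma>] pos by auto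
  from lacunary_bump_separation[OF adm]
  obtain c where c: "c > 0" and sep: "\<forall>K d J a M. K \<ge> 1 \<longrightarrow> (\<forall>j. \<bar>d j\<bar> \<le> 1) \<longrightarrow> J \<subseteq> {..<2 ^ K} \<longrightarrow> (\<forall>j\<in>J. \<bar>d j\<bar> = 1) \<longrightarrow>
    2 ^ K < 16 * card J \<longrightarrow> a \<ge> 0 \<longrightarrow> M \<ge> 0 \<longrightarrow>
    expL_norm \<nu> (\<lambda>x. of_real a * lacunary_bump K d x) \<le> ennreal M \<longrightarrow>
    c * a * real K powr (\<gamma> - decay_exponent \<nu> \<gamma>) \<le> M"
    by (elim exE conjE)
  have "ennreal (c / (4 * C) * real K powr - decay_exponent \<nu> \<gamma>)
      \<le> entropy_number n (LG \<Phi> \<gamma>) (LG_norm \<Phi> \<gamma>) (expL \<nu>) (expL_norm \<nu>)"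
    if K: "K \<ge> 1" and n: "n \<ge> 1" "n \<le> 2 ^ (K - 1)" for K n
  proof -
    \<comment> \<open>the factor that puts the test functions into the unit ball\<close>
    define a where "a = 1 / (C * real K powr \<gamma>)"
    have Kp: "real K powr \<gamma> > 0" using K by simp
    have a: "a > 0" using C Kp by (simp add: a_def)
    define \<sigma> where "\<sigma> = c / (4 * C) * real K powr - decay_exponent \<nu> \<gamma>"
    have \<sigma>: "\<sigma> > 0" using c C K by (simp add: \<sigma>_def)
    have \<sigma>_eq: "c * a * real K powr (\<gamma> - decay_exponent \<nu> \<gamma>) = 4 * \<sigma>"
      using Kp C by (simp add: \<sigma>_def a_def powr_diff powr_minus field_simps)
    from binary_code_exists[of "2 ^ K"]
    obtain \<C> where \<C>: "\<C> \<subseteq> Pow {..<(2::nat) ^ K}" "2 powr (real (2 ^ K) / 2) \<le> real (card \<C>)"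
      "\<forall>S\<in>\<C>. \<forall>T\<in>\<C>. S \<noteq> T \<longrightarrow> 2 ^ K < 16 * card (sym_diff S T)"
      by (elim exE conjE)
    define F where "F S x = of_real a * lacunary_bump K (indicator S) x" for S x
    have ind: "\<bar>indicat_real S j\<bar> \<le> 1" for S j by (simp add: indicator_def)
    have cF: "continuous_on UNIV (F S)" for S
      unfolding F_def by (intro continuous_on_mult continuous_on_const continuous_lacunary_bump)
    have unit: "F S \<in> unit_ball (LG \<Phi> \<gamma>) (LG_norm \<Phi> \<gamma>)" for S
    proof -
      have "periodic1 (F S)" using lacunary_bump_periodic[of K "indicator S"] by (simp add: periodic1_def F_def)
      moreover have "integrable torus (F S)" by (rule integrable_torus_continuous[OF cF])
      moreover have "LG_norm \<Phi> \<gamma> (F S) \<le> ennreal 1"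
      proof (subst LG_norm_le_iff[OF \<Phi>], simp, unfold shell_bounded_def, intro allI)
        fix k x
        have "LP_coeff \<Phi> (F S) k n = of_real a * LP_coeff \<Phi> (lacunary_bump K (indicator S)) k n" for n
          unfolding LP_coeff_def F_def fourier_coeff_cmult by simp
        then have "tsum (dyadic_shell k) (LP_coeff \<Phi> (F S) k) x
            = of_real a * tsum (dyadic_shell k) (LP_coeff \<Phi> (lacunary_bump K (indicator S)) k) x"
          by (simp add: tsum_def sum_distrib_left mult.assoc)
        then have "norm (tsum (dyadic_shell k) (LP_coeff \<Phi> (F S) k) x)
            = a * norm (tsum (dyadic_shell k) (LP_coeff \<Phi> (lacunary_bump K (indicator S)) k) x)"
          using a by (simp add: norm_mult)
        also have "\<dots> \<le> a * (C * real K powr \<gamma> * (1 + real k) powr - \<gamma>)"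
          using bdd[of K "indicator S", OF K ind] a unfolding shell_bounded_def by (intro mult_left_mono) auto
        also have "\<dots> = 1 * (1 + real k) powr - \<gamma>" using C Kp by (simp add: a_def)
        finally show "norm (tsum (dyadic_shell k) (LP_coeff \<Phi> (F S) k) x) \<le> 1 * (1 + real k) powr - \<gamma>" .
      qed
      ultimately show ?thesis by (auto simp: unit_ball_def LG_def intro: le_less_trans)
    qed
    have far: "\<sigma> \<le> e" if S: "S \<in> \<C>" "T \<in> \<C>" "S \<noteq> T" and g: "g \<in> expL \<nu>" and e: "e > 0"
      and near: "expL_norm \<nu> (F S - g) \<le> ennreal e" "expL_norm \<nu> (F T - g) \<le> ennreal e" for S T g e
    proof -
      define d where "d j = indicat_real S j - indicat_real T j" for j
      have "expL_norm \<nu> (\<lambda>x. of_real a * lacunary_bump K d x) \<le> ennreal (4 * e)"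
      proof (rule expL_norm_quasi_triangle[OF _ _ _ near])
        have mg: "g \<in> borel_measurable torus" using g by (simp add: expL_def)
        have "(\<lambda>x. F S x - g x) \<in> borel_measurable torus" for S
          by (intro borel_measurable_diff borel_measurable_torus_continuous cF mg)
        then show "F S - g \<in> borel_measurable torus" "F T - g \<in> borel_measurable torus"
          by (simp_all add: fun_diff_def)
        have "of_real a * lacunary_bump K d x = (F S - g) x - (F T - g) x" for x
          unfolding d_def lacunary_bump_diff by (simp add: F_def algebra_simps)
        then show "AE x in torus. norm (of_real a * lacunary_bump K d x) \<le> norm ((F S - g) x) + norm ((F T - g) x)"
          by (intro AE_I2) (simp only: norm_triangle_ineq4)
      qed (use e in simp)
      then have "c * a * real K powr (\<gamma> - decay_exponent \<nu> \<gamma>) \<le> 4 * e"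
        using \<C>(1) \<C>(3)[rule_format, OF S] S a e
        K
        by (intro sep[rule_format, where J = "sym_diff S T" and d = d]) (auto simp: d_def indicator_def)
      then show ?thesis unfolding \<sigma>_eq by simp
    qed
    have inj: "inj_on F \<C>"
    proof (rule inj_onI, rule ccontr)
      fix S T assume S: "S \<in> \<C>" "T \<in> \<C>" "F S = F T" "S \<noteq> T"
      have z: "expL_norm \<nu> (F S - F S) \<le> ennreal (\<sigma> / 2)"
        using \<sigma> by (intro expL_norm_bounded[OF pos(1)]) auto
      have "F S \<in> expL \<nu>" using unit LG_subset_expL[OF \<Phi> adm] by (auto simp: unit_ball_def)
      then have "\<sigma> \<le> \<sigma> / 2" using far[of S T "F S" "\<sigma> / 2"] S z \<sigma> by simp
      then show False using \<sigma> by simp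
    qed
    have fin: "finite \<C>" using \<C>(1) by (rule finite_subset) simp
    have "ennreal \<sigma> \<le> entropy_number n (LG \<Phi> \<gamma>) (LG_norm \<Phi> \<gamma>) (expL \<nu>) (expL_norm \<nu>)"
    proof (rule entropy_number_ge[where T = "F ` \<C>"])
      show "F ` \<C> \<subseteq> unit_ball (LG \<Phi> \<gamma>) (LG_norm \<Phi> \<gamma>)" using unit by blast
      show "finite (F ` \<C>)" using fin by simp
      have "2 * 2 ^ (K - 1) = (2::real) ^ K" using K by (cases K) auto
      then have "real (2 ^ K) / 2 = real (2 ^ (K - 1))" by simp
      then have "2 powr (real (2 ^ (K - 1))) \<le> real (card \<C>)" using \<C>(2) by simp
      then have "real (2 ^ 2 ^ (K - 1)) \<le> real (card \<C>)" by (subst (asm) powr_realpow) auto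
      then have "2 ^ 2 ^ (K - 1) \<le> card \<C>" by (simp only: of_nat_le_iff)
      moreover have "(2::nat) ^ (n - 1) < 2 ^ 2 ^ (K - 1)"
        using n by (intro power_strict_increasing) linarith+
      ultimately show "2 ^ (n - 1) < card (F ` \<C>)" unfolding card_image[OF inj] by linarith
      fix f h g e assume "f \<in> F ` \<C>" "h \<in> F ` \<C>" "f \<noteq> h" "g \<in> expL \<nu>" "e > 0"
        "expL_norm \<nu> (f - g) \<le> ennreal e" "expL_norm \<nu> (h - g) \<le> ennreal e"
      then show "\<sigma> \<le> e" using far by blast
    qed
    then show ?thesis by (simp add: \<sigma>_def)
  qed
  then show ?thesis using c C by (intro exI[of _ "c / (4 * C)"]) auto
qed

text \<open>The smallest \<open>L\<close> with \<open>n \<le> 2^L\<close> satisfies \<open>L + 1 \<le> 5 ln n\<close>.\<close>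

lemma entropy_lower:
  assumes \<Phi>: "admissible_cutoff \<Phi>" and adm: "admissible_exponents \<nu> \<gamma>"
  shows "\<exists>c>0. \<forall>n\<ge>2. ennreal (c * ln (real n) powr - decay_exponent \<nu> \<gamma>)
    \<le> entropy_number n (LG \<Phi> \<gamma>) (LG_norm \<Phi> \<gamma>) (expL \<nu>) (expL_norm \<nu>)"
proof -
  define \<beta> where "\<beta> = decay_exponent \<nu> \<gamma>"
  have \<beta>: "\<beta> > 0" using admissible_exponentsD[OF adm] by (simp add: \<beta>_def)
  obtain c where c: "c > 0" and low: "\<And>K n. K \<ge> 1 \<Longrightarrow> n \<ge> 1 \<Longrightarrow> n \<le> 2 ^ (K - 1) \<Longrightarrow>
    ennreal (c * real K powr - \<beta>) \<le> entropy_number n (LG \<Phi> \<gamma>) (LG_norm \<Phi> \<gamma>) (expL \<nu>) (expL_norm \<nu>)"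
    using entropy_lower_dyadic[OF \<Phi> adm] unfolding \<beta>_def by blast
  have "ennreal (c * 5 powr - \<beta> * ln (real n) powr - \<beta>) \<le> entropy_number n (LG \<Phi> \<gamma>) (LG_norm \<Phi> \<gamma>) (expL \<nu>) (expL_norm \<nu>)"
    if n: "n \<ge> 2" for n
  proof -
    have ex: "\<exists>L. n \<le> 2 ^ L" using less_exp[of n] less_imp_le by blast
    define L where "L = (LEAST L. n \<le> 2 ^ L)"
    have L: "n \<le> 2 ^ L" unfolding L_def by (rule LeastI_ex[OF ex])
    have "L \<noteq> 0" using L n by (cases L) auto
    then obtain l where l: "L = Suc l" by (cases L) auto
    have "\<not> n \<le> 2 ^ l" using not_less_Least[of l "\<lambda>L. n \<le> 2 ^ L"] l by (simp add: L_def[symmetric])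
    then have "real (2 ^ l) \<le> real n" by simp
    then have "ln (2 ^ l) \<le> ln (real n)" using n by (subst ln_le_cancel_iff) auto
    then have "real l * ln 2 \<le> ln (real n)" by (simp add: ln_realpow)
    moreover have "real l * (2 / 3) \<le> real l * ln 2" using ln2_ge_two_thirds by (intro mult_left_mono) auto
    moreover have "ln 2 \<le> ln (real n)" using n by simp
    ultimately have "real (L + 1) \<le> 5 * ln (real n)" using ln2_ge_two_thirds unfolding l by simp
    then have "(5 * ln (real n)) powr - \<beta> \<le> real (L + 1) powr - \<beta>"
      using \<beta> n by (intro powr_mono2') auto
    then have "c * 5 powr - \<beta> * ln (real n) powr - \<beta> \<le> c * real (L + 1) powr - \<beta>"
      using c n by (simp add: powr_mult)
    then have "ennreal (c * 5 powr - \<beta> * ln (real n) powr - \<beta>) \<le> ennreal (c * real (L + 1) powr - \<beta>)"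
      by (rule ennreal_leI)
    also have "\<dots> \<le> entropy_number n (LG \<Phi> \<gamma>) (LG_norm \<Phi> \<gamma>) (expL \<nu>) (expL_norm \<nu>)"
      using L n by (intro low) auto
    finally show ?thesis .
  qed
  then show ?thesis using c unfolding \<beta>_def by (intro exI[of _ "c * 5 powr - \<beta>"]) (simp add: \<beta>_def)
qed

lemma entropy_comparable:
  assumes "admissible_cutoff \<Phi>" "admissible_exponents \<nu> \<gamma>"
  shows "comparable_from_2 (\<lambda>n. entropy_number n (LG \<Phi> \<gamma>) (LG_norm \<Phi> \<gamma>) (expL \<nu>) (expL_norm \<nu>))
    (\<lambda>n. ln (real n) powr - decay_exponent \<nu> \<gamma>)"
  using entropy_lower[OF assms] entropy_upper[OF assms] unfolding comparable_from_2_def by blast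

theorem theorem1p3:
  fixes \<Phi> :: "real \<Rightarrow> real" and \<nu> \<gamma> :: real
  assumes "admissible_cutoff \<Phi>"
    and "\<nu> > 0"
  shows "((\<gamma> > 1/2 \<and> \<nu> < 2) \<or> (\<nu> \<ge> 2 \<and> \<gamma> > 1 - 1/\<nu>) \<longrightarrow>
            compact_embedding (LG \<Phi> \<gamma>) (LG_norm \<Phi> \<gamma>) (expL \<nu>) (expL_norm \<nu>)) \<and>
         (\<gamma> > 1/2 \<and> \<nu> < 2 \<longrightarrow>
            comparable_from_2
              (\<lambda>n. entropy_number n (LG \<Phi> \<gamma>) (LG_norm \<Phi> \<gamma>) (expL \<nu>) (expL_norm \<nu>))
              (\<lambda>n. ln (real n) powr (1/2 - \<gamma>))) \<and>
         (\<nu> \<ge> 2 \<and> \<gamma> > 1 - 1/\<nu> \<longrightarrow>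
            comparable_from_2
              (\<lambda>n. entropy_number n (LG \<Phi> \<gamma>) (LG_norm \<Phi> \<gamma>) (expL \<nu>) (expL_norm \<nu>))
              (\<lambda>n. ln (real n) powr (1 - \<gamma> - 1/\<nu>)))"
proof (intro conjI impI)
  assume "(\<gamma> > 1/2 \<and> \<nu> < 2) \<or> (\<nu> \<ge> 2 \<and> \<gamma> > 1 - 1/\<nu>)"
  then have "admissible_exponents \<nu> \<gamma>" using assms(2) by (simp add: admissible_exponents_def)
  then show "compact_embedding (LG \<Phi> \<gamma>) (LG_norm \<Phi> \<gamma>) (expL \<nu>) (expL_norm \<nu>)"
    by (rule LG_compact_embedding[OF assms(1)])
next
  assume *: "\<gamma> > 1/2 \<and> \<nu> < 2"
  then have "admissible_exponents \<nu> \<gamma>" using assms(2) by (simp add: admissible_exponents_def)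
  moreover have "- decay_exponent \<nu> \<gamma> = 1/2 - \<gamma>" using * by (simp add: decay_exponent_def)
  ultimately show "comparable_from_2
      (\<lambda>n. entropy_number n (LG \<Phi> \<gamma>) (LG_norm \<Phi> \<gamma>) (expL \<nu>) (expL_norm \<nu>))
      (\<lambda>n. ln (real n) powr (1/2 - \<gamma>))"
    using entropy_comparable[OF assms(1)] by metis
next
  assume *: "\<nu> \<ge> 2 \<and> \<gamma> > 1 - 1/\<nu>"
  then have "admissible_exponents \<nu> \<gamma>" using assms(2) by (simp add: admissible_exponents_def)
  moreover have "- decay_exponent \<nu> \<gamma> = 1 - \<gamma> - 1/\<nu>" using * by (simp add: decay_exponent_def)
  ultimately show "comparable_from_2
      (\<lambda>n. entropy_number n (LG \<Phi> \<gamma>) (LG_norm \<Phi> \<gamma>) (expL \<nu>) (expL_norm \<nu>))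
      (\<lambda>n. ln (real n) powr (1 - \<gamma> - 1/\<nu>))"
    using entropy_comparable[OF assms(1)] by metis
qed

end
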